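(* Let $n\ge 2$. For each $i=1,\ldots,n$, let $\mathcal{H}_{k_i}$ be either the Hardy space or the Dirichlet space over $\mathbb{D}$, and let $\mathcal{Q}_i$ be a proper closed $M_z^*$-invariant subspace of $\mathcal{H}_{k_i}$. If $\mathcal{Q}_i^\perp$ is a zero-based $M_z$-invariant subspace of $\mathcal{H}_{k_i}$ for every $i=1,\ldots,n$, then $$\operatorname{mult}_{M_{\boldsymbol{z}}|_{(\mathcal{Q}_1\otimes\cdots\otimes\mathcal{Q}_n)^\perp}}\big((\mathcal{Q}_1\otimes\cdots\otimes\mathcal{Q}_n)^\perp\big)=n,$$ where $(\mathcal{Q}_1\otimes\cdots\otimes\mathcal{Q}_n)^\perp$ is the orthogonal complement in $\mathcal{H}_{k_1}\otimes\cdots\otimes\mathcal{H}_{k_n}$.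
   Context: $\mathbb{D}$ is the open unit disc in $\mathbb{C}$. The Hardy space (resp. Dirichlet space) over $\mathbb{D}$ is the Hilbert space of analytic functions $f(z)=\sum_{m\ge0}a_mz^m$ on $\mathbb{D}$ with $\|f\|^2=\sum_m|a_m|^2<\infty$ (resp. $\|f\|^2=\sum_m(m+1)|a_m|^2<\infty$). $M_z$ denotes multiplication by the coordinate function $z$. Zero-based invariant subspace: a closed subspace $\mathcal{S}$ with $z\mathcal{S}\subseteq\mathcal{S}$ for which there exists $\lambda\in\mathbb{D}$ with $f(\lambda)=0$ for all $f\in\mathcal{S}$. Multiplicity: for a commuting tuple $A=(A_1,\ldots,A_m)$ ($m\ge 1$) of bounded linear operators on a Hilbert space $\mathcal{H}$ and $G\subseteq\mathcal{H}$, put $[G]_A=\overline{\operatorname{span}}\{A_1^{k_1}\cdots A_m^{k_m}g : g\in G,\ k_1,\ldots,k_m\in\mathbb{Z}_+\}$, where $\mathbb{Z}_+=\{0,1,2,\ldots\}$, and $\operatorname{mult}_A(\mathcal{H})=\min\{\#G : G\subseteq\mathcal{H},\ [G]_A=\mathcal{H}\}$. $M_{\boldsymbol{z}}=(M_{z_1},\ldots,M_{z_n})$ is the commuting tuple on the Hilbert space tensor product $\mathcal{H}_{k_1}\otimes\cdots\otimes\mathcal{H}_{k_n}$ (identified with a space of analytic functions on the polydisc $\mathbb{D}^n$), where $M_{z_i}=I\otimes\cdots\otimes M_z\otimes\cdots\otimes I$ with $M_z$ acting in the $i$-th factor. $(\mathcal{Q}_1\otimes\cdots\otimes\mathcal{Q}_n)^\perp$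 is invariant under each $M_{z_i}$. *)

theory Defs
  imports
    "HOL-Complex_Analysis.Complex_Analysis"
    "HOL-Library.Function_Algebras"
    "HOL-Library.Extended_Nat"
begin

section \<open>Hilbert spaces of functions\<close>

text \<open>
  A Hilbert space of complex-valued functions is given by its set of vectors and its inner
  product (linear in the first argument).  A closed subspace \<open>S\<close> of \<open>H\<close>, regarded as a Hilbert
  space of its own, is \<open>H\<lparr>vecs := S\<rparr>\<close>.
\<close>

record 'x function_space =
  vecs :: "('x \<Rightarrow> complex) set"
  ip :: "('x \<Rightarrow> complex) \<Rightarrow> ('x \<Rightarrow> complex) \<Rightarrow> complex"

interpretation cfun: vector_space "\<lambda>(c::complex) (f::'x \<Rightarrow> complex) x. c * f x"
  by unfold_locales (auto simp: fun_eq_iff algebra_simps)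

definition hnorm :: "'x function_space \<Rightarrow> ('x \<Rightarrow> complex) \<Rightarrow> real" where
  "hnorm H f = sqrt (Re (ip H f f))"

definition hclosure :: "'x function_space \<Rightarrow> ('x \<Rightarrow> complex) set \<Rightarrow> ('x \<Rightarrow> complex) set" where
  "hclosure H S = {f \<in> vecs H. \<forall>e>0. \<exists>g\<in>S. hnorm H (f - g) < e}"

definition closed_subspace :: "'x function_space \<Rightarrow> ('x \<Rightarrow> complex) set \<Rightarrow> bool" where
  "closed_subspace H S \<longleftrightarrow> S \<subseteq> vecs H \<and> cfun.subspace S \<and> hclosure H S = S"

definition orth_compl :: "'x function_space \<Rightarrow> ('x \<Rightarrow> complex) set \<Rightarrow> ('x \<Rightarrow> complex) set" where
  "orth_compl H S = {f \<in> vecs H. \<forall>g\<in>S. ip H f g = 0}"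

definition adjoint_op ::
  "'x function_space \<Rightarrow> (('x \<Rightarrow> complex) \<Rightarrow> ('x \<Rightarrow> complex)) \<Rightarrow> ('x \<Rightarrow> complex) \<Rightarrow> ('x \<Rightarrow> complex)"
where
  "adjoint_op H T f = (THE g. g \<in> vecs H \<and> (\<forall>h\<in>vecs H. ip H (T h) f = ip H h g))"


section \<open>Multiplicity of a commuting tuple\<close>

text \<open>
  The product of the powers \<open>A i ^^ k i\<close> applied to \<open>g\<close>.  The fold over the index type is
  meaningful because the members of the tuple commute, so that their order does not matter.
\<close>

definition tuple_power ::
  "('n::finite \<Rightarrow> ('x \<Rightarrow> complex) \<Rightarrow> ('x \<Rightarrow> complex)) \<Rightarrow> ('n \<Rightarrow> nat) \<Rightarrow> ('x \<Rightarrow> complex) \<Rightarrow> ('x \<Rightarrow> complex)"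
where
  "tuple_power A k g = Finite_Set.fold (\<lambda>i. A i ^^ k i) g UNIV"

definition generated ::
  "'x function_space \<Rightarrow> ('n::finite \<Rightarrow> ('x \<Rightarrow> complex) \<Rightarrow> ('x \<Rightarrow> complex)) \<Rightarrow>
    ('x \<Rightarrow> complex) set \<Rightarrow> ('x \<Rightarrow> complex) set"
where
  "generated H A G = hclosure H (cfun.span {tuple_power A k g | k g. g \<in> G})"

text \<open>
  Infinite cardinalities are not distinguished.  The infimum is attained, since \<open>enat\<close> is
  well-ordered and \<open>G = vecs H\<close> generates.
\<close>

definition tuple_multiplicity ::
  "'x function_space \<Rightarrow> ('n::finite \<Rightarrow> ('x \<Rightarrow> complex) \<Rightarrow> ('x \<Rightarrow> complex)) \<Rightarrow> enat"
where
  "tuple_multiplicity H A =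
    (INF G \<in> {G. G \<subseteq> vecs H \<and> generated H A G = vecs H}. if finite G then enat (card G) else \<infinity>)"


section \<open>The Hardy and the Dirichlet space over the unit disc\<close>

datatype disc_space = Hardy | Dirichlet

fun weight :: "disc_space \<Rightarrow> nat \<Rightarrow> real" where
  "weight Hardy m = 1"
| "weight Dirichlet m = real m + 1"

text \<open>
  A function on the disc is represented by its extension by zero, so that equality of
  vectors is equality of HOL functions.
\<close>

definition disc_hilbert :: "disc_space \<Rightarrow> complex function_space" where
  "disc_hilbert K =
    \<lparr>vecs = {f. f holomorphic_on ball 0 1 \<and> (\<forall>z. z \<notin> ball 0 1 \<longrightarrow> f z = 0) \<and>
               summable (\<lambda>m. weight K m * (cmod (fps_nth (fps_expansion f 0) m))\<^sup>2)},
     ip = (\<lambda>f g. \<Sum>m. complex_of_real (weight K m) *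
               fps_nth (fps_expansion f 0) m * cnj (fps_nth (fps_expansion g 0) m))\<rparr>"

definition mult_z :: "(complex \<Rightarrow> complex) \<Rightarrow> complex \<Rightarrow> complex" where
  "mult_z f = (\<lambda>z. z * f z)"

definition zero_based :: "complex function_space \<Rightarrow> (complex \<Rightarrow> complex) set \<Rightarrow> bool" where
  "zero_based H S \<longleftrightarrow> closed_subspace H S \<and> mult_z ` S \<subseteq> S \<and> (\<exists>l\<in>ball 0 1. \<forall>f\<in>S. f l = 0)"


section \<open>Hilbert space tensor products over the polydisc\<close>

definition polydisc :: "(complex ^ 'n) set" where
  "polydisc = {z. \<forall>i. z $ i \<in> ball 0 1}"

definition monomial :: "('n::finite \<Rightarrow> nat) \<Rightarrow> complex ^ 'n \<Rightarrow> complex" where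
  "monomial \<alpha> z = (\<Prod>i\<in>UNIV. (z $ i) ^ \<alpha> i)"

definition has_power_series :: "(complex ^ 'n \<Rightarrow> complex) \<Rightarrow> (('n::finite \<Rightarrow> nat) \<Rightarrow> complex) \<Rightarrow> bool" where
  "has_power_series f a \<longleftrightarrow> (\<forall>z\<in>polydisc. ((\<lambda>\<alpha>. a \<alpha> * monomial \<alpha> z) has_sum f z) UNIV)"

definition power_series_coeff :: "(complex ^ 'n \<Rightarrow> complex) \<Rightarrow> ('n::finite \<Rightarrow> nat) \<Rightarrow> complex" where
  "power_series_coeff f = (THE a. has_power_series f a)"

definition tensor_weight :: "('n::finite \<Rightarrow> disc_space) \<Rightarrow> ('n \<Rightarrow> nat) \<Rightarrow> real" where
  "tensor_weight K \<alpha> = (\<Prod>i\<in>UNIV. weight (K i) (\<alpha> i))"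

text \<open>
  The tensor product of the spaces \<open>disc_hilbert (K i)\<close>, with the elementary tensor of functions
  \<open>f i\<close> identified with the function \<open>\<Prod>i. f i (z $ i)\<close> on the polydisc.  The monomials
  \<open>z ^ \<alpha>\<close> are then the tensors of the orthogonal bases of the factors; they form an orthogonal
  basis, and the squared norm of \<open>z ^ \<alpha>\<close> is the product of the squared norms \<open>weight (K i) (\<alpha> i)\<close>.
  Functions are again extended by zero.
\<close>

definition tensor_hilbert :: "('n::finite \<Rightarrow> disc_space) \<Rightarrow> (complex ^ 'n) function_space" where
  "tensor_hilbert K =
    \<lparr>vecs = {f. (\<exists>a. has_power_series f a) \<and> (\<forall>z. z \<notin> polydisc \<longrightarrow> f z = 0) \<and>
               (\<lambda>\<alpha>. tensor_weight K \<alpha> * (cmod (power_series_coeff f \<alpha>))\<^sup>2) summable_on UNIV},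
     ip = (\<lambda>f g. \<Sum>\<^sub>\<infinity>\<alpha>. complex_of_real (tensor_weight K \<alpha>) *
               power_series_coeff f \<alpha> * cnj (power_series_coeff g \<alpha>))\<rparr>"

definition elementary_tensor :: "('n::finite \<Rightarrow> complex \<Rightarrow> complex) \<Rightarrow> complex ^ 'n \<Rightarrow> complex" where
  "elementary_tensor f = (\<lambda>z. \<Prod>i\<in>UNIV. f i (z $ i))"

definition tensor_subspace ::
  "('n::finite \<Rightarrow> disc_space) \<Rightarrow> ('n \<Rightarrow> (complex \<Rightarrow> complex) set) \<Rightarrow> (complex ^ 'n \<Rightarrow> complex) set"
where
  "tensor_subspace K Q =
    hclosure (tensor_hilbert K) (cfun.span {elementary_tensor f | f. \<forall>i. f i \<in> Q i})"

definition mult_coord :: "'n \<Rightarrow> (complex ^ 'n \<Rightarrow> complex) \<Rightarrow> complex ^ 'n \<Rightarrow> complex" where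
  "mult_coord i f = (\<lambda>z. z $ i * f z)"

lemma mult_coord_elementary_tensor:
  "mult_coord i (elementary_tensor f) = elementary_tensor (f(i := mult_z (f i)))"
proof
  fix z :: "complex ^ 'a"
  have *: "(\<Prod>j\<in>UNIV - {i}. (f(i := mult_z (f i))) j (z $ j)) = (\<Prod>j\<in>UNIV - {i}. f j (z $ j))"
    by (rule prod.cong) auto
  show "mult_coord i (elementary_tensor f) z = elementary_tensor (f(i := mult_z (f i))) z"
    unfolding mult_coord_def elementary_tensor_def
      prod.remove[OF finite_class.finite_UNIV UNIV_I[of i]] *
    by (simp add: mult_z_def)
qed

end

theory Submission
  imports Defs
begin

text \<open>
  Write \<open>S i\<close> for the orthogonal complement of \<open>Q i\<close> and \<open>N\<close> for that of the tensor product of the \<open>Q i\<close>.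

  Upper bound.  Each \<open>S i\<close> is generated by a single \<open>\<phi> i\<close>, and the \<open>n\<close> functions \<open>\<phi> i (z\<^sub>i)\<close> generate \<open>N\<close>,
  because an elementary tensor expands along \<open>S i \<oplus> Q i\<close> in every factor.  That \<open>S\<close> is singly
  generated follows in two steps.  First, if \<open>m\<close> is the least order of a zero at \<open>0\<close> in \<open>S\<close>, an element of \<open>S\<close> of larger
  order may be divided by \<open>z\<close> within \<open>S\<close>: for \<open>f\<close> in the space there is an analytic
  \<open>V\<close> with \<open>Re \<langle>V g, g\<rangle> \<ge> \<parallel>f g\<parallel>\<^sup>2\<close>, so \<open>f\<close> is the quotient of the contractive multipliers \<open>f / (1 + V)\<close> and
  \<open>1 / (1 + V)\<close>, and products of elements of \<open>S\<close> by multipliers stay in \<open>S\<close>.  Hence \<open>S = \<complex> \<phi> + z S\<close> with \<open>\<phi> \<bottom> z S\<close>.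
  Second, Richter's wandering subspace argument shows that the \<open>z^p \<phi>\<close> span \<open>S\<close>.

  Lower bound.  Let \<open>l i\<close> be a common zero of \<open>S i\<close>, \<open>k j\<close> the reproducing kernel at \<open>l j\<close>, which lies in \<open>Q j\<close>, and
  \<open>e i\<close> a nonzero element of \<open>S i\<close> orthogonal to \<open>(z - l i) S i\<close>.  The functionals \<open>\<langle>F, E i\<rangle>\<close>, where \<open>E i\<close> is the
  tensor of \<open>e i\<close> and the \<open>k j\<close> with \<open>j \<noteq> i\<close>, map \<open>N\<close> onto an \<open>n\<close>-dimensional space on which each coordinate
  multiplication acts as the scalar \<open>l j\<close>; so a generating set has at least \<open>n\<close> elements.
\<close>

section \<open>Hilbert spaces of functions\<close>

text \<open>The obstacle is the Dirichlet space: its elements need not be multipliers, so an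
  invariant subspace need not be stable under products with them, and the inner-outer factorization
  of the Hardy space does not settle the division by \<open>z\<close>. Both spaces share that
  \<open>weight K\<close> is affine in the index, and two facts rest on this. The square of
  \<open>hnorm H ((M ^^ n) f)\<close> is affine in \<open>n\<close>, which drives the wandering
  subspace argument. And in each degree \<open>N\<close>, both
  \<open>Re \<langle>V g, g\<rangle>\<close> and \<open>\<parallel>F g\<parallel>\<^sup>2\<close>
  are Hermitian forms in the products \<open>F_a G_(N-a)\<close>, whose difference has an explicit
  positive kernel. The one-variable argument therefore runs on coefficient sequences and formal
  power series; analyticity serves to identify functions with coefficients and to take derivatives
  at the common zero. Limits are weak: a bounded sequence with convergent coefficients has its limit
  in every closed subspace that contains it, which is why uniform norm bounds accompany all
  approximations.\<close>

abbreviation (input) cscale :: "complex \<Rightarrow> ('x \<Rightarrow> complex) \<Rightarrow> 'x \<Rightarrow> complex" where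
  "cscale k f \<equiv> (\<lambda>x. k * f x)"

text \<open>The factors and their tensor product consist of functions on different types, with the
  inner product a record field; the locale gives them one common theory.\<close>

locale hilbert_function_space =
  fixes H :: "'x function_space"
  assumes vecs_subspace: "cfun.subspace (vecs H)"
    and ip_add: "\<lbrakk>f \<in> vecs H; g \<in> vecs H; h \<in> vecs H\<rbrakk> \<Longrightarrow> ip H (f + g) h = ip H f h + ip H g h"
    and ip_scale: "\<lbrakk>f \<in> vecs H; h \<in> vecs H\<rbrakk> \<Longrightarrow> ip H (cscale k f) h = k * ip H f h"
    and ip_cnj: "\<lbrakk>f \<in> vecs H; g \<in> vecs H\<rbrakk> \<Longrightarrow> ip H g f = cnj (ip H f g)"
    and ip_nonneg: "f \<in> vecs H \<Longrightarrow> 0 \<le> Re (ip H f f)"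
    and ip_definite: "f \<in> vecs H \<Longrightarrow> Re (ip H f f) = 0 \<Longrightarrow> f = 0"
    and complete: "\<lbrakk>\<And>n::nat. X n \<in> vecs H;
          \<And>e. e > 0 \<Longrightarrow> \<exists>N. \<forall>m\<ge>N. \<forall>n\<ge>N. hnorm H (X m - X n) < e\<rbrakk>
        \<Longrightarrow> \<exists>f\<in>vecs H. (\<lambda>n. hnorm H (X n - f)) \<longlonglongrightarrow> 0"
begin

lemma vecs_closed [simp, intro]:
  shows "0 \<in> vecs H"
    and "f \<in> vecs H \<Longrightarrow> g \<in> vecs H \<Longrightarrow> f + g \<in> vecs H"
    and "f \<in> vecs H \<Longrightarrow> g \<in> vecs H \<Longrightarrow> f - g \<in> vecs H"
    and "f \<in> vecs H \<Longrightarrow> cscale k f \<in> vecs H"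
  using vecs_subspace cfun.subspace_0 cfun.subspace_add cfun.subspace_diff cfun.subspace_scale
  by blast+

lemma ip_diff:
  assumes "f \<in> vecs H" "g \<in> vecs H" "h \<in> vecs H"
  shows "ip H (f - g) h = ip H f h - ip H g h"
proof -
  have e: "f - g = f + cscale (-1) g" by auto
  have "ip H (f + cscale (-1) g) h = ip H f h + ip H (cscale (-1) g) h"
    using assms by (intro ip_add vecs_closed)
  then show ?thesis unfolding e using assms ip_scale[of g h "-1"] by simp
qed

lemma ip_add_right:
  assumes "f \<in> vecs H" "g \<in> vecs H" "h \<in> vecs H"
  shows "ip H h (f + g) = ip H h f + ip H h g"
  using assms by (simp add: ip_cnj[of _ h] ip_add)

lemma ip_diff_right:
  assumes "f \<in> vecs H" "g \<in> vecs H" "h \<in> vecs H"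
  shows "ip H h (f - g) = ip H h f - ip H h g"
  using assms by (simp add: ip_cnj[of _ h] ip_diff)

lemma ip_scale_right:
  assumes "f \<in> vecs H" "h \<in> vecs H"
  shows "ip H h (cscale k f) = cnj k * ip H h f"
  using assms by (simp add: ip_cnj[of _ h] ip_scale)

lemma ip_zero [simp]: "f \<in> vecs H \<Longrightarrow> ip H 0 f = 0" "f \<in> vecs H \<Longrightarrow> ip H f 0 = 0"
  using ip_diff[of f f f] ip_diff_right[of f f f] by simp_all

lemma ip_self: "f \<in> vecs H \<Longrightarrow> ip H f f = of_real (Re (ip H f f))"
  using ip_cnj[of f f] by (simp add: complex_eq_iff)

lemma ip_eq_0_sym: "f \<in> vecs H \<Longrightarrow> g \<in> vecs H \<Longrightarrow> ip H f g = 0 \<longleftrightarrow> ip H g f = 0"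
  using ip_cnj[of f g] by simp

lemma hnorm_sq: "f \<in> vecs H \<Longrightarrow> (hnorm H f)\<^sup>2 = Re (ip H f f)"
  by (simp add: hnorm_def ip_nonneg)

lemma hnorm_nonneg [simp]: "f \<in> vecs H \<Longrightarrow> 0 \<le> hnorm H f"
  by (simp add: hnorm_def ip_nonneg)

lemma hnorm_eq_0: "f \<in> vecs H \<Longrightarrow> hnorm H f = 0 \<longleftrightarrow> f = 0"
  by (auto simp: hnorm_def ip_definite)

lemma hnorm_zero [simp]: "hnorm H 0 = 0"
  by (simp add: hnorm_def)

text \<open>The square is expanded once for a general multiple: suitable values of \<open>k\<close>
  yield Cauchy-Schwarz, the triangle inequality, the parallelogram law and the variational step of
  \<open>projection\<close>.\<close>

lemma hnorm_sq_diff_scale: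
  assumes "f \<in> vecs H" "g \<in> vecs H"
  shows "(hnorm H (f - cscale k g))\<^sup>2
    = (hnorm H f)\<^sup>2 - 2 * Re (cnj k * ip H f g) + (cmod k)\<^sup>2 * (hnorm H g)\<^sup>2"
proof -
  have "ip H (f - cscale k g) (f - cscale k g)
      = ip H f f - cnj k * ip H f g - k * cnj (ip H f g) + k * cnj k * ip H g g"
    using assms by (simp add: ip_diff ip_diff_right ip_scale ip_scale_right ip_cnj[of f g]
        algebra_simps)
  also have "\<dots> = ip H f f - (cnj k * ip H f g + cnj (cnj k * ip H f g)) + of_real ((cmod k)\<^sup>2) * ip H g g"
    by (simp add: complex_norm_square del: of_real_power)
  finally show ?thesis
    using assms by (simp add: hnorm_sq complex_add_cnj del: of_real_power)
qed

lemma hnorm_scale: "f \<in> vecs H \<Longrightarrow> hnorm H (cscale k f) = cmod k * hnorm H f"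
proof -
  assume f: "f \<in> vecs H"
  have "ip H (cscale k f) (cscale k f) = of_real ((cmod k)\<^sup>2) * ip H f f"
    using f by (simp add: ip_scale ip_scale_right complex_norm_square del: of_real_power)
  then show ?thesis using f
    by (simp add: hnorm_def real_sqrt_mult del: of_real_power)
qed

lemma hnorm_minus_commute: "f \<in> vecs H \<Longrightarrow> g \<in> vecs H \<Longrightarrow> hnorm H (f - g) = hnorm H (g - f)"
proof -
  assume a: "f \<in> vecs H" "g \<in> vecs H"
  have e: "f - g = cscale (-1) (g - f)" by auto
  show ?thesis unfolding e using a hnorm_scale[of "g - f" "-1"] by simp
qed

lemma Cauchy_Schwarz:
  assumes "f \<in> vecs H" "g \<in> vecs H"
  shows "cmod (ip H f g) \<le> hnorm H f * hnorm H g"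
proof (cases "g = 0")
  case True
  then show ?thesis using assms by simp
next
  case False
  then have g: "hnorm H g > 0"
    using assms hnorm_nonneg[of g] hnorm_eq_0[of g] by linarith
  \<comment> \<open>The value of \<open>k\<close> that minimizes
    \<open>hnorm H (f - cscale k g)\<close>.\<close>
  define k where "k = ip H f g / of_real ((hnorm H g)\<^sup>2)"
  have "cnj k * ip H f g = of_real ((cmod (ip H f g))\<^sup>2 / (hnorm H g)\<^sup>2)"
    using complex_norm_square[of "ip H f g"] by (simp add: k_def mult.commute)
  moreover have "(cmod k)\<^sup>2 * (hnorm H g)\<^sup>2 = (cmod (ip H f g))\<^sup>2 / (hnorm H g)\<^sup>2"
    using g by (simp add: k_def norm_divide power_divide norm_power norm_mult power2_eq_square)
  ultimately have "(cmod (ip H f g))\<^sup>2 / (hnorm H g)\<^sup>2 \<le> (hnorm H f)\<^sup>2"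
    using hnorm_sq_diff_scale[OF assms, of k] zero_le_power2[of "hnorm H (f - cscale k g)"]
    by (simp del: of_real_divide of_real_power)
  then have "(cmod (ip H f g))\<^sup>2 \<le> (hnorm H f * hnorm H g)\<^sup>2"
    using g by (simp add: pos_divide_le_eq power_mult_distrib)
  then show ?thesis by (rule power2_le_imp_le) (intro mult_nonneg_nonneg hnorm_nonneg assms)
qed

lemma hnorm_triangle:
  assumes "f \<in> vecs H" "g \<in> vecs H"
  shows "hnorm H (f + g) \<le> hnorm H f + hnorm H g"
proof (rule power2_le_imp_le)
  have e: "f + g = f - cscale (-1) g" by auto
  have "(hnorm H (f + g))\<^sup>2 = (hnorm H f)\<^sup>2 + 2 * Re (ip H f g) + (hnorm H g)\<^sup>2"
    using hnorm_sq_diff_scale[OF assms, of "-1"] unfolding e[symmetric] by simp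
  also have "Re (ip H f g) \<le> hnorm H f * hnorm H g"
    using Cauchy_Schwarz[OF assms] complex_Re_le_cmod order_trans by blast
  finally show "(hnorm H (f + g))\<^sup>2 \<le> (hnorm H f + hnorm H g)\<^sup>2"
    by (simp add: power2_sum)
qed (use assms in simp)

lemma hnorm_triangle_diff:
  assumes "f \<in> vecs H" "g \<in> vecs H" "h \<in> vecs H"
  shows "hnorm H (f - h) \<le> hnorm H (f - g) + hnorm H (g - h)"
proof -
  have "f - h = (f - g) + (g - h)" by auto
  then show ?thesis using hnorm_triangle[of "f - g" "g - h"] assms by simp
qed

lemma parallelogram:
  assumes "f \<in> vecs H" "g \<in> vecs H"
  shows "(hnorm H (f + g))\<^sup>2 + (hnorm H (f - g))\<^sup>2 = 2 * (hnorm H f)\<^sup>2 + 2 * (hnorm H g)\<^sup>2"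
proof -
  have e: "f + g = f - cscale (-1) g" and e': "f - g = f - cscale 1 g" by auto
  show ?thesis using hnorm_sq_diff_scale[OF assms, of "-1"] hnorm_sq_diff_scale[OF assms, of 1]
    unfolding e[symmetric] e'[symmetric] by simp
qed

section \<open>Closures, orthogonal complements and projections\<close>

lemma mem_hclosure_iff:
  assumes "S \<subseteq> vecs H"
  shows "f \<in> hclosure H S \<longleftrightarrow>
    f \<in> vecs H \<and> (\<exists>X::nat \<Rightarrow> _. range X \<subseteq> S \<and> (\<lambda>n. hnorm H (X n - f)) \<longlonglongrightarrow> 0)"
    (is "?L \<longleftrightarrow> ?R")
proof
  assume L: ?L
  then have f: "f \<in> vecs H" by (simp add: hclosure_def)
  have "\<exists>g\<in>S. hnorm H (f - g) < inverse (real (Suc n))" for n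
    using L by (simp add: hclosure_def del: of_nat_Suc)
  then obtain X where X: "\<And>n. X n \<in> S" "\<And>n. hnorm H (f - X n) < inverse (real (Suc n))"
    by metis
  have "(\<lambda>n. hnorm H (X n - f)) \<longlonglongrightarrow> 0"
  proof (rule tendsto_sandwich[OF _ _ tendsto_const LIMSEQ_inverse_real_of_nat])
    show "\<forall>\<^sub>F n in sequentially. 0 \<le> hnorm H (X n - f)"
      using X(1) assms f by (auto intro!: always_eventually hnorm_nonneg vecs_closed)
    show "\<forall>\<^sub>F n in sequentially. hnorm H (X n - f) \<le> inverse (real (Suc n))"
    proof (rule always_eventually, rule allI)
      fix n
      have "hnorm H (X n - f) = hnorm H (f - X n)"
        using X(1) assms f by (intro hnorm_minus_commute) auto
      then show "hnorm H (X n - f) \<le> inverse (real (Suc n))"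
        using X(2)[of n] by linarith
    qed
  qed
  then show ?R using X(1) f by auto
next
  assume R: ?R
  then obtain X where f: "f \<in> vecs H" and X: "\<And>n. X n \<in> S" and lim: "(\<lambda>n. hnorm H (X n - f)) \<longlonglongrightarrow> 0"
    by auto
  have "\<exists>g\<in>S. hnorm H (f - g) < e" if "e > 0" for e
  proof -
    have "\<forall>\<^sub>F n in sequentially. hnorm H (X n - f) < e"
      using lim that order_tendstoD(2) by blast
    then obtain n where "hnorm H (X n - f) < e" by (auto simp: eventually_sequentially)
    moreover have "hnorm H (X n - f) = hnorm H (f - X n)"
      using X assms f by (intro hnorm_minus_commute) auto
    ultimately show ?thesis using X by metis
  qed
  then show ?L using f by (simp add: hclosure_def)
qed

lemma closed_subspaceD:
  assumes "closed_subspace H S"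
  shows "S \<subseteq> vecs H" "cfun.subspace S"
    "\<lbrakk>\<And>n. X n \<in> S; f \<in> vecs H; (\<lambda>n. hnorm H (X n - f)) \<longlonglongrightarrow> 0\<rbrakk> \<Longrightarrow> f \<in> S"
proof -
  show a: "S \<subseteq> vecs H" "cfun.subspace S" using assms by (simp_all add: closed_subspace_def)
  assume "\<And>n. X n \<in> S" "f \<in> vecs H" "(\<lambda>n. hnorm H (X n - f)) \<longlonglongrightarrow> 0"
  then have "f \<in> hclosure H S" using mem_hclosure_iff[OF a(1)] by blast
  then show "f \<in> S" using assms by (simp add: closed_subspace_def)
qed

lemma hclosureE:
  assumes "f \<in> hclosure H S" "e > 0"
  obtains g where "g \<in> S" "hnorm H (f - g) < e"
  using assms by (auto simp: hclosure_def)

lemma hclosure_superset: "S \<subseteq> vecs H \<Longrightarrow> S \<subseteq> hclosure H S"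
  by (force simp: hclosure_def)

lemma ip_tendsto:
  assumes X: "\<And>n. X n \<in> vecs H" and Y: "\<And>n. Y n \<in> vecs H" and f: "f \<in> vecs H" and g: "g \<in> vecs H"
    and lX: "(\<lambda>n. hnorm H (X n - f)) \<longlonglongrightarrow> 0" and lY: "(\<lambda>n. hnorm H (Y n - g)) \<longlonglongrightarrow> 0"
  shows "(\<lambda>n. ip H (X n) (Y n)) \<longlonglongrightarrow> ip H f g"
proof -
  have "(\<lambda>n. ip H (X n) (Y n) - ip H f g) \<longlonglongrightarrow> 0"
  proof (rule Lim_null_comparison)
    show "(\<lambda>n. hnorm H (X n - f) * hnorm H (Y n - g) + hnorm H (X n - f) * hnorm H g
        + hnorm H f * hnorm H (Y n - g)) \<longlonglongrightarrow> 0"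
      using tendsto_add[OF tendsto_add[OF tendsto_mult[OF lX lY] tendsto_mult_left_zero[OF lX]]
          tendsto_mult_right_zero[OF lY]] by simp
    have "norm (ip H (X n) (Y n) - ip H f g) \<le> hnorm H (X n - f) * hnorm H (Y n - g)
        + hnorm H (X n - f) * hnorm H g + hnorm H f * hnorm H (Y n - g)" for n
    proof -
      have e: "ip H (X n) (Y n) - ip H f g = ip H (X n - f) (Y n - g) + ip H (X n - f) g + ip H f (Y n - g)"
        using X Y f g by (simp add: ip_diff ip_diff_right)
      show ?thesis
        unfolding e
        using norm_triangle_ineq[of "ip H (X n - f) (Y n - g) + ip H (X n - f) g" "ip H f (Y n - g)"]
          norm_triangle_ineq[of "ip H (X n - f) (Y n - g)" "ip H (X n - f) g"]
          Cauchy_Schwarz[OF vecs_closed(3)[OF X f] vecs_closed(3)[OF Y g], of n n]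
          Cauchy_Schwarz[OF vecs_closed(3)[OF X f] g, of n] Cauchy_Schwarz[OF f vecs_closed(3)[OF Y g], of n]
        by linarith
    qed
    then show "\<forall>\<^sub>F n in sequentially. norm (ip H (X n) (Y n) - ip H f g)
        \<le> hnorm H (X n - f) * hnorm H (Y n - g) + hnorm H (X n - f) * hnorm H g + hnorm H f * hnorm H (Y n - g)"
      by (rule always_eventually[OF allI])
  qed
  then show ?thesis by (simp add: LIM_zero_iff)
qed

lemma ip_tendsto_left:
  assumes "\<And>n. X n \<in> vecs H" "f \<in> vecs H" "g \<in> vecs H" "(\<lambda>n. hnorm H (X n - f)) \<longlonglongrightarrow> 0"
  shows "(\<lambda>n. ip H (X n) g) \<longlonglongrightarrow> ip H f g"
  by (rule ip_tendsto[OF assms(1) _ assms(2,3,4)]) (simp_all add: assms(3))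

lemma closed_subspace_orth_compl:
  assumes "S \<subseteq> vecs H"
  shows "closed_subspace H (orth_compl H S)"
proof -
  have sub: "orth_compl H S \<subseteq> vecs H" by (auto simp: orth_compl_def)
  have "cfun.subspace (orth_compl H S)"
    using assms by (auto simp: cfun.subspace_def orth_compl_def ip_add ip_scale subset_iff
       )
  moreover have "f \<in> orth_compl H S" if "f \<in> hclosure H (orth_compl H S)" for f
  proof -
    from that obtain X where f: "f \<in> vecs H" and X: "\<And>n::nat. X n \<in> orth_compl H S"
      and lim: "(\<lambda>n. hnorm H (X n - f)) \<longlonglongrightarrow> 0"
      using mem_hclosure_iff[OF sub] by blast
    have "ip H f g = 0" if "g \<in> S" for g
    proof -
      have "(\<lambda>n. ip H (X n) g) \<longlonglongrightarrow> ip H f g"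
        using X sub that assms f lim by (intro ip_tendsto_left) auto
      moreover have "(\<lambda>n. ip H (X n) g) = (\<lambda>n. 0)"
        using X that by (auto simp: orth_compl_def)
      ultimately show ?thesis by (simp add: LIMSEQ_const_iff)
    qed
    then show ?thesis using f by (simp add: orth_compl_def)
  qed
  ultimately show ?thesis
    using sub hclosure_superset[OF sub] by (auto simp: closed_subspace_def)
qed

text \<open>A minimizing sequence for the distance from \<open>f\<close> to \<open>M\<close> is
  Cauchy by the parallelogram law; its limit \<open>m\<close> is a nearest point, and no multiple of
  an element of \<open>M\<close> can improve on it, which is orthogonality.\<close>

theorem projection:
  assumes M: "closed_subspace H M" and f: "f \<in> vecs H"
  obtains m where "m \<in> M" "f - m \<in> orth_compl H M"
proof -
  note Msub = closed_subspaceD(1)[OF M] and Msp = closed_subspaceD(2)[OF M]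
  define D where "D = (\<lambda>g. (hnorm H (f - g))\<^sup>2) ` M"
  define d where "d = Inf D"
  have ne: "D \<noteq> {}" using cfun.subspace_0[OF Msp] by (auto simp: D_def)
  have bdd: "bdd_below D" by (rule bdd_belowI[of _ 0]) (auto simp: D_def)
  have dle: "d \<le> (hnorm H (f - g))\<^sup>2" if "g \<in> M" for g
    unfolding d_def using that bdd by (intro cInf_lower) (auto simp: D_def)
  have "\<exists>g\<in>M. (hnorm H (f - g))\<^sup>2 < d + inverse (real (Suc n))" for n
    using cInf_lessD[OF ne, of "d + inverse (real (Suc n))"] by (auto simp: D_def d_def)
  then obtain X where X: "\<And>n. X n \<in> M" "\<And>n. (hnorm H (f - X n))\<^sup>2 < d + inverse (real (Suc n))"
    by metis
  have Xv: "X n \<in> vecs H" for n using X(1) Msub by blast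
  have cauchy: "(hnorm H (X m - X n))\<^sup>2 \<le> 2 * inverse (real (Suc m)) + 2 * inverse (real (Suc n))" for m n
  proof -
    \<comment> \<open>The midpoint of \<open>X n\<close> and \<open>X m\<close> lies in
      \<open>M\<close>, so its squared distance to \<open>f\<close> is at least \<open>d\<close>;
      the other term of the parallelogram law must then be small.\<close>
    have "(hnorm H ((f - X n) + (f - X m)))\<^sup>2 + (hnorm H ((f - X n) - (f - X m)))\<^sup>2
        = 2 * (hnorm H (f - X n))\<^sup>2 + 2 * (hnorm H (f - X m))\<^sup>2"
      using Xv f by (intro parallelogram) auto
    moreover have "(f - X n) - (f - X m) = X m - X n" by auto
    moreover have "(f - X n) + (f - X m) = cscale 2 (f - cscale (1/2) (X n + X m))"
      by (auto simp: fun_eq_iff algebra_simps)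
    moreover have "hnorm H (cscale 2 (f - cscale (1/2) (X n + X m)))
        = cmod 2 * hnorm H (f - cscale (1/2) (X n + X m))"
      using Xv f by (intro hnorm_scale vecs_closed)
    moreover have "d \<le> (hnorm H (f - cscale (1/2) (X n + X m)))\<^sup>2"
      using X(1) by (intro dle cfun.subspace_add[OF Msp] cfun.subspace_scale[OF Msp])
    ultimately have "4 * d + (hnorm H (X m - X n))\<^sup>2 \<le> 2 * (hnorm H (f - X n))\<^sup>2 + 2 * (hnorm H (f - X m))\<^sup>2"
      by (simp add: power_mult_distrib)
    then show ?thesis using X(2)[of n] X(2)[of m] by linarith
  qed
  have "\<exists>m\<in>vecs H. (\<lambda>n. hnorm H (X n - m)) \<longlonglongrightarrow> 0"
  proof (rule complete[OF Xv])
    fix e :: real assume e: "e > 0"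
    obtain N where N: "inverse (real (Suc N)) < e\<^sup>2 / 4"
      using reals_Archimedean[of "e\<^sup>2 / 4"] e by auto
    have "hnorm H (X m - X n) < e" if "m \<ge> N" "n \<ge> N" for m n
    proof -
      have "inverse (real (Suc m)) \<le> inverse (real (Suc N))" "inverse (real (Suc n)) \<le> inverse (real (Suc N))"
        using that by (simp_all add: field_simps)
      then have "(hnorm H (X m - X n))\<^sup>2 < e\<^sup>2" using cauchy[of m n] N by linarith
      then show ?thesis using e power_less_imp_less_base[of _ 2 e] by simp
    qed
    then show "\<exists>N. \<forall>m\<ge>N. \<forall>n\<ge>N. hnorm H (X m - X n) < e" by blast
  qed
  then obtain m where m: "m \<in> vecs H" and lim: "(\<lambda>n. hnorm H (X n - m)) \<longlonglongrightarrow> 0" by blast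
  have mM: "m \<in> M" using closed_subspaceD(3)[OF M X(1) m lim] .
  have "hnorm H (f - m) \<le> sqrt d"
  proof (rule LIMSEQ_le_const)
    have "(\<lambda>n. sqrt (d + inverse (real (Suc n))) + hnorm H (X n - m)) \<longlonglongrightarrow> sqrt (d + 0) + 0"
      by (intro tendsto_intros LIMSEQ_inverse_real_of_nat lim)
    then show "(\<lambda>n. sqrt (d + inverse (real (Suc n))) + hnorm H (X n - m)) \<longlonglongrightarrow> sqrt d" by simp
    have "hnorm H (f - m) \<le> sqrt (d + inverse (real (Suc n))) + hnorm H (X n - m)" for n
    proof -
      have "hnorm H (f - X n) \<le> sqrt (d + inverse (real (Suc n)))"
        using X(2)[of n] by (intro real_le_rsqrt) simp
      then show ?thesis using hnorm_triangle_diff[OF f Xv m, of n] by linarith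
    qed
    then show "\<exists>N. \<forall>n\<ge>N. hnorm H (f - m) \<le> sqrt (d + inverse (real (Suc n))) + hnorm H (X n - m)" by blast
  qed
  moreover have "d \<ge> 0" unfolding d_def using ne by (intro cInf_greatest) (auto simp: D_def)
  ultimately have min: "(hnorm H (f - m))\<^sup>2 \<le> d"
    using f m by (metis hnorm_nonneg power_mono real_sqrt_pow2 vecs_closed(3))
  have "ip H (f - m) g = 0" if g: "g \<in> M" for g
  proof (rule ccontr)
    assume ne: "ip H (f - m) g \<noteq> 0"
    have gv: "g \<in> vecs H" using g Msub by blast
    have g0: "hnorm H g > 0"
    proof -
      have "g \<noteq> 0" using ne f m by (auto)
      then show ?thesis using gv hnorm_nonneg[of g] hnorm_eq_0[of g] by linarith
    qed
    \<comment> \<open>With the minimizing multiple, \<open>m + cscale k g\<close> would be strictly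
      closer to \<open>f\<close> than the infimum allows.\<close>
    define k where "k = ip H (f - m) g / of_real ((hnorm H g)\<^sup>2)"
    have "cnj k * ip H (f - m) g = of_real ((cmod (ip H (f - m) g))\<^sup>2 / (hnorm H g)\<^sup>2)"
      using complex_norm_square[of "ip H (f - m) g"] by (simp add: k_def mult.commute)
    then have r: "Re (cnj k * ip H (f - m) g) = (cmod (ip H (f - m) g))\<^sup>2 / (hnorm H g)\<^sup>2"
      by (metis Re_complex_of_real)
    moreover have "(cmod k)\<^sup>2 * (hnorm H g)\<^sup>2 = (cmod (ip H (f - m) g))\<^sup>2 / (hnorm H g)\<^sup>2"
      using g0 by (simp add: k_def norm_divide power_divide norm_power norm_mult power2_eq_square)
    moreover have "(cmod (ip H (f - m) g))\<^sup>2 / (hnorm H g)\<^sup>2 > 0"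
      using ne g0 by simp
    ultimately have "(hnorm H (f - m - cscale k g))\<^sup>2 < (hnorm H (f - m))\<^sup>2"
      using hnorm_sq_diff_scale[of "f - m" g k] f m gv by simp
    moreover have "f - m - cscale k g = f - (m + cscale k g)" by auto
    moreover have "m + cscale k g \<in> M"
      using mM g Msp by (simp add: cfun.subspace_add cfun.subspace_scale)
    ultimately show False using dle[of "m + cscale k g"] min by simp
  qed
  then have "f - m \<in> orth_compl H M" using f m by (simp add: orth_compl_def)
  with mM show thesis by (rule that)
qed

text \<open>\<open>M\<close> contains its double orthogonal complement. In this form weak limits are
  shown to stay in a closed subspace, and vectors orthogonal to \<open>S i\<close> to lie in
  \<open>Q i\<close>.\<close>

lemma mem_closed_subspaceI:
  assumes M: "closed_subspace H M" and f: "f \<in> vecs H"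
    and perp: "\<And>g. g \<in> orth_compl H M \<Longrightarrow> ip H f g = 0"
  shows "f \<in> M"
proof -
  obtain m where m: "m \<in> M" "f - m \<in> orth_compl H M" using projection[OF M f] .
  have mv: "m \<in> vecs H" using m(1) closed_subspaceD(1)[OF M] by blast
  have "ip H (f - m) m = 0" using m by (auto simp: orth_compl_def)
  then have "ip H m (f - m) = 0" using f mv ip_eq_0_sym[of m "f - m"] by simp
  then have "ip H (f - m) (f - m) = 0"
    using perp[OF m(2)] f mv ip_diff[of f m "f - m"] by simp
  then have "f - m = 0" using f mv by (intro ip_definite) (auto)
  then show ?thesis using m(1) by simp
qed

lemma closed_subspace_hclosure:
  assumes "cfun.subspace S" "S \<subseteq> vecs H"
  shows "closed_subspace H (hclosure H S)"
proof -
  have sub: "hclosure H S \<subseteq> vecs H" by (auto simp: hclosure_def)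
  have add: "f + g \<in> hclosure H S" if fg: "f \<in> hclosure H S" "g \<in> hclosure H S" for f g
  proof -
    have fv: "f \<in> vecs H" and gv: "g \<in> vecs H" using fg sub by auto
    have "\<exists>h\<in>S. hnorm H (f + g - h) < e" if e: "e > 0" for e
    proof -
      have e2: "e / 2 > 0" using e by simp
      obtain f' where f': "f' \<in> S" "hnorm H (f - f') < e/2" using hclosureE[OF fg(1) e2] .
      obtain g' where g': "g' \<in> S" "hnorm H (g - g') < e/2" using hclosureE[OF fg(2) e2] .
      note * = f' g'
      have e': "f + g - (f' + g') = (f - f') + (g - g')" by auto
      have "hnorm H ((f - f') + (g - g')) \<le> hnorm H (f - f') + hnorm H (g - g')"
        using fv gv * assms(2) by (intro hnorm_triangle) auto
      then have "hnorm H (f + g - (f' + g')) < e"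
        unfolding e' using * by simp
      moreover have "f' + g' \<in> S" using * assms(1) cfun.subspace_add by blast
      ultimately show ?thesis by blast
    qed
    then show ?thesis using fv gv by (simp add: hclosure_def)
  qed
  have scale: "cscale k f \<in> hclosure H S" if f: "f \<in> hclosure H S" for f k
  proof -
    have fv: "f \<in> vecs H" using f sub by auto
    have "\<exists>h\<in>S. hnorm H (cscale k f - h) < e" if e: "e > 0" for e
    proof -
      have "e / (cmod k + 1) > 0" using e by (simp add: add_nonneg_pos)
      then obtain f' where *: "f' \<in> S" "hnorm H (f - f') < e / (cmod k + 1)"
        using f unfolding hclosure_def by blast
      have nn: "hnorm H (f - f') \<ge> 0" using fv * assms(2) by auto
      have "cscale k f - cscale k f' = cscale k (f - f')" by (auto simp: algebra_simps)
      moreover have "hnorm H (cscale k (f - f')) = cmod k * hnorm H (f - f')"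
        using fv * assms(2) by (intro hnorm_scale vecs_closed) auto
      moreover have "\<dots> \<le> (cmod k + 1) * hnorm H (f - f')" using nn by (simp add: algebra_simps)
      moreover have "cmod k + 1 > 0" by (simp add: add_nonneg_pos)
      then have "(cmod k + 1) * hnorm H (f - f') < e"
        using *(2) by (simp only: pos_less_divide_eq mult.commute)
      ultimately have "hnorm H (cscale k f - cscale k f') < e" by simp
      moreover have "cscale k f' \<in> S" using * assms(1) cfun.subspace_scale by blast
      ultimately show ?thesis by blast
    qed
    then show ?thesis using fv by (simp add: hclosure_def)
  qed
  have idem: "f \<in> hclosure H S" if f: "f \<in> hclosure H (hclosure H S)" for f
  proof -
    have fv: "f \<in> vecs H" using f by (simp add: hclosure_def)
    have "\<exists>h\<in>S. hnorm H (f - h) < e" if e: "e > 0" for e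
    proof -
      have e2: "e / 2 > 0" using e by simp
      obtain g where g: "g \<in> hclosure H S" "hnorm H (f - g) < e/2" using hclosureE[OF f e2] .
      obtain h where h: "h \<in> S" "hnorm H (g - h) < e/2" using hclosureE[OF g(1) e2] .
      have "hnorm H (f - h) \<le> hnorm H (f - g) + hnorm H (g - h)"
        using fv g h sub assms(2) by (intro hnorm_triangle_diff) auto
      then show ?thesis using g h by force
    qed
    then show ?thesis using fv by (simp add: hclosure_def)
  qed
  have "0 \<in> hclosure H S"
    using hclosure_superset[OF assms(2)] cfun.subspace_0[OF assms(1)] by blast
  then have "cfun.subspace (hclosure H S)"
    unfolding cfun.subspace_def using add scale by blast
  moreover have "hclosure H (hclosure H S) = hclosure H S"
    using idem hclosure_superset[OF sub] by blast
  ultimately show ?thesis using sub by (simp add: closed_subspace_def)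
qed

lemma span_subset_vecs: "X \<subseteq> vecs H \<Longrightarrow> cfun.span X \<subseteq> vecs H"
  by (rule cfun.span_minimal[OF _ vecs_subspace])

lemma ip_span_eq_0:
  assumes "X \<subseteq> vecs H" "g \<in> vecs H" "\<And>x. x \<in> X \<Longrightarrow> ip H x g = 0" "f \<in> hclosure H (cfun.span X)"
  shows "ip H f g = 0"
proof -
  have gs: "{g} \<subseteq> vecs H" using assms(2) by simp
  note cl = closed_subspace_orth_compl[OF gs]
  have "X \<subseteq> orth_compl H {g}" using assms(1,3) by (auto simp: orth_compl_def)
  then have sp: "cfun.span X \<subseteq> orth_compl H {g}"
    by (rule cfun.span_minimal) (rule closed_subspaceD(2)[OF cl])
  have "f \<in> vecs H \<and> (\<exists>Y::nat \<Rightarrow> _. range Y \<subseteq> cfun.span X \<and> (\<lambda>n. hnorm H (Y n - f)) \<longlonglongrightarrow> 0)"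
    by (rule iffD1[OF mem_hclosure_iff[OF span_subset_vecs[OF assms(1)]] assms(4)])
  then obtain Y :: "nat \<Rightarrow> _" where f: "f \<in> vecs H" and Y: "\<And>n. Y n \<in> cfun.span X"
    and lim: "(\<lambda>n. hnorm H (Y n - f)) \<longlonglongrightarrow> 0" by auto
  have "f \<in> orth_compl H {g}" using sp Y by (intro closed_subspaceD(3)[OF cl _ f lim]) auto
  then show ?thesis by (simp add: orth_compl_def)
qed

lemma hnorm_sq_add:
  assumes "f \<in> vecs H" "g \<in> vecs H" "ip H f g = 0"
  shows "(hnorm H (f + g))\<^sup>2 = (hnorm H f)\<^sup>2 + (hnorm H g)\<^sup>2"
proof -
  have "ip H g f = 0" using assms ip_eq_0_sym by blast
  then show ?thesis using assms by (simp add: hnorm_sq ip_add ip_add_right)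
qed

lemma closed_subspace_vecs: "closed_subspace H (vecs H)"
  using vecs_subspace hclosure_superset[of "vecs H"] by (auto simp: closed_subspace_def hclosure_def)

text \<open>The projection of \<open>x\<close> to the closed span of \<open>A\<close> stays in
  \<open>S\<close>, so the remainder is subject to \<open>total\<close>. Density questions in
  \<open>S\<close> thereby become statements that a vector is zero.\<close>

lemma total_in_subspace:
  assumes S: "closed_subspace H S" and A: "A \<subseteq> S"
    and total: "\<And>x. x \<in> S \<Longrightarrow> (\<And>a. a \<in> A \<Longrightarrow> ip H x a = 0) \<Longrightarrow> x = 0"
  shows "S \<subseteq> hclosure H (cfun.span A)"
proof
  fix x assume x: "x \<in> S"
  note Sv = closed_subspaceD(1)[OF S] and Ssub = closed_subspaceD(2)[OF S]
  have Av: "A \<subseteq> vecs H" using A Sv by blast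
  have spS: "cfun.span A \<subseteq> S" by (rule cfun.span_minimal[OF A Ssub])
  have "hclosure H (cfun.span A) \<subseteq> hclosure H S" using spS unfolding hclosure_def by blast
  then have clS: "hclosure H (cfun.span A) \<subseteq> S" using S by (simp add: closed_subspace_def)
  obtain p where p: "p \<in> hclosure H (cfun.span A)" "x - p \<in> orth_compl H (hclosure H (cfun.span A))"
    using projection[OF closed_subspace_hclosure[OF cfun.subspace_span span_subset_vecs[OF Av]] subsetD[OF Sv x]] .
  have "x - p = 0"
  proof (rule total)
    show "x - p \<in> S" using x p(1) clS cfun.subspace_diff[OF Ssub] by blast
    fix a assume "a \<in> A"
    then have "a \<in> hclosure H (cfun.span A)"
      using hclosure_superset[OF span_subset_vecs[OF Av]] cfun.span_base by blast
    then show "ip H (x - p) a = 0" using p(2) by (simp add: orth_compl_def)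
  qed
  then have "x = p" using eq_iff_diff_eq_0[of x p] by blast
  then show "x \<in> hclosure H (cfun.span A)" using p(1) by simp
qed

end

section \<open>Weighted coefficient spaces\<close>

lemma weighted_product_summable:
  fixes a b :: "'i \<Rightarrow> complex"
  assumes w: "\<And>i. 0 \<le> w i"
    and a: "(\<lambda>i. w i * (cmod (a i))\<^sup>2) summable_on UNIV"
    and b: "(\<lambda>i. w i * (cmod (b i))\<^sup>2) summable_on UNIV"
  shows "(\<lambda>i. complex_of_real (w i) * a i * cnj (b i)) summable_on UNIV"
proof -
  have "(\<lambda>i. norm (complex_of_real (w i) * a i * cnj (b i))) summable_on UNIV"
  proof (rule Infinite_Sum.abs_summable_on_comparison_test')
    show "(\<lambda>i. w i * (cmod (a i))\<^sup>2 + w i * (cmod (b i))\<^sup>2) summable_on UNIV"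
      by (intro summable_on_add a b)
    fix i
    have "cmod (a i) * cmod (b i) \<le> (cmod (a i))\<^sup>2 + (cmod (b i))\<^sup>2"
      using sum_squares_bound[of "cmod (a i)" "cmod (b i)"]
        mult_nonneg_nonneg[OF norm_ge_zero[of "a i"] norm_ge_zero[of "b i"]] by linarith
    then have "w i * (cmod (a i) * cmod (b i)) \<le> w i * ((cmod (a i))\<^sup>2 + (cmod (b i))\<^sup>2)"
      using w mult_left_mono by blast
    then show "norm (complex_of_real (w i) * a i * cnj (b i))
        \<le> w i * (cmod (a i))\<^sup>2 + w i * (cmod (b i))\<^sup>2"
      using w[of i] by (simp add: norm_mult algebra_simps)
  qed
  then show ?thesis by (rule abs_summable_summable)
qed

lemma weighted_summable_add:
  fixes a b :: "'i \<Rightarrow> complex"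
  assumes w: "\<And>i. 0 \<le> w i"
    and a: "(\<lambda>i. w i * (cmod (a i))\<^sup>2) summable_on UNIV"
    and b: "(\<lambda>i. w i * (cmod (b i))\<^sup>2) summable_on UNIV"
  shows "(\<lambda>i. w i * (cmod (a i + b i))\<^sup>2) summable_on UNIV"
proof (rule summable_on_comparison_test)
  show "(\<lambda>i. 2 * (w i * (cmod (a i))\<^sup>2) + 2 * (w i * (cmod (b i))\<^sup>2)) summable_on UNIV"
    by (intro summable_on_add summable_on_cmult_right a b)
  fix i
  have "(cmod (a i + b i))\<^sup>2 \<le> (cmod (a i) + cmod (b i))\<^sup>2"
    by (intro power_mono norm_triangle_ineq) simp
  also have "\<dots> \<le> 2 * (cmod (a i))\<^sup>2 + 2 * (cmod (b i))\<^sup>2"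
    using sum_squares_bound[of "cmod (a i)" "cmod (b i)"] by (simp add: power2_sum)
  finally have "w i * (cmod (a i + b i))\<^sup>2 \<le> w i * (2 * (cmod (a i))\<^sup>2 + 2 * (cmod (b i))\<^sup>2)"
    by (rule mult_left_mono[OF _ w])
  then show "w i * (cmod (a i + b i))\<^sup>2 \<le> 2 * (w i * (cmod (a i))\<^sup>2) + 2 * (w i * (cmod (b i))\<^sup>2)"
    by (simp add: algebra_simps)
qed (simp add: w)

text \<open>The map \<open>c\<close> identifies \<open>vecs H\<close> with a weighted square
  summable sequence space over any index type: degrees for the disc, multi-indices for the polydisc.
  Weights of at least 1 make every coefficient a contractive functional.\<close>

locale weighted_space =
  fixes H :: "'x function_space" and c :: "('x \<Rightarrow> complex) \<Rightarrow> 'i \<Rightarrow> complex" and w :: "'i \<Rightarrow> real"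
  assumes w_ge1: "1 \<le> w i"
    and subspace: "cfun.subspace (vecs H)"
    and c_add: "\<lbrakk>f \<in> vecs H; g \<in> vecs H\<rbrakk> \<Longrightarrow> c (f + g) i = c f i + c g i"
    and c_scale: "f \<in> vecs H \<Longrightarrow> c (cscale k f) i = k * c f i"
    and c_inj: "\<lbrakk>f \<in> vecs H; \<And>i. c f i = 0\<rbrakk> \<Longrightarrow> f = 0"
    and c_summable: "f \<in> vecs H \<Longrightarrow> (\<lambda>i. w i * (cmod (c f i))\<^sup>2) summable_on UNIV"
    and c_surj: "(\<lambda>i. w i * (cmod (a i))\<^sup>2) summable_on UNIV \<Longrightarrow> \<exists>f\<in>vecs H. c f = a"
    and ip_eq: "\<lbrakk>f \<in> vecs H; g \<in> vecs H\<rbrakk> \<Longrightarrow>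
      ip H f g = (\<Sum>\<^sub>\<infinity>i. complex_of_real (w i) * c f i * cnj (c g i))"
begin

lemma w_nonneg: "0 \<le> w i" and w_pos: "0 < w i"
  using w_ge1[of i] by linarith+

lemma ip_summable:
  assumes "f \<in> vecs H" "g \<in> vecs H"
  shows "(\<lambda>i. complex_of_real (w i) * c f i * cnj (c g i)) summable_on UNIV"
  by (intro weighted_product_summable w_nonneg c_summable assms)

lemma ip_has_sum:
  assumes "f \<in> vecs H" "g \<in> vecs H"
  shows "((\<lambda>i. complex_of_real (w i) * c f i * cnj (c g i)) has_sum ip H f g) UNIV"
  using has_sum_infsum[OF ip_summable[OF assms]] ip_eq[OF assms] by simp

lemma ip_self_has_sum:
  assumes "f \<in> vecs H"
  shows "((\<lambda>i. w i * (cmod (c f i))\<^sup>2) has_sum Re (ip H f f)) UNIV"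
proof -
  have e: "Re (complex_of_real (w i) * c f i * cnj (c f i)) = w i * (cmod (c f i))\<^sup>2" for i
  proof -
    have "complex_of_real (w i) * c f i * cnj (c f i) = of_real (w i * (cmod (c f i))\<^sup>2)"
      using complex_norm_square[of "c f i"] by (simp add: mult.assoc)
    then show ?thesis by (metis Re_complex_of_real)
  qed
  show ?thesis using has_sum_Re[OF ip_has_sum[OF assms assms]] unfolding e .
qed

lemma norm_coeff_le:
  assumes "f \<in> vecs H"
  shows "w i * (cmod (c f i))\<^sup>2 \<le> Re (ip H f f)"
proof -
  have "sum (\<lambda>i. w i * (cmod (c f i))\<^sup>2) {i} \<le> Re (ip H f f)"
    by (rule has_sum_mono2[OF has_sum_finite ip_self_has_sum[OF assms]]) (auto simp: w_nonneg)
  then show ?thesis by simp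
qed

text \<open>Fatou's lemma for sums: finite partial sums obey the bound and pass to the limit, which
  yields summability and the bound on the whole sum.\<close>

lemma bounded_limit_weak:
  assumes X: "\<And>n::nat. X n \<in> vecs H" and B: "\<And>n. Re (ip H (X n) (X n)) \<le> B"
    and lim: "\<And>i. (\<lambda>n. c (X n) i) \<longlonglongrightarrow> a i"
  shows "\<exists>f\<in>vecs H. c f = a \<and> Re (ip H f f) \<le> B"
proof -
  have fin: "sum (\<lambda>i. w i * (cmod (a i))\<^sup>2) F \<le> B" if "finite F" for F
  proof (rule LIMSEQ_le_const2)
    show "(\<lambda>n. \<Sum>i\<in>F. w i * (cmod (c (X n) i))\<^sup>2) \<longlonglongrightarrow> (\<Sum>i\<in>F. w i * (cmod (a i))\<^sup>2)"
      by (intro tendsto_intros lim)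
    have "(\<Sum>i\<in>F. w i * (cmod (c (X n) i))\<^sup>2) \<le> B" for n
      using has_sum_mono2[OF has_sum_finite[OF that] ip_self_has_sum[OF X[of n]]] B[of n]
      by (force simp: w_nonneg)
    then show "\<exists>N. \<forall>n\<ge>N. (\<Sum>i\<in>F. w i * (cmod (c (X n) i))\<^sup>2) \<le> B" by blast
  qed
  have s: "(\<lambda>i. w i * (cmod (a i))\<^sup>2) summable_on UNIV"
    by (rule nonneg_bounded_partial_sums_imp_summable_on[where C = B])
      (auto simp: w_nonneg eventually_finite_subsets_at_top intro!: exI[of _ "{}"] fin)
  then obtain f where f: "f \<in> vecs H" "c f = a" using c_surj by blast
  have "Re (ip H f f) = (\<Sum>\<^sub>\<infinity>i. w i * (cmod (a i))\<^sup>2)"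
    using infsumI[OF ip_self_has_sum[OF f(1)]] f(2) by simp
  also have "\<dots> \<le> B" by (rule infsum_le_finite_sums[OF s]) (use fin in auto)
  finally show ?thesis using f by blast
qed

lemma c_diff: "f \<in> vecs H \<Longrightarrow> g \<in> vecs H \<Longrightarrow> c (f - g) i = c f i - c g i"
proof -
  assume a: "f \<in> vecs H" "g \<in> vecs H"
  have e: "f - g = f + cscale (-1) g" by auto
  show ?thesis unfolding e
    using c_add[of f "cscale (-1) g" i] c_scale[of g "-1" i] a cfun.subspace_scale[OF subspace a(2), of "-1"]
    by simp
qed

sublocale hilbert_function_space H
proof
  show "cfun.subspace (vecs H)" by (rule subspace)
next
  fix f g h assume a: "f \<in> vecs H" "g \<in> vecs H" "h \<in> vecs H"
  then have fg: "f + g \<in> vecs H" using subspace cfun.subspace_add by blast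
  have "((\<lambda>i. complex_of_real (w i) * c f i * cnj (c h i) + complex_of_real (w i) * c g i * cnj (c h i))
      has_sum (ip H f h + ip H g h)) UNIV"
    by (intro has_sum_add ip_has_sum a)
  moreover have "(\<lambda>i. complex_of_real (w i) * c f i * cnj (c h i) + complex_of_real (w i) * c g i * cnj (c h i))
      = (\<lambda>i. complex_of_real (w i) * c (f + g) i * cnj (c h i))"
    using c_add[OF a(1,2)] by (simp add: algebra_simps)
  ultimately show "ip H (f + g) h = ip H f h + ip H g h"
    using ip_has_sum[OF fg a(3)] has_sum_unique by metis
next
  fix f h k assume a: "f \<in> vecs H" "h \<in> vecs H"
  then have fk: "cscale k f \<in> vecs H" using subspace cfun.subspace_scale by blast
  have "((\<lambda>i. k * (complex_of_real (w i) * c f i * cnj (c h i))) has_sum (k * ip H f h)) UNIV"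
    by (intro has_sum_cmult_right ip_has_sum a)
  moreover have "(\<lambda>i. k * (complex_of_real (w i) * c f i * cnj (c h i)))
      = (\<lambda>i. complex_of_real (w i) * c (cscale k f) i * cnj (c h i))"
    using c_scale[OF a(1)] by (simp add: algebra_simps)
  ultimately show "ip H (cscale k f) h = k * ip H f h"
    using ip_has_sum[OF fk a(2)] has_sum_unique by metis
next
  fix f g assume a: "f \<in> vecs H" "g \<in> vecs H"
  have "((\<lambda>i. cnj (complex_of_real (w i) * c f i * cnj (c g i))) has_sum cnj (ip H f g)) UNIV"
    by (rule has_sum_cnj_iff[THEN iffD2, OF ip_has_sum[OF a]])
  moreover have "(\<lambda>i. cnj (complex_of_real (w i) * c f i * cnj (c g i)))
      = (\<lambda>i. complex_of_real (w i) * c g i * cnj (c f i))"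
    by (simp add: algebra_simps)
  ultimately show "ip H g f = cnj (ip H f g)"
    using ip_has_sum[OF a(2,1)] has_sum_unique by metis
next
  fix f assume a: "f \<in> vecs H"
  show "0 \<le> Re (ip H f f)"
    using ip_self_has_sum[OF a] by (rule has_sum_nonneg) (simp add: w_nonneg)
  assume z: "Re (ip H f f) = 0"
  have "c f i = 0" for i
  proof -
    have "w i * (cmod (c f i))\<^sup>2 \<le> 0" using norm_coeff_le[OF a, of i] z by simp
    then show ?thesis using w_pos[of i] by (simp add: mult_le_0_iff)
  qed
  then show "f = 0" using c_inj[OF a] by blast
next
  fix X :: "nat \<Rightarrow> 'x \<Rightarrow> complex"
  assume X: "\<And>n. X n \<in> vecs H"
    and cauchy: "\<And>e. e > 0 \<Longrightarrow> \<exists>N. \<forall>m\<ge>N. \<forall>n\<ge>N. hnorm H (X m - X n) < e"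
  have Xd: "X m - X n \<in> vecs H" for m n using X subspace cfun.subspace_diff by blast
  have "Cauchy (\<lambda>n. c (X n) i)" for i
  proof (rule metric_CauchyI)
    fix e :: real assume "e > 0"
    then obtain N where N: "\<And>m n. m \<ge> N \<Longrightarrow> n \<ge> N \<Longrightarrow> hnorm H (X m - X n) < e"
      using cauchy by blast
    have "dist (c (X m) i) (c (X n) i) < e" if "m \<ge> N" "n \<ge> N" for m n
    proof -
      have "1 * (cmod (c (X m - X n) i))\<^sup>2 \<le> w i * (cmod (c (X m - X n) i))\<^sup>2"
        by (intro mult_right_mono w_ge1) simp
      also have "\<dots> \<le> Re (ip H (X m - X n) (X m - X n))" by (rule norm_coeff_le[OF Xd])
      finally have "cmod (c (X m - X n) i) \<le> hnorm H (X m - X n)"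
        by (simp add: hnorm_def real_le_rsqrt)
      then show ?thesis using N[OF that] by (simp add: dist_norm c_diff X)
    qed
    then show "\<exists>M. \<forall>m\<ge>M. \<forall>n\<ge>M. dist (c (X m) i) (c (X n) i) < e" by blast
  qed
  then have "\<exists>a. \<forall>i. (\<lambda>n. c (X n) i) \<longlonglongrightarrow> a i"
    by (meson Cauchy_convergent convergent_def)
  then obtain a where a: "\<And>i. (\<lambda>n. c (X n) i) \<longlonglongrightarrow> a i" by blast
  \<comment> \<open>With \<open>m\<close> fixed, \<open>X m - X n\<close> converges coefficientwise
    to \<open>X m\<close> minus the limit, and the Cauchy bound survives by
    \<open>bounded_limit_weak\<close>.\<close>
  have key: "\<exists>N. \<forall>m\<ge>N. \<exists>d\<in>vecs H. c d = (\<lambda>i. c (X m) i - a i) \<and> Re (ip H d d) \<le> e\<^sup>2"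
    if e: "e > 0" for e
  proof -
    obtain N where N: "\<And>m n. m \<ge> N \<Longrightarrow> n \<ge> N \<Longrightarrow> hnorm H (X m - X n) < e"
      using cauchy[OF e] by blast
    have "\<exists>d\<in>vecs H. c d = (\<lambda>i. c (X m) i - a i) \<and> Re (ip H d d) \<le> e\<^sup>2" if m: "m \<ge> N" for m
    proof (rule bounded_limit_weak[where X = "\<lambda>n. X m - X (n + N)"])
      show "X m - X (n + N) \<in> vecs H" for n by (rule Xd)
      show "Re (ip H (X m - X (n + N)) (X m - X (n + N))) \<le> e\<^sup>2" for n
        using N[OF m, of "n + N"] e unfolding hnorm_def by (intro sqrt_le_D) simp
      show "(\<lambda>n. c (X m - X (n + N)) i) \<longlonglongrightarrow> c (X m) i - a i" for i
        unfolding c_diff[OF X X] using LIMSEQ_ignore_initial_segment[OF a, of N i]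
        by (intro tendsto_intros)
    qed
    then show ?thesis by blast
  qed
  obtain N d where d: "d \<in> vecs H" "c d = (\<lambda>i. c (X N) i - a i)" using key[of 1] by auto
  \<comment> \<open>Square summability of \<open>a\<close> itself is not yet known, only that of its
    difference from the coefficients of \<open>X N\<close>; hence the detour by
    \<open>X N - d\<close>.\<close>
  define f where "f = X N - d"
  have f: "f \<in> vecs H" unfolding f_def using X d(1) subspace cfun.subspace_diff by blast
  have cf: "c f = a" using c_diff[OF X[of N] d(1)] d(2) by (auto simp: f_def)
  have "(\<lambda>n. hnorm H (X n - f)) \<longlonglongrightarrow> 0"
  proof (rule metric_LIMSEQ_I)
    fix r :: real assume r: "r > 0"
    then obtain N where N: "\<And>m. m \<ge> N \<Longrightarrow>
        \<exists>d\<in>vecs H. c d = (\<lambda>i. c (X m) i - a i) \<and> Re (ip H d d) \<le> (r/2)\<^sup>2"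
      using key[of "r/2"] by auto
    have "dist (hnorm H (X n - f)) 0 < r" if n: "n \<ge> N" for n
    proof -
      obtain d where d: "d \<in> vecs H" "c d = (\<lambda>i. c (X n) i - a i)" "Re (ip H d d) \<le> (r/2)\<^sup>2"
        using N[OF n] by blast
      have nf: "X n - f \<in> vecs H" using X f subspace cfun.subspace_diff by blast
      have "(X n - f) - d = 0"
        using nf d(1) cfun.subspace_diff[OF subspace]
        by (intro c_inj) (auto simp: c_diff X f d cf)
      then have "X n - f = d" using eq_iff_diff_eq_0[of "X n - f" d] by blast
      moreover have "0 \<le> Re (ip H d d)" using ip_self_has_sum[OF d(1)]
        by (rule has_sum_nonneg) (simp add: w_nonneg)
      moreover have "sqrt (Re (ip H d d)) \<le> r/2" using d(3) r by (intro real_le_lsqrt) auto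
      ultimately show ?thesis using r by (simp add: hnorm_def)
    qed
    then show "\<exists>no. \<forall>n\<ge>no. dist (hnorm H (X n - f)) 0 < r" by blast
  qed
  then show "\<exists>f\<in>vecs H. (\<lambda>n. hnorm H (X n - f)) \<longlonglongrightarrow> 0" using f by blast
qed

section \<open>Bounded coefficientwise limits and weak convergence\<close>

lemma coeff_zero [simp]: "c 0 i = 0"
  using c_diff[of 0 0 i] by simp

lemma c_eqI:
  assumes "f \<in> vecs H" "g \<in> vecs H" "\<And>i. c f i = c g i"
  shows "f = g"
proof -
  have "f - g = 0" using assms by (intro c_inj) (auto simp: c_diff)
  then show ?thesis using eq_iff_diff_eq_0[of f g] by blast
qed

lemma norm_coeff_le_hnorm: "f \<in> vecs H \<Longrightarrow> cmod (c f i) \<le> hnorm H f"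
proof -
  assume f: "f \<in> vecs H"
  have "1 * (cmod (c f i))\<^sup>2 \<le> w i * (cmod (c f i))\<^sup>2"
    by (intro mult_right_mono w_ge1) simp
  also have "\<dots> \<le> Re (ip H f f)" by (rule norm_coeff_le[OF f])
  finally show ?thesis by (simp add: hnorm_def real_le_rsqrt)
qed

lemma bounded_limit:
  assumes "\<And>n::nat. X n \<in> vecs H" "\<And>n. hnorm H (X n) \<le> B" "\<And>i. (\<lambda>n. c (X n) i) \<longlonglongrightarrow> a i"
  obtains f where "f \<in> vecs H" "c f = a" "hnorm H f \<le> B"
proof -
  have B: "B \<ge> 0" using assms(2)[of 0] hnorm_nonneg[OF assms(1)] order_trans by blast
  have "Re (ip H (X n) (X n)) \<le> B\<^sup>2" for n
    using power_mono[OF assms(2) hnorm_nonneg[OF assms(1)], of n 2] by (simp add: hnorm_sq assms(1))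
  from bounded_limit_weak[OF assms(1) this assms(3)]
  obtain f where f: "f \<in> vecs H" "c f = a" "Re (ip H f f) \<le> B\<^sup>2" by auto
  moreover have "hnorm H f \<le> B" using f(3) B by (simp add: hnorm_def real_le_lsqrt)
  ultimately show thesis using that by blast
qed

lemma finite_summable: "finite F \<Longrightarrow> (\<And>i. i \<notin> F \<Longrightarrow> a i = 0) \<Longrightarrow> (\<lambda>i. w i * (cmod (a i))\<^sup>2) summable_on UNIV"
  by (subst summable_on_cong_neutral[where T = F and g = "\<lambda>i. w i * (cmod (a i))\<^sup>2"]) auto

lemma finite_support_exists:
  assumes "finite F" "\<And>i. i \<notin> F \<Longrightarrow> a i = 0"
  obtains f where "f \<in> vecs H" "c f = a"
  using c_surj[OF finite_summable[OF assms(1), of a]] assms(2) that by auto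

lemma ip_finite:
  assumes "f \<in> vecs H" "g \<in> vecs H" "finite F" "\<And>i. i \<notin> F \<Longrightarrow> c g i = 0"
  shows "ip H f g = (\<Sum>i\<in>F. complex_of_real (w i) * c f i * cnj (c g i))"
proof -
  have "ip H f g = (\<Sum>\<^sub>\<infinity>i\<in>F. complex_of_real (w i) * c f i * cnj (c g i))"
    unfolding ip_eq[OF assms(1,2)] by (rule infsum_cong_neutral) (use assms(4) in auto)
  then show ?thesis using assms(3) by simp
qed

lemma finite_approx:
  assumes g: "g \<in> vecs H" and e: "e > 0"
  obtains F g' where "finite F" "g' \<in> vecs H" "c g' = (\<lambda>i. if i \<in> F then c g i else 0)"
    "hnorm H (g - g') < e"
proof -
  let ?s = "\<lambda>i. w i * (cmod (c g i))\<^sup>2"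
  have "(sum ?s \<longlongrightarrow> Re (ip H g g)) (finite_subsets_at_top UNIV)"
    using ip_self_has_sum[OF g] by (simp add: has_sum_def)
  then have "\<forall>\<^sub>F F in finite_subsets_at_top UNIV. dist (sum ?s F) (Re (ip H g g)) < e\<^sup>2"
    using e by (intro tendstoD) auto
  then obtain F where F: "finite F" "dist (sum ?s F) (Re (ip H g g)) < e\<^sup>2"
    by (auto simp: eventually_finite_subsets_at_top)
  obtain g' where g': "g' \<in> vecs H" "c g' = (\<lambda>i. if i \<in> F then c g i else 0)"
    using finite_support_exists[OF F(1), of "\<lambda>i. if i \<in> F then c g i else 0"] by auto
  have d: "g - g' \<in> vecs H" using g g' by blast
  have "(?s has_sum (Re (ip H g g) - sum ?s F)) (UNIV - F)"
    by (intro has_sum_Diff ip_self_has_sum g has_sum_finite F) auto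
  then have "((\<lambda>i. w i * (cmod (c (g - g') i))\<^sup>2) has_sum (Re (ip H g g) - sum ?s F)) UNIV"
    by (rule has_sum_cong_neutral[THEN iffD1, rotated -1]) (auto simp: c_diff g g')
  then have "Re (ip H (g - g') (g - g')) = Re (ip H g g) - sum ?s F"
    using ip_self_has_sum[OF d] has_sum_unique by blast
  then have "Re (ip H (g - g') (g - g')) < e\<^sup>2"
    using F(2) by (simp add: dist_real_def)
  then have "hnorm H (g - g') < e"
    using e by (simp add: hnorm_def real_sqrt_less_iff real_less_lsqrt)
  then show thesis using that F(1) g' by blast
qed

text \<open>Against a finitely supported \<open>g'\<close> the inner product is a finite sum of
  coefficients; boundedness of \<open>X\<close> controls the error of replacing \<open>g\<close> by
  \<open>g'\<close>.\<close>

lemma weak_convergence: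
  assumes X: "\<And>n::nat. X n \<in> vecs H" and f: "f \<in> vecs H"
    and B: "\<And>n. hnorm H (X n) \<le> B" and lim: "\<And>i. (\<lambda>n. c (X n) i) \<longlonglongrightarrow> c f i"
    and g: "g \<in> vecs H"
  shows "(\<lambda>n. ip H (X n) g) \<longlonglongrightarrow> ip H f g"
proof (rule metric_LIMSEQ_I)
  fix r :: real assume r: "r > 0"
  have Bnn: "B \<ge> 0" using B[of 0] hnorm_nonneg[OF X] order_trans by blast
  \<comment> \<open>\<open>C\<close> bounds \<open>hnorm H (X n - f)\<close>, the summand 1 making
    it positive, so the choice of \<open>r / (2 * C)\<close> leaves \<open>r / 2\<close> for the
    finite part.\<close>
  define C where "C = B + hnorm H f + 1"
  have C: "C > 0" using Bnn hnorm_nonneg[OF f] by (simp add: C_def)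
  have rC: "r / (2 * C) > 0" using r C by simp
  obtain F g' where F: "finite F" and g': "g' \<in> vecs H" "c g' = (\<lambda>i. if i \<in> F then c g i else 0)"
    and small: "hnorm H (g - g') < r / (2 * C)"
    by (rule finite_approx[OF g rC])
  have fin: "ip H h g' = (\<Sum>i\<in>F. complex_of_real (w i) * c h i * cnj (c g' i))" if "h \<in> vecs H" for h
    by (rule ip_finite[OF that g'(1) F]) (simp add: g'(2))
  have "(\<lambda>n. ip H (X n) g') \<longlonglongrightarrow> ip H f g'"
    unfolding fin[OF X] fin[OF f] by (intro tendsto_intros lim)
  then obtain N where N: "\<And>n. n \<ge> N \<Longrightarrow> dist (ip H (X n) g') (ip H f g') < r/2"
    using r metric_LIMSEQ_D[of _ _ "r/2"] by fastforce
  have "dist (ip H (X n) g) (ip H f g) < r" if n: "n \<ge> N" for n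
  proof -
    have "ip H (X n) g - ip H f g = ip H (X n - f) (g - g') + (ip H (X n) g' - ip H f g')"
      using X f g g'(1) by (simp add: ip_diff ip_diff_right)
    then have "cmod (ip H (X n) g - ip H f g)
        \<le> cmod (ip H (X n - f) (g - g')) + cmod (ip H (X n) g' - ip H f g')"
      by (metis norm_triangle_ineq)
    moreover have "cmod (ip H (X n - f) (g - g')) \<le> hnorm H (X n - f) * hnorm H (g - g')"
      using X f g g'(1) by (intro Cauchy_Schwarz) auto
    moreover have "hnorm H (X n - f) \<le> hnorm H (X n) + hnorm H f"
      using hnorm_triangle_diff[of "X n" 0 f] hnorm_minus_commute[of 0 f] X f by simp
    then have "hnorm H (X n - f) \<le> C" using B[of n] by (simp add: C_def)
    then have "hnorm H (X n - f) * hnorm H (g - g') \<le> C * (r / (2 * C))"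
      using small C g g'(1) by (intro mult_mono hnorm_nonneg) auto
    ultimately show ?thesis using N[OF n] C by (simp add: dist_norm)
  qed
  then show "\<exists>no. \<forall>n\<ge>no. dist (ip H (X n) g) (ip H f g) < r" by blast
qed

text \<open>Bounded coefficientwise limits are weak limits, so a closed subspace contains them.\<close>

lemma closed_subspace_bounded_limit:
  assumes S: "closed_subspace H S" and X: "\<And>n::nat. X n \<in> S" and B: "\<And>n. hnorm H (X n) \<le> B"
    and lim: "\<And>i. (\<lambda>n. c (X n) i) \<longlonglongrightarrow> a i"
  obtains f where "f \<in> S" "c f = a" "hnorm H f \<le> B"
proof -
  have Xv: "X n \<in> vecs H" for n using X closed_subspaceD(1)[OF S] by blast
  obtain f where f: "f \<in> vecs H" "c f = a" "hnorm H f \<le> B" using bounded_limit[OF Xv B lim] .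
  have "ip H f g = 0" if g: "g \<in> orth_compl H S" for g
  proof -
    have gv: "g \<in> vecs H" using g by (simp add: orth_compl_def)
    have "ip H (X n) g = 0" for n
      using g X[of n] ip_eq_0_sym[OF gv Xv[of n]] by (auto simp: orth_compl_def)
    moreover have "(\<lambda>n. ip H (X n) g) \<longlonglongrightarrow> ip H f g"
      by (rule weak_convergence[OF Xv f(1) B _ gv]) (simp add: f(2) lim)
    ultimately show ?thesis by (simp add: LIMSEQ_const_iff)
  qed
  then have "f \<in> S" by (rule mem_closed_subspaceI[OF S f(1)])
  then show thesis using that f by blast
qed

end

section \<open>The Sarason inequality\<close>

text \<open>Taking \<open>Re\<close> makes the condition meaningful for every kernel; the form of a
  symmetric real kernel is real anyway.\<close>

definition psd_kernel :: "nat \<Rightarrow> (nat \<Rightarrow> nat \<Rightarrow> real) \<Rightarrow> bool" where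
  "psd_kernel N k \<longleftrightarrow>
    (\<forall>y. 0 \<le> Re (\<Sum>a\<le>N. \<Sum>b\<le>N. complex_of_real (k a b) * y a * cnj (y b)))"

lemma psd_kernelD:
  "psd_kernel N k \<Longrightarrow> 0 \<le> Re (\<Sum>a\<le>N. \<Sum>b\<le>N. complex_of_real (k a b) * y a * cnj (y b))"
  by (simp add: psd_kernel_def)

lemma psd_kernel_cong:
  assumes "psd_kernel N k'" "\<And>a b. a \<le> N \<Longrightarrow> b \<le> N \<Longrightarrow> k a b = k' a b"
  shows "psd_kernel N k"
proof -
  have "(\<Sum>a\<le>N. \<Sum>b\<le>N. complex_of_real (k a b) * y a * cnj (y b))
      = (\<Sum>a\<le>N. \<Sum>b\<le>N. complex_of_real (k' a b) * y a * cnj (y b))" for y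
    by (intro sum.cong refl) (simp add: assms(2))
  then show ?thesis using assms(1) by (simp add: psd_kernel_def)
qed

lemma psd_kernel_rank1: "psd_kernel N (\<lambda>a b. u a * u b)"
proof -
  have "(\<Sum>a\<le>N. \<Sum>b\<le>N. complex_of_real (u a * u b) * y a * cnj (y b))
      = of_real ((cmod (\<Sum>a\<le>N. of_real (u a) * y a))\<^sup>2)" for y
    unfolding complex_norm_square by (simp add: sum_product algebra_simps)
  then show ?thesis by (simp add: psd_kernel_def del: of_real_power of_real_mult)
qed

lemma psd_kernel_add:
  assumes "psd_kernel N k" "psd_kernel N k'"
  shows "psd_kernel N (\<lambda>a b. k a b + k' a b)"
proof -
  have "(\<Sum>a\<le>N. \<Sum>b\<le>N. complex_of_real (k a b + k' a b) * y a * cnj (y b))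
      = (\<Sum>a\<le>N. \<Sum>b\<le>N. complex_of_real (k a b) * y a * cnj (y b))
      + (\<Sum>a\<le>N. \<Sum>b\<le>N. complex_of_real (k' a b) * y a * cnj (y b))" for y
    by (simp add: algebra_simps sum.distrib)
  then show ?thesis using psd_kernelD[OF assms(1)] psd_kernelD[OF assms(2)]
    by (simp add: psd_kernel_def)
qed

lemma psd_kernel_zero: "psd_kernel N (\<lambda>a b. 0)"
  by (simp add: psd_kernel_def)

lemma psd_kernel_sum:
  assumes "finite L" "\<And>l. l \<in> L \<Longrightarrow> psd_kernel N (k l)"
  shows "psd_kernel N (\<lambda>a b. \<Sum>l\<in>L. k l a b)"
  using assms
proof (induction L rule: finite_induct)
  case empty
  show ?case by (simp add: psd_kernel_zero)
next
  case (insert l L)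
  then show ?case using psd_kernel_add[of N "k l" "\<lambda>a b. \<Sum>l\<in>L. k l a b"] by simp
qed

text \<open>The factors \<open>u\<close> are absorbed into the vector \<open>y\<close>. Together
  with sums this stands in for Schur's product theorem, because one factor of the product considered
  below is a sum of rank one kernels.\<close>

lemma psd_kernel_mult_rank1:
  assumes "psd_kernel N k"
  shows "psd_kernel N (\<lambda>a b. u a * u b * k a b)"
  unfolding psd_kernel_def
proof
  fix y
  have "(\<Sum>a\<le>N. \<Sum>b\<le>N. complex_of_real (u a * u b * k a b) * y a * cnj (y b))
      = (\<Sum>a\<le>N. \<Sum>b\<le>N. complex_of_real (k a b) * (of_real (u a) * y a) * cnj (of_real (u b) * y b))"
    by (simp add: algebra_simps)
  then show "0 \<le> Re (\<Sum>a\<le>N. \<Sum>b\<le>N. complex_of_real (u a * u b * k a b) * y a * cnj (y b))"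
    using psd_kernelD[OF assms, of "\<lambda>a. of_real (u a) * y a"] by simp
qed

lemma psd_kernel_scale: "psd_kernel N k \<Longrightarrow> s \<ge> 0 \<Longrightarrow> psd_kernel N (\<lambda>a b. s * k a b)"
  using psd_kernel_mult_rank1[of N k "\<lambda>_. sqrt s"] by simp

text \<open>With truncated subtraction, \<open>(a - b) + (b - a)\<close> is the distance of two natural numbers.\<close>

lemma psd_kernel_power_dist:
  fixes r :: real
  assumes "0 \<le> r" "r \<le> 1"
  shows "psd_kernel N (\<lambda>a b. r ^ ((a - b) + (b - a)))"
proof -
  define u where "u l a = (if l \<le> a then r ^ (a - l) else 0)" for l a :: nat
  \<comment> \<open>A Gram representation: the geometric series in \<open>r\<^sup>2\<close> up to
    \<open>min a b\<close> gives everything but the term with exponent \<open>a + b + 2\<close>,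
    which is itself of rank one.\<close>
  have split: "r ^ ((a - b) + (b - a))
      = (1 - r\<^sup>2) * (\<Sum>l\<le>N. u l a * u l b) + r ^ Suc a * r ^ Suc b" if "a \<le> N" "b \<le> N" for a b
  proof -
    let ?m = "min a b" let ?d = "(a - b) + (b - a)"
    have "(\<Sum>l\<le>N. u l a * u l b) = (\<Sum>l\<le>?m. r ^ (a - l) * r ^ (b - l))"
      using that by (intro sum.mono_neutral_cong_right) (auto simp: u_def)
    also have "\<dots> = (\<Sum>l\<le>?m. r ^ ?d * (r\<^sup>2) ^ (?m - l))"
    proof (rule sum.cong[OF refl])
      fix l assume "l \<in> {..?m}"
      then have "(a - l) + (b - l) = ?d + 2 * (?m - l)" by auto
      then show "r ^ (a - l) * r ^ (b - l) = r ^ ?d * (r\<^sup>2) ^ (?m - l)"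
        by (metis power_add power_mult)
    qed
    also have "\<dots> = r ^ ?d * (\<Sum>l\<le>?m. (r\<^sup>2) ^ l)"
      unfolding sum_distrib_left[symmetric] by (simp add: sum.nat_diff_reindex atLeast0AtMost
          sum.atLeastAtMost_rev[of "\<lambda>l. (r\<^sup>2) ^ l" 0, simplified atLeast0AtMost])
    finally have "(1 - r\<^sup>2) * (\<Sum>l\<le>N. u l a * u l b) = r ^ ?d * ((1 - r\<^sup>2) * (\<Sum>l\<le>?m. (r\<^sup>2) ^ l))"
      by (simp only: mult.left_commute)
    then have "(1 - r\<^sup>2) * (\<Sum>l\<le>N. u l a * u l b) = r ^ ?d * (1 - (r\<^sup>2) ^ Suc ?m)"
      unfolding sum_gp_basic .
    moreover have "r ^ ?d * (r\<^sup>2) ^ Suc ?m = r ^ Suc a * r ^ Suc b"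
    proof -
      have "?d + 2 * Suc ?m = Suc a + Suc b" by auto
      then show ?thesis by (metis power_add power_mult)
    qed
    ultimately show ?thesis by (simp only: right_diff_distrib)
  qed
  have "1 - r\<^sup>2 \<ge> 0" using assms by (simp add: power_le_one)
  then have "psd_kernel N (\<lambda>a b. (1 - r\<^sup>2) * (\<Sum>l\<le>N. u l a * u l b) + r ^ Suc a * r ^ Suc b)"
    by (intro psd_kernel_add psd_kernel_scale psd_kernel_sum psd_kernel_rank1) auto
  then show ?thesis by (rule psd_kernel_cong) (rule split)
qed

text \<open>\<open>1 / (1 + n)\<close> is the integral of \<open>r ^ n\<close> over [0,1], so this
  kernel is an average of those in \<open>psd_kernel_power_dist\<close>.\<close>

lemma psd_kernel_inverse_dist: "psd_kernel N (\<lambda>a b. 1 / (1 + real ((a - b) + (b - a))))"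
  unfolding psd_kernel_def
proof
  fix y :: "nat \<Rightarrow> complex"
  let ?R = "\<lambda>k. Re (\<Sum>a\<le>N. \<Sum>b\<le>N. complex_of_real (k a b) * y a * cnj (y b))"
  have R: "?R k = (\<Sum>a\<le>N. \<Sum>b\<le>N. k a b * Re (y a * cnj (y b)))" for k
    by (simp add: algebra_simps)
  have "((\<lambda>r. r ^ n) has_integral 1 / (1 + real n)) {0..1::real}" for n
  proof -
    have "((\<lambda>r. r ^ Suc n / (1 + real n)) has_vector_derivative r ^ n) (at r within {0..1})" for r :: real
      unfolding has_real_derivative_iff_has_vector_derivative[symmetric]
      by (rule derivative_eq_intros refl | simp)+
    then show ?thesis
      using fundamental_theorem_of_calculus[of 0 1 "\<lambda>r. r ^ Suc n / (1 + real n)" "\<lambda>r. r ^ n"] by simp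
  qed
  then have "((\<lambda>r. ?R (\<lambda>a b. r ^ ((a - b) + (b - a))))
      has_integral ?R (\<lambda>a b. 1 / (1 + real ((a - b) + (b - a))))) {0..1::real}"
    unfolding R by (intro has_integral_sum has_integral_mult_left finite_atMost)
  then show "0 \<le> ?R (\<lambda>a b. 1 / (1 + real ((a - b) + (b - a))))"
    by (rule has_integral_nonneg) (intro psd_kernelD psd_kernel_power_dist; simp)
qed

text \<open>Makes \<open>min\<close> a sum of rank one kernels, the shape that
  \<open>psd_kernel_mult_rank1\<close> accepts.\<close>

lemma min_as_sum: "a \<le> N \<Longrightarrow> b \<le> N \<Longrightarrow>
  real (min a b) = (\<Sum>l<N. (if l < a then 1 else 0) * (if l < b then 1 else 0))"
proof -
  assume "a \<le> N" "b \<le> N"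
  then have "(\<Sum>l<N. (if l < a then 1 else 0) * (if l < b then 1 else 0 :: real)) = (\<Sum>l<min a b. 1)"
    by (intro sum.mono_neutral_cong_right) auto
  then show ?thesis by simp
qed

text \<open>
  The difference of the kernels of \<open>\<langle>V g, g\<rangle>\<close> and \<open>\<parallel>f g\<parallel>\<^sup>2\<close>; in the Dirichlet case it is
  \<open>min a b \<cdot> min (N - a) (N - b) / (1 + |a - b|)\<close>.
\<close>

lemma psd_kernel_weight_difference:
  "psd_kernel N (\<lambda>a b. weight K (N - min a b) * weight K (max a b) / weight K ((a - b) + (b - a))
     - weight K N)"
proof (cases K)
  case Hardy
  then show ?thesis by (simp add: psd_kernel_zero)
next
  case Dirichlet
  let ?q = "\<lambda>a b. 1 / (1 + real ((a - b) + (b - a)))"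
  let ?u = "\<lambda>l a. if l < a then 1 else 0 :: real"
  have eq: "weight K (N - min a b) * weight K (max a b) / weight K ((a - b) + (b - a)) - weight K N
      = (\<Sum>l<N. \<Sum>l'<N. (?u l a * ?u l' (N - a)) * (?u l b * ?u l' (N - b)) * ?q a b)"
    if ab: "a \<le> N" "b \<le> N" for a b
  proof -
    \<comment> \<open>In these variables \<open>N = m + n + d\<close>, and
      \<open>(n + d + 1) (m + d + 1) - (1 + d) (m + n + d + 1)\<close> equals
      \<open>m n\<close>.\<close>
    define d m n where "d = real ((a - b) + (b - a))" and "m = real (min a b)" and "n = real (min (N - a) (N - b))"
    have M: "real (max a b) = m + d" by (auto simp: m_def d_def)
    have Nm: "real (N - min a b) = n + d" using ab by (auto simp: m_def d_def n_def of_nat_diff)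
    have N: "real N = m + n + d" using ab by (auto simp: m_def d_def n_def of_nat_diff)
    have d: "1 + d > 0" by (simp add: d_def)
    have "weight K (N - min a b) * weight K (max a b) / weight K ((a - b) + (b - a)) - weight K N
        = (n + d + 1) * (m + d + 1) / (1 + d) - (m + n + d + 1)"
      unfolding Dirichlet weight.simps N Nm M by (simp add: d_def algebra_simps)
    also have "\<dots> = m * n * (1 / (1 + d))"
      using d by (simp add: field_simps)
    also have "\<dots> = (\<Sum>l<N. ?u l a * ?u l b) * (\<Sum>l'<N. ?u l' (N - a) * ?u l' (N - b)) * ?q a b"
      unfolding m_def n_def d_def using ab by (subst (1 2) min_as_sum[of _ N]) auto
    also have "\<dots> = (\<Sum>l<N. \<Sum>l'<N. (?u l a * ?u l' (N - a)) * (?u l b * ?u l' (N - b)) * ?q a b)"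
      unfolding sum_product unfolding sum_distrib_right by (intro sum.cong refl) (simp add: ac_simps)
    finally show ?thesis .
  qed
  have "psd_kernel N (\<lambda>a b. \<Sum>l<N. \<Sum>l'<N. (?u l a * ?u l' (N - a)) * (?u l b * ?u l' (N - b)) * ?q a b)"
    by (intro psd_kernel_sum psd_kernel_mult_rank1[where u = "\<lambda>a. ?u _ a * ?u _ (N - a)"]
        psd_kernel_inverse_dist finite_lessThan)
  then show ?thesis by (rule psd_kernel_cong) (rule eq)
qed

section \<open>The function V and its inequality for polynomials\<close>

text \<open>Off-diagonal terms pair up as complex conjugates. This accounts for the factor 2 in the
  coefficients of \<open>sarason\<close> of positive index.\<close>

lemma Re_hermitian_sum:
  fixes k :: "nat \<Rightarrow> nat \<Rightarrow> real"
  assumes sym: "\<And>a b. k a b = k b a"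
  shows "Re (\<Sum>a\<le>N. \<Sum>b\<le>N. complex_of_real (k a b) * x a * cnj (x b))
    = Re (\<Sum>a\<le>N. \<Sum>b\<le>a. (if a = b then 1 else 2) * complex_of_real (k a b) * x a * cnj (x b))"
proof (induction N)
  case 0
  show ?case by simp
next
  case (Suc N)
  let ?t = "\<lambda>a b. complex_of_real (k a b) * x a * cnj (x b)"
  have "(\<Sum>a\<le>Suc N. \<Sum>b\<le>Suc N. ?t a b) = (\<Sum>a\<le>N. \<Sum>b\<le>N. ?t a b) + (\<Sum>a\<le>N. ?t a (Suc N))
      + ((\<Sum>b\<le>N. ?t (Suc N) b) + ?t (Suc N) (Suc N))"
    by (simp add: sum.distrib)
  moreover have "(\<Sum>a\<le>N. ?t a (Suc N)) = cnj (\<Sum>b\<le>N. ?t (Suc N) b)"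
    unfolding cnj_sum by (intro sum.cong refl) (simp add: sym[of _ "Suc N"] ac_simps)
  ultimately have "Re (\<Sum>a\<le>Suc N. \<Sum>b\<le>Suc N. ?t a b) = Re (\<Sum>a\<le>N. \<Sum>b\<le>N. ?t a b)
      + 2 * Re (\<Sum>b\<le>N. ?t (Suc N) b) + Re (?t (Suc N) (Suc N))"
    by simp
  moreover have "(\<Sum>b\<le>Suc N. (if Suc N = b then 1 else 2) * complex_of_real (k (Suc N) b) * x (Suc N) * cnj (x b))
      = 2 * (\<Sum>b\<le>N. ?t (Suc N) b) + ?t (Suc N) (Suc N)"
    by (simp add: sum_distrib_left mult.assoc)
  ultimately show ?case using Suc.IH by simp
qed

text \<open>For \<open>F\<close> of degree below \<open>B\<close> this is the inner product of
  \<open>F\<close> with \<open>X ^ n * F\<close>.\<close>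

definition sarason_coeff :: "disc_space \<Rightarrow> nat \<Rightarrow> complex fps \<Rightarrow> nat \<Rightarrow> complex" where
  "sarason_coeff K B F n =
    (\<Sum>a<B. if n \<le> a then of_real (weight K a) * fps_nth F a * cnj (fps_nth F (a - n)) else 0)"

definition sarason :: "disc_space \<Rightarrow> nat \<Rightarrow> complex fps \<Rightarrow> complex fps" where
  "sarason K B F = Abs_fps (\<lambda>n. (if n = 0 then 1 else 2) * sarason_coeff K B F n / of_real (weight K n))"

lemma weight_pos [simp]: "0 < weight K m" and weight_ge1: "1 \<le> weight K m"
  by (cases K; simp)+

text \<open>
  \<open>sarason K B F\<close> is the analytic function \<open>V\<close> with \<open>Re \<langle>V g, g\<rangle> \<ge> \<parallel>F g\<parallel>\<^sup>2\<close>; its coefficients are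
  those of \<open>2 \<langle>F, k\<^sub>z F\<rangle> - \<parallel>F\<parallel>\<^sup>2\<close>, \<open>k\<^sub>z\<close> being the reproducing kernel.
\<close>

lemma sarason_inequality:
  assumes F: "\<And>i. i \<ge> B \<Longrightarrow> fps_nth F i = 0" and G: "\<And>i. i \<ge> B \<Longrightarrow> fps_nth G i = 0"
  shows "(\<Sum>N<2*B. weight K N * (cmod (fps_nth (F * G) N))\<^sup>2)
    \<le> Re (\<Sum>j<B. of_real (weight K j) * fps_nth (sarason K B F * G) j * cnj (fps_nth G j))"
proof -
  let ?w = "weight K"
  \<comment> \<open>\<open>W N\<close> is the kernel of the degree \<open>N\<close> part of
    \<open>Re \<langle>V g, g\<rangle>\<close>, as a form in the products
    \<open>x N a\<close>.\<close>
  define W where "W N a b = ?w (N - min a b) * ?w (max a b) / ?w ((a - b) + (b - a))" for N a b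
  define x where "x N a = fps_nth F a * fps_nth G (N - a)" for N a
  define T1 where "T1 = (SIGMA j:{..<B}. SIGMA i:{..j}. {a. a < B \<and> j - i \<le> a})"
  define T2 where "T2 = (SIGMA N:{..<2*B}. SIGMA a:{..N}. {..a})"
  define t1 where "t1 = (\<lambda>(j, i, a). complex_of_real (?w j) * ((if j = i then 1 else 2)
      * (of_real (?w a) * fps_nth F a * cnj (fps_nth F (a - (j - i)))) / of_real (?w (j - i)))
      * fps_nth G i * cnj (fps_nth G j))"
  define t2 where "t2 = (\<lambda>(N, a, b). (if a = b then 1 else 2) * complex_of_real (W N a b) * x N a * cnj (x N b))"
  have "(\<Sum>j<B. of_real (?w j) * fps_nth (sarason K B F * G) j * cnj (fps_nth G j))
      = (\<Sum>j<B. \<Sum>i\<le>j. \<Sum>a\<in>{a. a < B \<and> j - i \<le> a}. t1 (j, i, a))"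
  proof (rule sum.cong[OF refl])
    fix j
    have *: "fps_nth (sarason K B F * G) j = (\<Sum>i\<le>j. fps_nth (sarason K B F) (j - i) * fps_nth G i)"
      by (subst mult.commute) (simp add: fps_mult_nth atLeast0AtMost mult.commute)
    have "of_real (?w j) * (fps_nth (sarason K B F) (j - i) * fps_nth G i) * cnj (fps_nth G j)
        = (\<Sum>a\<in>{a. a < B \<and> j - i \<le> a}. t1 (j, i, a))" if "i \<le> j" for i
    proof -
      have s: "sarason_coeff K B F (j - i) = (\<Sum>a\<in>{a. a < B \<and> j - i \<le> a}.
          of_real (?w a) * fps_nth F a * cnj (fps_nth F (a - (j - i))))"
        unfolding sarason_coeff_def by (intro sum.mono_neutral_cong_right) auto
      have e: "j - i = 0 \<longleftrightarrow> j = i" using that by auto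
      show ?thesis
        unfolding sarason_def s t1_def fps_nth_Abs_fps e prod.case
        by (simp only: sum_distrib_left sum_distrib_right sum_divide_distrib ac_simps)
    qed
    then show "of_real (?w j) * fps_nth (sarason K B F * G) j * cnj (fps_nth G j)
        = (\<Sum>i\<le>j. \<Sum>a\<in>{a. a < B \<and> j - i \<le> a}. t1 (j, i, a))"
      unfolding * sum_distrib_left sum_distrib_right by (intro sum.cong refl) simp
  qed
  also have "\<dots> = sum t1 T1"
    unfolding T1_def by (simp add: sum.Sigma)
  \<comment> \<open>A term of \<open>t1\<close> contains \<open>F_a G_i\<close> and the conjugate of
    \<open>F_b G_j\<close> with \<open>b = a - (j - i)\<close>; both products have degree
    \<open>N = a + i = b + j\<close>, by which the sum is regrouped. Triples of \<open>T2\<close>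
    without a partner have \<open>a \<ge> B\<close> or \<open>N - b \<ge> B\<close> and contribute
    0.\<close>
  also have "\<dots> = sum t2 T2"
  proof (rule sum.reindex_bij_witness_not_neutral[where S' = "{}" and
        T' = "{(N, a, b) \<in> T2. \<not> (N - b < B \<and> a < B)}" and
        j = "\<lambda>(j, i, a). (a + i, a, a - (j - i))" and i = "\<lambda>(N, a, b). (N - b, N - a, a)"])
    show "finite {(N, a, b) \<in> T2. \<not> (N - b < B \<and> a < B)}"
      by (rule finite_subset[of _ T2]) (auto simp: T2_def)
    fix p assume "p \<in> T2 - {(N, a, b) \<in> T2. \<not> (N - b < B \<and> a < B)}"
    then show "(case case p of (N, a, b) \<Rightarrow> (N - b, N - a, a) of (j, i, a) \<Rightarrow> (a + i, a, a - (j - i))) = p"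
      and "(case p of (N, a, b) \<Rightarrow> (N - b, N - a, a)) \<in> T1 - {}"
      by (auto simp: T1_def T2_def)
  next
    fix p assume p: "p \<in> {(N, a, b) \<in> T2. \<not> (N - b < B \<and> a < B)}"
    then show "t2 p = 0" using F G by (auto simp: t2_def x_def not_less)
  next
    fix p assume "p \<in> T1 - {}"
    then obtain j i a where p: "p = (j, i, a)" "j < B" "i \<le> j" "a < B" "j - i \<le> a"
      by (auto simp: T1_def)
    show "(case case p of (j, i, a) \<Rightarrow> (a + i, a, a - (j - i)) of (N, a, b) \<Rightarrow> (N - b, N - a, a)) = p"
      and "(case p of (j, i, a) \<Rightarrow> (a + i, a, a - (j - i))) \<in> T2 - {(N, a, b) \<in> T2. \<not> (N - b < B \<and> a < B)}"
      using p by (auto simp: T2_def)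
  next
    fix p assume "p \<in> T1"
    then obtain j i a where p: "p = (j, i, a)" "j < B" "i \<le> j" "a < B" "j - i \<le> a"
      by (auto simp: T1_def)
    have e: "a + i - (a - (j - i)) = j" "min a (a - (j - i)) = a - (j - i)" "max a (a - (j - i)) = a"
      "(a - (a - (j - i))) + (a - (j - i) - a) = j - i" "a = a - (j - i) \<longleftrightarrow> j = i" "a + i - a = i"
      using p by auto
    show "t2 (case p of (j, i, a) \<Rightarrow> (a + i, a, a - (j - i))) = t1 p"
      unfolding p(1) prod.case t2_def t1_def W_def x_def e
      by (simp add: e)
  qed auto
  also have "\<dots> = (\<Sum>N<2*B. \<Sum>a\<le>N. \<Sum>b\<le>a. t2 (N, a, b))"
    unfolding T2_def by (simp add: sum.Sigma)
  finally have rhs: "Re (\<Sum>j<B. of_real (?w j) * fps_nth (sarason K B F * G) j * cnj (fps_nth G j))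
      = (\<Sum>N<2*B. Re (\<Sum>a\<le>N. \<Sum>b\<le>N. complex_of_real (W N a b) * x N a * cnj (x N b)))"
    unfolding t2_def prod.case
    by (subst Re_hermitian_sum) (auto simp: W_def min.commute max.commute add.commute)
  \<comment> \<open>Degree by degree, the left side is the form of the constant kernel
    \<open>weight K N\<close>, and \<open>psd_kernel_weight_difference\<close> makes
    \<open>W N\<close> dominate it.\<close>
  have "?w N * (cmod (fps_nth (F * G) N))\<^sup>2
      \<le> Re (\<Sum>a\<le>N. \<Sum>b\<le>N. complex_of_real (W N a b) * x N a * cnj (x N b))" for N
  proof -
    have FG: "fps_nth (F * G) N = (\<Sum>a\<le>N. x N a)"
      by (simp add: fps_mult_nth atLeast0AtMost x_def)
    have "complex_of_real (?w N * (cmod (fps_nth (F * G) N))\<^sup>2)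
        = (\<Sum>a\<le>N. \<Sum>b\<le>N. complex_of_real (?w N) * x N a * cnj (x N b))"
      unfolding of_real_mult complex_norm_square FG cnj_sum sum_product
      unfolding sum_distrib_left
      by (simp only: mult.assoc)
    then have "?w N * (cmod (fps_nth (F * G) N))\<^sup>2
        = Re (\<Sum>a\<le>N. \<Sum>b\<le>N. complex_of_real (?w N) * x N a * cnj (x N b))"
      by (metis Re_complex_of_real)
    moreover have "0 \<le> Re (\<Sum>a\<le>N. \<Sum>b\<le>N. complex_of_real (W N a b - ?w N) * x N a * cnj (x N b))"
      unfolding W_def by (rule psd_kernelD[OF psd_kernel_weight_difference])
    moreover have "(\<Sum>a\<le>N. \<Sum>b\<le>N. complex_of_real (W N a b - ?w N) * x N a * cnj (x N b))
        = (\<Sum>a\<le>N. \<Sum>b\<le>N. complex_of_real (W N a b) * x N a * cnj (x N b))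
        - (\<Sum>a\<le>N. \<Sum>b\<le>N. complex_of_real (?w N) * x N a * cnj (x N b))"
      by (simp only: of_real_diff left_diff_distrib sum_subtractf)
    ultimately show ?thesis by (simp only: minus_complex.simps)
  qed
  then show ?thesis unfolding rhs by (intro sum_mono)
qed

section \<open>Shift spaces\<close>

text \<open>The weights are affine in the index; this is the source of
  \<open>M_pow_norm\<close>.\<close>

lemma weight_add: "weight K (m + n) = weight K m + real n * (weight K (Suc m) - weight K m)"
  by (cases K) auto

lemma weight_Suc: "weight K m \<le> weight K (Suc m)" "weight K (Suc m) \<le> 2 * weight K m"
  by (cases K; simp)+

text \<open>Only the effect of the shift on coefficients is recorded, so that the one-variable
  theory can be carried out with formal power series.\<close>

locale shift_space = weighted_space H c "weight K"
  for H :: "'x function_space" and c :: "('x \<Rightarrow> complex) \<Rightarrow> nat \<Rightarrow> complex" and K +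
  fixes M :: "('x \<Rightarrow> complex) \<Rightarrow> 'x \<Rightarrow> complex"
  assumes M_vecs [simp, intro]: "f \<in> vecs H \<Longrightarrow> M f \<in> vecs H"
    and c_M: "f \<in> vecs H \<Longrightarrow> c (M f) n = (if n = 0 then 0 else c f (n - 1))"
begin

text \<open>The ring of formal power series gives meaning to products and inverses before they are
  known to belong to \<open>H\<close>.\<close>

definition E :: "('x \<Rightarrow> complex) \<Rightarrow> complex fps" where
  "E f = Abs_fps (c f)"

lemma E_nth [simp]: "fps_nth (E f) n = c f n"
  by (simp add: E_def)

lemma E_inject: "f \<in> vecs H \<Longrightarrow> g \<in> vecs H \<Longrightarrow> E f = E g \<Longrightarrow> f = g"
  by (rule c_eqI) (simp_all flip: E_nth)

lemma E_add: "f \<in> vecs H \<Longrightarrow> g \<in> vecs H \<Longrightarrow> E (f + g) = E f + E g"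
  by (simp add: fps_eq_iff c_add)

lemma E_diff: "f \<in> vecs H \<Longrightarrow> g \<in> vecs H \<Longrightarrow> E (f - g) = E f - E g"
  by (simp add: fps_eq_iff c_diff)

lemma E_scale: "f \<in> vecs H \<Longrightarrow> E (cscale k f) = fps_const k * E f"
  by (simp add: fps_eq_iff c_scale)

lemma E_M: "f \<in> vecs H \<Longrightarrow> E (M f) = fps_X * E f"
  by (simp add: fps_eq_iff c_M)

lemma M_add: "f \<in> vecs H \<Longrightarrow> g \<in> vecs H \<Longrightarrow> M (f + g) = M f + M g"
  by (rule E_inject) (auto simp: E_M E_add algebra_simps)

lemma M_scale: "f \<in> vecs H \<Longrightarrow> M (cscale k f) = cscale k (M f)"
  by (rule E_inject) (auto simp: E_M E_scale algebra_simps)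

lemma M_pow_vecs [simp, intro]: "f \<in> vecs H \<Longrightarrow> (M ^^ n) f \<in> vecs H"
  by (induction n) auto

lemma E_M_pow: "f \<in> vecs H \<Longrightarrow> E ((M ^^ n) f) = fps_X ^ n * E f"
  by (induction n) (auto simp: E_M mult.assoc)

lemma c_M_pow: "f \<in> vecs H \<Longrightarrow> c ((M ^^ n) f) i = (if i < n then 0 else c f (i - n))"
  using arg_cong[OF E_M_pow, of f "\<lambda>F. fps_nth F i" n] by (simp add: fps_X_power_mult_nth)

lemma norm_sums: "f \<in> vecs H \<Longrightarrow> (\<lambda>n. weight K n * (cmod (c f n))\<^sup>2) sums Re (ip H f f)"
  by (rule has_sum_imp_sums[OF ip_self_has_sum])

lemma M_pow_norm_sums:
  assumes "f \<in> vecs H"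
  shows "(\<lambda>m. weight K (m + n) * (cmod (c f m))\<^sup>2) sums Re (ip H ((M ^^ n) f) ((M ^^ n) f))"
proof -
  let ?g = "\<lambda>i. weight K i * (cmod (c ((M ^^ n) f) i))\<^sup>2"
  have "(\<Sum>i<n. ?g i) = 0" by (simp add: c_M_pow[OF assms])
  then have "(\<lambda>m. ?g (m + n)) sums Re (ip H ((M ^^ n) f) ((M ^^ n) f))"
    using norm_sums[OF M_pow_vecs[OF assms], of n] sums_iff_shift[of ?g n] by simp
  then show ?thesis by (simp add: c_M_pow[OF assms])
qed

text \<open>The shift is a 2-isometry: squared norms grow linearly along its powers because the
  weights do. In \<open>cyclic_vector\<close> this identity turns small increments into
  bounds.\<close>

lemma M_pow_norm:
  assumes "f \<in> vecs H"
  shows "(hnorm H ((M ^^ n) f))\<^sup>2 = (hnorm H f)\<^sup>2 + real n * ((hnorm H (M f))\<^sup>2 - (hnorm H f)\<^sup>2)"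
proof -
  let ?s = "\<lambda>m. weight K m * (cmod (c f m))\<^sup>2" and ?t = "\<lambda>m. weight K (Suc m) * (cmod (c f m))\<^sup>2"
  have "?s sums Re (ip H f f)" "?t sums Re (ip H (M f) (M f))"
    using norm_sums[OF assms] M_pow_norm_sums[OF assms, of 1] by simp_all
  then have "(\<lambda>m. ?s m + real n * (?t m - ?s m))
      sums (Re (ip H f f) + real n * (Re (ip H (M f) (M f)) - Re (ip H f f)))"
    by (intro sums_add sums_mult sums_diff)
  moreover have "(\<lambda>m. ?s m + real n * (?t m - ?s m)) = (\<lambda>m. weight K (m + n) * (cmod (c f m))\<^sup>2)"
    by (rule ext) (simp only: weight_add algebra_simps)
  ultimately show ?thesis
    using sums_unique2[OF M_pow_norm_sums[OF assms, of n]] assms by (simp add: hnorm_sq)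
qed

lemma hnorm_M:
  assumes "f \<in> vecs H"
  shows "hnorm H f \<le> hnorm H (M f)" "hnorm H (M f) \<le> 2 * hnorm H f"
proof -
  have s: "(\<lambda>m. weight K m * (cmod (c f m))\<^sup>2) sums (hnorm H f)\<^sup>2"
    "(\<lambda>m. weight K (Suc m) * (cmod (c f m))\<^sup>2) sums (hnorm H (M f))\<^sup>2"
    using norm_sums[OF assms] M_pow_norm_sums[OF assms, of 1] by (simp_all add: hnorm_sq assms)
  have "(hnorm H f)\<^sup>2 \<le> (hnorm H (M f))\<^sup>2"
    by (rule sums_le[OF _ s]) (intro mult_right_mono weight_Suc zero_le_power2)
  then show "hnorm H f \<le> hnorm H (M f)" by (rule power2_le_imp_le) (simp add: assms)
  have "(\<lambda>m. 2 * (weight K m * (cmod (c f m))\<^sup>2)) sums (2 * (hnorm H f)\<^sup>2)"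
    by (intro sums_mult s)
  then have "(hnorm H (M f))\<^sup>2 \<le> 2 * (hnorm H f)\<^sup>2"
  proof (rule sums_le[OF _ s(2), rotated])
    fix m show "weight K (Suc m) * (cmod (c f m))\<^sup>2 \<le> 2 * (weight K m * (cmod (c f m))\<^sup>2)"
      unfolding mult.assoc[symmetric] by (intro mult_right_mono weight_Suc zero_le_power2)
  qed
  also have "\<dots> \<le> (2 * hnorm H f)\<^sup>2" by (simp add: power_mult_distrib)
  finally show "hnorm H (M f) \<le> 2 * hnorm H f" by (rule power2_le_imp_le) (simp add: assms)
qed

lemma hnorm_M_pow_le: "f \<in> vecs H \<Longrightarrow> hnorm H ((M ^^ n) f) \<le> 2 ^ n * hnorm H f"
proof (induction n)
  case (Suc n)
  have "hnorm H ((M ^^ Suc n) f) \<le> 2 * hnorm H ((M ^^ n) f)"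
    using hnorm_M(2)[of "(M ^^ n) f"] Suc.prems by simp
  then show ?case using Suc by simp
qed simp

definition trunc :: "nat \<Rightarrow> ('x \<Rightarrow> complex) \<Rightarrow> 'x \<Rightarrow> complex" where
  "trunc n f = (SOME g. g \<in> vecs H \<and> c g = (\<lambda>i. if i < n then c f i else 0))"

lemma trunc_vecs [simp, intro]: "trunc n f \<in> vecs H"
  and c_trunc: "c (trunc n f) i = (if i < n then c f i else 0)"
proof -
  obtain g where "g \<in> vecs H" "c g = (\<lambda>i. if i < n then c f i else 0)"
    by (rule finite_support_exists[of "{..<n}" "\<lambda>i. if i < n then c f i else 0"]) auto
  then have "\<exists>g. g \<in> vecs H \<and> c g = (\<lambda>i. if i < n then c f i else 0)" by blast
  then have "trunc n f \<in> vecs H \<and> c (trunc n f) = (\<lambda>i. if i < n then c f i else 0)"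
    unfolding trunc_def by (rule someI_ex)
  then show "trunc n f \<in> vecs H" "c (trunc n f) i = (if i < n then c f i else 0)" by auto
qed

lemma hnorm_trunc_le: "f \<in> vecs H \<Longrightarrow> hnorm H (trunc n f) \<le> hnorm H f"
proof -
  assume f: "f \<in> vecs H"
  have "Re (ip H (trunc n f) (trunc n f)) \<le> Re (ip H f f)"
    by (rule sums_le[OF _ norm_sums[OF trunc_vecs] norm_sums[OF f]]) (simp add: c_trunc w_nonneg)
  then show ?thesis by (simp add: hnorm_def)
qed

lemma trunc_tendsto: "f \<in> vecs H \<Longrightarrow> (\<lambda>n. hnorm H (trunc n f - f)) \<longlonglongrightarrow> 0"
proof -
  assume f: "f \<in> vecs H"
  let ?s = "\<lambda>i. weight K i * (cmod (c f i))\<^sup>2"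
  have tail: "Re (ip H (trunc n f - f) (trunc n f - f)) = Re (ip H f f) - (\<Sum>i<n. ?s i)" for n
  proof -
    have "(\<lambda>i. ?s i - (if i < n then ?s i else 0)) sums (Re (ip H f f) - (\<Sum>i<n. ?s i))"
    proof (intro sums_diff norm_sums f)
      show "(\<lambda>i. if i < n then ?s i else 0) sums (\<Sum>i<n. ?s i)"
        using sums_If_finite_set[of "{..<n}" ?s] by simp
    qed
    moreover have "(\<lambda>i. ?s i - (if i < n then ?s i else 0))
        = (\<lambda>i. weight K i * (cmod (c (trunc n f - f) i))\<^sup>2)"
      by (auto simp: c_diff[OF trunc_vecs f] c_trunc)
    ultimately have "(\<lambda>i. weight K i * (cmod (c (trunc n f - f) i))\<^sup>2) sums (Re (ip H f f) - (\<Sum>i<n. ?s i))"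
      by simp
    from sums_unique2[OF norm_sums[OF vecs_closed(3)[OF trunc_vecs f]] this] show ?thesis .
  qed
  have "(\<lambda>n. sqrt (Re (ip H f f) - (\<Sum>i<n. ?s i))) \<longlonglongrightarrow> sqrt (Re (ip H f f) - Re (ip H f f))"
    using norm_sums[OF f] by (intro tendsto_intros) (simp add: sums_def)
  then show ?thesis by (simp add: hnorm_def tail)
qed

section \<open>Invariant subspaces and products with polynomials\<close>

definition invariant :: "('x \<Rightarrow> complex) set \<Rightarrow> bool" where
  "invariant S \<longleftrightarrow> closed_subspace H S \<and> (\<forall>f\<in>S. M f \<in> S)"

lemma invariantD:
  assumes "invariant S"
  shows "closed_subspace H S" "f \<in> S \<Longrightarrow> f \<in> vecs H" "f \<in> S \<Longrightarrow> M f \<in> S" "0 \<in> S"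
    "f \<in> S \<Longrightarrow> g \<in> S \<Longrightarrow> f + g \<in> S" "f \<in> S \<Longrightarrow> g \<in> S \<Longrightarrow> f - g \<in> S" "f \<in> S \<Longrightarrow> cscale k f \<in> S"
proof -
  show cl: "closed_subspace H S" using assms by (simp add: invariant_def)
  show "f \<in> S \<Longrightarrow> f \<in> vecs H" using closed_subspaceD(1)[OF cl] by blast
  show "f \<in> S \<Longrightarrow> M f \<in> S" using assms by (simp add: invariant_def)
  note sp = closed_subspaceD(2)[OF cl]
  show "0 \<in> S" "f \<in> S \<Longrightarrow> g \<in> S \<Longrightarrow> f + g \<in> S" "f \<in> S \<Longrightarrow> g \<in> S \<Longrightarrow> f - g \<in> S"
    "f \<in> S \<Longrightarrow> cscale k f \<in> S"
    using cfun.subspace_0[OF sp] cfun.subspace_add[OF sp] cfun.subspace_diff[OF sp] cfun.subspace_scale[OF sp]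
    by blast+
qed

lemma invariant_vecs: "invariant (vecs H)"
  by (auto simp: invariant_def closed_subspace_vecs)

text \<open>Horner's scheme: \<open>P\<close> is a constant plus \<open>fps_X\<close> times a
  polynomial of smaller degree, and \<open>S\<close> is closed under the operations
  involved.\<close>

lemma poly_mult:
  assumes S: "invariant S" and P: "\<And>i. i \<ge> B \<Longrightarrow> fps_nth P i = 0" and f: "f \<in> S"
  obtains g where "g \<in> S" "E g = P * E f"
proof -
  have "\<exists>g\<in>S. E g = P * E f" using P
  proof (induction B arbitrary: P)
    case 0
    then have "P = 0" by (simp add: fps_eq_iff)
    moreover have "E 0 = 0" by (simp add: fps_eq_iff)
    ultimately show ?case using invariantD(4)[OF S] by auto
  next
    case (Suc B)
    have "\<And>i. i \<ge> B \<Longrightarrow> fps_nth (fps_shift 1 P) i = 0" using Suc.prems by simp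
    from Suc.IH[OF this] obtain g where g: "g \<in> S" "E g = fps_shift 1 P * E f" by auto
    have P: "P = fps_const (fps_nth P 0) + fps_X * fps_shift 1 P"
      by (auto simp: fps_eq_iff)
    have "E (cscale (fps_nth P 0) f + M g) = fps_const (fps_nth P 0) * E f + fps_X * (fps_shift 1 P * E f)"
      using f g invariantD[OF S] by (simp add: E_add E_scale E_M)
    also have "\<dots> = P * E f" by (subst (3) P) (simp add: algebra_simps)
    finally show ?case
      by (rule bexI[where x = "cscale (fps_nth P 0) f + M g"]) (intro invariantD(5)[OF S] invariantD(7)[OF S] invariantD(3)[OF S] f g)
  qed
  then show thesis using that by auto
qed

text \<open>The recursion of \<open>poly_mult\<close> again, with \<open>hnorm_M\<close> at each
  step; the resulting continuity lets truncations pass to the limit.\<close>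

lemma poly_mult_bound:
  assumes "\<And>i. i \<ge> B \<Longrightarrow> fps_nth P i = 0"
  obtains C where "C \<ge> 0" "\<And>f g. f \<in> vecs H \<Longrightarrow> g \<in> vecs H \<Longrightarrow> E g = P * E f \<Longrightarrow> hnorm H g \<le> C * hnorm H f"
proof -
  have "\<exists>C\<ge>0. \<forall>f\<in>vecs H. \<forall>g\<in>vecs H. E g = P * E f \<longrightarrow> hnorm H g \<le> C * hnorm H f" using assms
  proof (induction B arbitrary: P)
    case 0
    then have "P = 0" by (simp add: fps_eq_iff)
    moreover have "hnorm H g = 0" if "g \<in> vecs H" "E g = 0" for g
      using that c_inj[of g] by (simp add: fps_eq_iff hnorm_eq_0)
    ultimately show ?case by (intro exI[of _ 0]) auto
  next
    case (Suc B)
    have sh: "\<And>i. i \<ge> B \<Longrightarrow> fps_nth (fps_shift 1 P) i = 0" using Suc.prems by simp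
    from Suc.IH[OF this] obtain C where C: "C \<ge> 0"
      "\<And>f g. f \<in> vecs H \<Longrightarrow> g \<in> vecs H \<Longrightarrow> E g = fps_shift 1 P * E f \<Longrightarrow> hnorm H g \<le> C * hnorm H f"
      by auto
    have P: "P = fps_const (fps_nth P 0) + fps_X * fps_shift 1 P"
      by (auto simp: fps_eq_iff)
    have "hnorm H g \<le> (cmod (fps_nth P 0) + 2 * C) * hnorm H f"
      if fg: "f \<in> vecs H" "g \<in> vecs H" "E g = P * E f" for f g
    proof -
      obtain h where h: "h \<in> vecs H" "E h = fps_shift 1 P * E f"
        by (rule poly_mult[OF invariant_vecs sh fg(1)])
      have "E (cscale (fps_nth P 0) f + M h) = fps_const (fps_nth P 0) * E f + fps_X * (fps_shift 1 P * E f)"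
        using fg(1) h by (simp add: E_add E_scale E_M)
      also have "\<dots> = P * E f" by (subst (3) P) (simp add: algebra_simps)
      finally have "cscale (fps_nth P 0) f + M h = g"
        using fg h by (intro E_inject) auto
      then have "hnorm H g \<le> hnorm H (cscale (fps_nth P 0) f) + hnorm H (M h)"
        using hnorm_triangle[of "cscale (fps_nth P 0) f" "M h"] fg(1) h by auto
      also have "\<dots> \<le> cmod (fps_nth P 0) * hnorm H f + 2 * (C * hnorm H f)"
        using hnorm_scale[OF fg(1)] hnorm_M(2)[OF h(1)] C(2)[OF fg(1) h] by simp
      finally show ?thesis by (simp add: algebra_simps)
    qed
    then show ?case using C(1) by (intro exI[of _ "cmod (fps_nth P 0) + 2 * C"]) simp
  qed
  then show thesis using that by auto
qed

section \<open>Contractive multipliers from the Sarason function\<close>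

lemma sarason_nth_large: "n \<ge> B \<Longrightarrow> fps_nth (sarason K B F) n = 0"
  by (simp add: sarason_def sarason_coeff_def)

lemma sarason_enlarge:
  assumes "\<And>i. i \<ge> B \<Longrightarrow> fps_nth F i = 0" "B \<le> B'"
  shows "sarason K B' F = sarason K B F"
proof -
  have "sarason_coeff K B' F n = sarason_coeff K B F n" for n
    unfolding sarason_coeff_def using assms by (intro sum.mono_neutral_right) auto
  then show ?thesis by (simp add: sarason_def)
qed

lemma sarason_inequality_finite:
  assumes F: "\<And>i. i \<ge> B \<Longrightarrow> fps_nth F i = 0" and g: "g \<in> vecs H" "\<And>i. i \<ge> n \<Longrightarrow> c g i = 0"
    and v: "v \<in> vecs H" "E v = sarason K B F * E g" and k: "k \<in> vecs H" "E k = F * E g"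
  shows "Re (ip H k k) \<le> Re (ip H v g)"
proof -
  define m where "m = max B n"
  have F': "\<And>i. i \<ge> m \<Longrightarrow> fps_nth F i = 0" and g': "\<And>i. i \<ge> m \<Longrightarrow> fps_nth (E g) i = 0"
    using F g(2) by (simp_all add: m_def)
  have "fps_nth (F * E g) N = 0" if "N \<ge> 2 * m" for N
    unfolding fps_mult_nth
  proof (rule sum.neutral, rule ballI)
    fix i assume "i \<in> {0..N}"
    show "fps_nth F i * fps_nth (E g) (N - i) = 0"
    proof (cases "i \<ge> m")
      case True
      then show ?thesis by (simp add: F')
    next
      case False
      then have "N - i \<ge> m" using that by simp
      then show ?thesis using g' by simp
    qed
  qed
  then have k0: "c k N = 0" if "N \<notin> {..<2 * m}" for N using that k(2) by (simp flip: E_nth)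
  have "complex_of_real (weight K N) * c k N * cnj (c k N) = of_real (weight K N * (cmod (c k N))\<^sup>2)" for N
    using complex_norm_square[of "c k N"] by (simp add: mult.assoc)
  then have "Re (ip H k k) = (\<Sum>N<2*m. weight K N * (cmod (fps_nth (F * E g) N))\<^sup>2)"
    using ip_finite[OF k(1) k(1) finite_lessThan k0] by (simp flip: k(2) del: of_real_mult of_real_power)
  also have "\<dots> \<le> Re (\<Sum>j<m. of_real (weight K j) * fps_nth (sarason K m F * E g) j * cnj (fps_nth (E g) j))"
    by (rule sarason_inequality[OF F' g'])
  also have "\<dots> = Re (ip H v g)"
  proof -
    have g0: "c g i = 0" if "i \<notin> {..<m}" for i using g'[of i] that by simp
    have "sarason K m F = sarason K B F" by (rule sarason_enlarge) (simp_all add: F m_def)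
    then show ?thesis
      using ip_finite[OF v(1) g(1) finite_lessThan g0] by (simp only: v(2)[symmetric] E_nth)
  qed
  finally show ?thesis .
qed

text \<open>Multiplication by the polynomials \<open>F\<close> and \<open>sarason K B F\<close> is
  bounded, so both sides are continuous in \<open>g\<close> and truncations of \<open>g\<close>
  suffice.\<close>

lemma sarason_inequality_space:
  assumes F: "\<And>i. i \<ge> B \<Longrightarrow> fps_nth F i = 0" and g: "g \<in> vecs H"
    and v: "v \<in> vecs H" "E v = sarason K B F * E g" and k: "k \<in> vecs H" "E k = F * E g"
  shows "Re (ip H k k) \<le> Re (ip H v g)"
proof -
  have conv: "\<exists>X. (\<forall>n. X n \<in> vecs H \<and> E (X n) = P * E (trunc n g)) \<and> (\<lambda>n. hnorm H (X n - x)) \<longlonglongrightarrow> 0"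
    if P: "\<And>i. i \<ge> B \<Longrightarrow> fps_nth P i = 0" and x: "x \<in> vecs H" "E x = P * E g" for P x
  proof -
    have "\<exists>X. \<forall>n. X n \<in> vecs H \<and> E (X n) = P * E (trunc n g)"
    proof (rule choice, rule allI)
      fix n
      obtain y where "y \<in> vecs H" "E y = P * E (trunc n g)"
        by (rule poly_mult[OF invariant_vecs P trunc_vecs])
      then show "\<exists>y. y \<in> vecs H \<and> E y = P * E (trunc n g)" by blast
    qed
    then obtain X where X: "\<And>n. X n \<in> vecs H" "\<And>n. E (X n) = P * E (trunc n g)" by auto
    obtain C where C: "C \<ge> 0"
      "\<And>f g. f \<in> vecs H \<Longrightarrow> g \<in> vecs H \<Longrightarrow> E g = P * E f \<Longrightarrow> hnorm H g \<le> C * hnorm H f"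
      using poly_mult_bound[OF P] by metis
    have "(\<lambda>n. hnorm H (X n - x)) \<longlonglongrightarrow> 0"
    proof (rule tendsto_sandwich[OF _ _ tendsto_const])
      show "\<forall>\<^sub>F n in sequentially. 0 \<le> hnorm H (X n - x)"
        using hnorm_nonneg[OF vecs_closed(3)[OF X(1) x(1)]] by (intro always_eventually allI)
      have "hnorm H (X n - x) \<le> C * hnorm H (trunc n g - g)" for n
        using X x g by (intro C(2)) (auto simp: E_diff algebra_simps)
      then show "\<forall>\<^sub>F n in sequentially. hnorm H (X n - x) \<le> C * hnorm H (trunc n g - g)"
        by (intro always_eventually allI)
      show "(\<lambda>n. C * hnorm H (trunc n g - g)) \<longlonglongrightarrow> 0"
        by (intro tendsto_mult_right_zero trunc_tendsto g)
    qed
    with X show ?thesis by blast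
  qed
  obtain X where X: "\<And>n. X n \<in> vecs H" "\<And>n. E (X n) = F * E (trunc n g)"
    and Xl: "(\<lambda>n. hnorm H (X n - k)) \<longlonglongrightarrow> 0"
    using conv[OF F k] by auto
  obtain Y where Y: "\<And>n. Y n \<in> vecs H" "\<And>n. E (Y n) = sarason K B F * E (trunc n g)"
    and Yl: "(\<lambda>n. hnorm H (Y n - v)) \<longlonglongrightarrow> 0"
    using conv[OF sarason_nth_large v] by auto
  show ?thesis
  proof (rule LIMSEQ_le)
    show "(\<lambda>n. Re (ip H (X n) (X n))) \<longlonglongrightarrow> Re (ip H k k)"
      by (intro tendsto_Re ip_tendsto X k Xl)
    show "(\<lambda>n. Re (ip H (Y n) (trunc n g))) \<longlonglongrightarrow> Re (ip H v g)"
      by (intro tendsto_Re ip_tendsto Y v Yl trunc_vecs trunc_tendsto g)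
    have "Re (ip H (X n) (X n)) \<le> Re (ip H (Y n) (trunc n g))" for n
      by (rule sarason_inequality_finite[OF F trunc_vecs _ Y X, of n]) (simp_all add: c_trunc)
    then show "\<exists>N. \<forall>n\<ge>N. Re (ip H (X n) (X n)) \<le> Re (ip H (Y n) (trunc n g))" by blast
  qed
qed

text \<open>For \<open>h = (1 + V) g\<close> the inequality reads
  \<open>\<parallel>g\<parallel>\<^sup>2 + \<parallel>F g\<parallel>\<^sup>2 \<le> Re \<langle>h,
  g\<rangle>\<close>, and Cauchy-Schwarz does the rest: \<open>1 / (1 + V)\<close> and
  \<open>F / (1 + V)\<close> act contractively on the range of \<open>1 + V\<close>.\<close>

lemma sarason_resolvent_bound:
  assumes F: "\<And>i. i \<ge> B \<Longrightarrow> fps_nth F i = 0" and g: "g \<in> vecs H" and h: "h \<in> vecs H"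
    and gh: "E h = (1 + sarason K B F) * E g" and k: "k \<in> vecs H" "E k = F * E g"
  shows "hnorm H g \<le> hnorm H h" "hnorm H k \<le> hnorm H h" "(hnorm H g)\<^sup>2 \<le> Re (ip H h g)"
proof -
  have v: "h - g \<in> vecs H" "E (h - g) = sarason K B F * E g"
    using g h by (auto simp: E_diff gh algebra_simps)
  have "(hnorm H k)\<^sup>2 \<le> Re (ip H h g) - (hnorm H g)\<^sup>2"
    using sarason_inequality_space[OF F g v k] g h k by (simp add: hnorm_sq ip_diff)
  moreover have cs: "Re (ip H h g) \<le> hnorm H h * hnorm H g"
    using Cauchy_Schwarz[OF h g] complex_Re_le_cmod order_trans by blast
  ultimately have *: "(hnorm H g)\<^sup>2 + (hnorm H k)\<^sup>2 \<le> hnorm H h * hnorm H g" by linarith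
  show "(hnorm H g)\<^sup>2 \<le> Re (ip H h g)"
    using \<open>(hnorm H k)\<^sup>2 \<le> Re (ip H h g) - (hnorm H g)\<^sup>2\<close> zero_le_power2[of "hnorm H k"] by linarith
  show 1: "hnorm H g \<le> hnorm H h"
  proof (cases "hnorm H g = 0")
    case False
    then have "hnorm H g > 0" using hnorm_nonneg[OF g] by linarith
    moreover have "hnorm H g * hnorm H g \<le> hnorm H h * hnorm H g"
      unfolding power2_eq_square[symmetric] using * zero_le_power2[of "hnorm H k"] by linarith
    ultimately show ?thesis by simp
  qed (use h in simp)
  have "(hnorm H k)\<^sup>2 \<le> hnorm H h * hnorm H g" using * zero_le_power2[of "hnorm H g"] by linarith
  also have "\<dots> \<le> (hnorm H h)\<^sup>2"
    using mult_left_mono[OF 1 hnorm_nonneg[OF h]] by (simp add: power2_eq_square)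
  finally show "hnorm H k \<le> hnorm H h" by (rule power2_le_imp_le) (simp add: h)
qed

lemma sarason_nth_0: "0 \<le> Re (fps_nth (sarason K B F) 0)" "Im (fps_nth (sarason K B F) 0) = 0"
proof -
  have "complex_of_real (weight K a) * fps_nth F a * cnj (fps_nth F a)
      = of_real (weight K a * (cmod (fps_nth F a))\<^sup>2)" for a
    using complex_norm_square[of "fps_nth F a"] by (simp add: mult.assoc)
  then have s: "sarason_coeff K B F 0 = of_real (\<Sum>a<B. weight K a * (cmod (fps_nth F a))\<^sup>2)"
    unfolding sarason_coeff_def of_real_sum by (intro sum.cong refl) (simp only: le0 if_True diff_zero)
  have "fps_nth (sarason K B F) 0 = of_real ((\<Sum>a<B. weight K a * (cmod (fps_nth F a))\<^sup>2) / weight K 0)"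
    unfolding sarason_def fps_nth_Abs_fps s by (simp del: of_real_sum)
  moreover have "(\<Sum>a<B. weight K a * (cmod (fps_nth F a))\<^sup>2) / weight K 0 \<ge> 0"
    by (intro divide_nonneg_nonneg sum_nonneg mult_nonneg_nonneg w_nonneg) auto
  ultimately show "0 \<le> Re (fps_nth (sarason K B F) 0)" "Im (fps_nth (sarason K B F) 0) = 0"
    by (simp_all del: of_real_divide of_real_sum)
qed

lemma one_plus_sarason_nth_0: "1 \<le> cmod (fps_nth (1 + sarason K B F) 0)"
  using sarason_nth_0[of B F] complex_Re_le_cmod[of "fps_nth (1 + sarason K B F) 0"] by simp

text \<open>A Lax-Milgram argument inside \<open>S\<close>. By coercivity no nonzero
  \<open>y\<close> in \<open>S\<close> is orthogonal to \<open>(1 + V) y\<close>, so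
  \<open>1 + V\<close> has dense range in \<open>S\<close>; preimages of an approximating sequence
  stay bounded and have a weak limit in \<open>S\<close>.\<close>

lemma sarason_resolvent:
  assumes S: "invariant S" and F: "\<And>i. i \<ge> B \<Longrightarrow> fps_nth F i = 0" and h: "h \<in> S"
  obtains g k where "g \<in> S" "E g = inverse (1 + sarason K B F) * E h" "hnorm H g \<le> hnorm H h"
    "k \<in> S" "E k = F * inverse (1 + sarason K B F) * E h" "hnorm H k \<le> hnorm H h"
proof -
  let ?V = "1 + sarason K B F"
  have V0: "fps_nth ?V 0 \<noteq> 0" using one_plus_sarason_nth_0[of B F] by auto
  have V: "\<And>i. i \<ge> Suc B \<Longrightarrow> fps_nth ?V i = 0" by (simp add: sarason_nth_large)
  note cl = invariantD(1)[OF S] and Sv = invariantD(2)[OF S]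
  define R where "R = {b \<in> S. \<exists>g\<in>S. E b = ?V * E g}"
  have Rv: "R \<subseteq> vecs H" using Sv by (auto simp: R_def)
  have Rsub: "cfun.subspace R"
    unfolding cfun.subspace_def
  proof (intro conjI ballI allI)
    have "E 0 = 0" by (simp add: fps_eq_iff)
    then have "E 0 = ?V * E 0" by simp
    then show "0 \<in> R" using invariantD(4)[OF S] by (auto simp: R_def)
  next
    fix b b' assume "b \<in> R" "b' \<in> R"
    then obtain g g' where "b \<in> S" "g \<in> S" "E b = ?V * E g" "b' \<in> S" "g' \<in> S" "E b' = ?V * E g'"
      by (auto simp: R_def)
    then have "b + b' \<in> S" "g + g' \<in> S" "E (b + b') = ?V * E (g + g')"
      using Sv invariantD(5)[OF S] by (auto simp: E_add algebra_simps)
    then show "b + b' \<in> R" unfolding R_def by blast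
  next
    fix k b assume "b \<in> R"
    then obtain g where "b \<in> S" "g \<in> S" "E b = ?V * E g" by (auto simp: R_def)
    then have "cscale k b \<in> S" "cscale k g \<in> S" "E (cscale k b) = ?V * E (cscale k g)"
      using Sv invariantD(7)[OF S] by (auto simp: E_scale algebra_simps)
    then show "cscale k b \<in> R" unfolding R_def by blast
  qed
  note clR = closed_subspace_hclosure[OF Rsub Rv]
  obtain m where m: "m \<in> hclosure H R" "h - m \<in> orth_compl H (hclosure H R)"
    by (rule projection[OF clR Sv[OF h]])
  have mS: "m \<in> S"
  proof -
    have "hclosure H R \<subseteq> hclosure H S" by (auto simp: hclosure_def R_def)
    then show ?thesis using m(1) cl by (auto simp: closed_subspace_def)
  qed
  define y where "y = h - m"
  have y: "y \<in> S" using h mS invariantD(6)[OF S] by (simp add: y_def)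
  obtain b where b: "b \<in> S" "E b = ?V * E y" by (rule poly_mult[OF S V y])
  obtain k where k: "k \<in> S" "E k = F * E y" by (rule poly_mult[OF S F y])
  have "b \<in> hclosure H R" using b y hclosure_superset[OF Rv] by (auto simp: R_def)
  then have "ip H y b = 0" using m(2) by (simp add: orth_compl_def y_def)
  then have "ip H b y = 0" using ip_eq_0_sym Sv y b by blast
  then have "(hnorm H y)\<^sup>2 \<le> 0"
    using sarason_resolvent_bound(3)[OF F Sv[OF y] Sv[OF b(1)] b(2) Sv[OF k(1)] k(2)] by simp
  then have "y = 0" using hnorm_eq_0[OF Sv[OF y]] by simp
  then have "h \<in> hclosure H R" using m(1) by (simp add: y_def)
  then have "\<exists>X. range X \<subseteq> R \<and> (\<lambda>n::nat. hnorm H (X n - h)) \<longlonglongrightarrow> 0"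
    by (simp add: mem_hclosure_iff[OF Rv])
  then obtain X where X: "\<And>n::nat. X n \<in> R" and Xl: "(\<lambda>n. hnorm H (X n - h)) \<longlonglongrightarrow> 0" by auto
  have "\<exists>G. \<forall>n. G n \<in> S \<and> E (X n) = ?V * E (G n)"
    using X unfolding R_def by (intro choice) auto
  then obtain G where G: "\<And>n. G n \<in> S" "\<And>n. E (X n) = ?V * E (G n)" by auto
  have inv: "E (G n) = inverse ?V * E (X n)" for n
    using G(2)[of n] inverse_mult_eq_1[OF V0] by (simp flip: mult.assoc)
  have "Bseq (\<lambda>n. hnorm H (X n - h))" by (rule convergent_imp_Bseq) (use Xl convergent_def in blast)
  then obtain C where C: "\<And>n. hnorm H (X n - h) \<le> C"
    unfolding Bseq_def real_norm_def by (metis abs_le_D1)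
  have Xv: "X n \<in> vecs H" for n using X Rv by blast
  have "hnorm H (G n) \<le> C + hnorm H h" for n
  proof -
    obtain k where k: "k \<in> S" "E k = F * E (G n)" by (rule poly_mult[OF S F G(1)])
    have "hnorm H (G n) \<le> hnorm H (X n)"
      by (rule sarason_resolvent_bound(1)[OF F Sv[OF G(1)] Xv G(2) Sv[OF k(1)] k(2)])
    also have "\<dots> \<le> hnorm H (X n - h) + hnorm H h"
      using hnorm_triangle[of "X n - h" h] Xv Sv[OF h] by simp
    finally show ?thesis using C[of n] by linarith
  qed
  \<comment> \<open>A coefficient of \<open>inverse ?V * E (X n)\<close> involves finitely many
    coefficients of \<open>X n\<close>, so coefficientwise convergence of \<open>X\<close>
    suffices.\<close>
  moreover have "(\<lambda>n. c (G n) i) \<longlonglongrightarrow> fps_nth (inverse ?V * E h) i" for i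
  proof -
    have "(\<lambda>n. c (X n) i - c h i) \<longlonglongrightarrow> 0" for i
    proof (rule Lim_null_comparison[OF _ Xl])
      show "\<forall>\<^sub>F n in sequentially. norm (c (X n) i - c h i) \<le> hnorm H (X n - h)"
        using norm_coeff_le_hnorm[of "X _ - h" i] Xv Sv[OF h]
        by (intro always_eventually allI) (simp add: c_diff)
    qed
    then have lim: "(\<lambda>n. fps_nth (E (X n)) i) \<longlonglongrightarrow> fps_nth (E h) i" for i
      by (simp add: LIM_zero_iff)
    have "(\<lambda>n. \<Sum>j=0..i. fps_nth (inverse ?V) j * fps_nth (E (X n)) (i - j))
        \<longlonglongrightarrow> (\<Sum>j=0..i. fps_nth (inverse ?V) j * fps_nth (E h) (i - j))"
      by (rule tendsto_sum) (rule tendsto_mult_left[OF lim])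
    moreover have "c (G n) i = (\<Sum>j=0..i. fps_nth (inverse ?V) j * fps_nth (E (X n)) (i - j))" for n
      using arg_cong[OF inv[of n], of "\<lambda>F. fps_nth F i"] by (simp only: fps_mult_nth E_nth)
    ultimately show ?thesis by (simp only: fps_mult_nth)
  qed
  ultimately obtain g where g: "g \<in> S" "c g = fps_nth (inverse ?V * E h)"
    by (rule closed_subspace_bounded_limit[OF cl G(1)])
  have Eg: "E g = inverse ?V * E h" using g(2) by (simp add: E_def fps_nth_inverse)
  have gh: "E h = ?V * E g"
    using inverse_mult_eq_1'[OF V0] by (simp add: Eg flip: mult.assoc)
  obtain k where k: "k \<in> S" "E k = F * E g" by (rule poly_mult[OF S F g(1)])
  note bd = sarason_resolvent_bound[OF F Sv[OF g(1)] Sv[OF h] gh Sv[OF k(1)] k(2)]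
  have Ek: "E k = F * inverse ?V * E h" unfolding k(2) Eg by (rule mult.assoc[symmetric])
  show thesis
    by (rule that[OF g(1) Eg bd(1) k(1) Ek bd(2)])
qed

end

section \<open>Division and cyclic vectors\<close>

definition fps_tends :: "(nat \<Rightarrow> complex fps) \<Rightarrow> complex fps \<Rightarrow> bool" where
  "fps_tends X L \<longleftrightarrow> (\<forall>i. (\<lambda>n. fps_nth (X n) i) \<longlonglongrightarrow> fps_nth L i)"

lemma fps_tends_const: "fps_tends (\<lambda>_. L) L"
  by (simp add: fps_tends_def)

lemma fps_tends_add: "fps_tends X L \<Longrightarrow> fps_tends Y L' \<Longrightarrow> fps_tends (\<lambda>n. X n + Y n) (L + L')"
  by (simp add: fps_tends_def tendsto_add)

lemma fps_tends_mult: "fps_tends X L \<Longrightarrow> fps_tends Y L' \<Longrightarrow> fps_tends (\<lambda>n. X n * Y n) (L * L')"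
  unfolding fps_tends_def fps_mult_nth by (intro allI tendsto_sum tendsto_mult) auto

lemma fps_tends_shift: "fps_tends X L \<Longrightarrow> fps_tends (\<lambda>n. fps_shift 1 (X n)) (fps_shift 1 L)"
  by (simp add: fps_tends_def)

text \<open>The coefficients of an inverse obey a recursion that divides by the constant term alone,
  so strong induction on the index applies.\<close>

lemma fps_tends_inverse:
  assumes X: "fps_tends X L" and "\<And>n. fps_nth (X n) 0 \<noteq> 0" and "fps_nth L 0 \<noteq> 0"
  shows "fps_tends (\<lambda>n. inverse (X n)) (inverse L)"
proof -
  have rec: "fps_nth (inverse W) i = ((if i = 0 then 1 else 0)
      - (\<Sum>j=1..i. fps_nth W j * fps_nth (inverse W) (i - j))) / fps_nth W 0"
    if "fps_nth W 0 \<noteq> 0" for W :: "complex fps" and i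
  proof -
    have "(if i = 0 then 1 else 0) = fps_nth (W * inverse W) i"
      using inverse_mult_eq_1'[OF that] by simp
    also have "\<dots> = fps_nth W 0 * fps_nth (inverse W) i
        + (\<Sum>j=1..i. fps_nth W j * fps_nth (inverse W) (i - j))"
      unfolding fps_mult_nth by (subst sum.atLeast_Suc_atMost) auto
    finally show ?thesis using that by (simp add: field_simps)
  qed
  have "(\<lambda>n. fps_nth (inverse (X n)) i) \<longlonglongrightarrow> fps_nth (inverse L) i" for i
  proof (induction i rule: less_induct)
    case (less i)
    have "(\<lambda>n. \<Sum>j=1..i. fps_nth (X n) j * fps_nth (inverse (X n)) (i - j))
        \<longlonglongrightarrow> (\<Sum>j=1..i. fps_nth L j * fps_nth (inverse L) (i - j))"
      using X less.IH by (intro tendsto_sum tendsto_mult) (auto simp: fps_tends_def)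
    then show ?case
      unfolding rec[OF assms(2), where i = i] rec[OF assms(3), where i = i]
      using X assms(3) by (intro tendsto_divide tendsto_diff tendsto_const) (auto simp: fps_tends_def)
  qed
  then show ?thesis by (simp add: fps_tends_def)
qed

text \<open>Otherwise the decrements, whose series telescopes, would dominate a tail of the harmonic
  series.\<close>

lemma frequently_slow_decrease:
  fixes b :: "nat \<Rightarrow> real"
  assumes "\<And>n. b n \<ge> 0" "\<And>n. b (Suc n) \<le> b n"
  shows "\<exists>n\<ge>N. real (Suc n) * (b n - b (Suc n)) \<le> 1"
proof (rule ccontr)
  assume "\<not> ?thesis"
  then have *: "\<And>n. n \<ge> N \<Longrightarrow> real (Suc n) * (b n - b (Suc n)) > 1" by (meson not_le)
  have "decseq b" using assms(2) by (simp add: decseq_Suc_iff)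
  then obtain l where "b \<longlonglongrightarrow> l" using decseq_convergent[of b 0] assms(1) by metis
  then have "summable (\<lambda>n. b n - b (Suc n))" by (rule telescope_summable')
  then have "summable (\<lambda>n. inverse (real (Suc n)))"
  proof (rule summable_comparison_test'[where N = N])
    fix n assume "n \<ge> N"
    then have "1 / real (Suc n) \<le> b n - b (Suc n)" using *[of n] by (simp add: field_simps)
    then show "norm (inverse (real (Suc n))) \<le> b n - b (Suc n)" by (simp add: inverse_eq_divide)
  qed
  then have "summable (\<lambda>n. inverse (real n))" by (subst (asm) summable_Suc_iff)
  then show False using not_summable_harmonic[where 'a = real] by simp
qed

section \<open>Division by the variable and singly generated subspaces\<close>

context shift_space
begin

lemma fps_limit:
  assumes "invariant S" "\<And>n. X n \<in> S" "\<And>n. hnorm H (X n) \<le> B" "fps_tends (\<lambda>n. E (X n)) L"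
  obtains f where "f \<in> S" "E f = L" "hnorm H f \<le> B"
proof -
  obtain f where "f \<in> S" "c f = fps_nth L" "hnorm H f \<le> B"
    by (rule closed_subspace_bounded_limit[where X = X, OF invariantD(1)[OF assms(1)] assms(2,3), of "fps_nth L"])
      (use assms(4) in \<open>auto simp: fps_tends_def\<close>)
  then show thesis using that[of f] by (simp add: E_def fps_nth_inverse)
qed

text \<open>The weights increase, so stripping a zero at the origin preserves square summability.
  This happens in the ambient space; keeping a quotient inside \<open>S\<close> is the task of
  \<open>division\<close>.\<close>

lemma unshift_exists:
  assumes f: "f \<in> vecs H" "E f = fps_X ^ m * F"
  obtains h where "h \<in> vecs H" "E h = F"
proof -
  have cf: "c f (i + m) = fps_nth F i" for i
    using arg_cong[OF f(2), of "\<lambda>P. fps_nth P (i + m)"] by (simp add: fps_X_power_mult_nth)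
  have "summable (\<lambda>i. weight K (i + m) * (cmod (c f (i + m)))\<^sup>2)"
    using sums_summable[OF norm_sums[OF f(1)]] by (subst summable_iff_shift)
  then have "summable (\<lambda>i. weight K i * (cmod (fps_nth F i))\<^sup>2)"
  proof (rule summable_comparison_test')
    fix i
    have "weight K i \<le> weight K (i + m)" by (cases K) auto
    then show "norm (weight K i * (cmod (fps_nth F i))\<^sup>2) \<le> weight K (i + m) * (cmod (c f (i + m)))\<^sup>2"
      by (simp add: cf mult_right_mono w_nonneg)
  qed
  then have "(\<lambda>i. weight K i * (cmod (fps_nth F i))\<^sup>2) summable_on UNIV"
    by (subst summable_on_UNIV_nonneg_real_iff) (simp_all add: w_nonneg)
  from c_surj[OF this] obtain h where "h \<in> vecs H" "c h = fps_nth F" by auto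
  then show thesis using that[of h] by (simp add: E_def fps_nth_inverse)
qed

text \<open>
  With \<open>u = 1 / (1 + V)\<close>, both \<open>u\<close> and \<open>\<phi> = u F\<close> multiply contractively, and \<open>X^m \<phi> = u f\<close> lies
  in \<open>S\<close>.  Hence \<open>X^m \<phi> G\<close> and \<open>((\<phi> - \<phi>(0)) / X) g\<close> lie in \<open>S\<close>, and their difference is
  \<open>\<phi>(0) X^m G\<close>.
\<close>

lemma division:
  assumes S: "invariant S" and f: "f \<in> S" "E f = fps_X ^ m * F" and F0: "fps_nth F 0 \<noteq> 0"
    and g: "g \<in> S" "E g = fps_X ^ Suc m * G"
  obtains y where "y \<in> S" "E y = fps_X ^ m * G"
proof -
  note Sv = invariantD(2)[OF S]
  obtain fh where fh: "fh \<in> vecs H" "E fh = F" by (rule unshift_exists[OF Sv[OF f(1)] f(2)])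
  obtain gh where gh: "gh \<in> vecs H" "E gh = G" by (rule unshift_exists[OF Sv[OF g(1)] g(2)])
  \<comment> \<open>\<open>F\<close> is in general no polynomial, so the multipliers are built for
    its truncations \<open>P n\<close>, and coefficientwise limits are taken under uniform norm
    bounds.\<close>
  define P where "P n = E (trunc n fh)" for n
  define V where "V n = 1 + sarason K n (P n)" for n
  define U where "U n = inverse (V n)" for n
  \<comment> \<open>The coefficientwise limit of \<open>V n\<close>: the values of
    \<open>sarason_coeff K n (P n)\<close> are partial sums of the inner products of
    \<open>fh\<close> with \<open>(M ^^ j) fh\<close>.\<close>
  define L where "L = 1 + Abs_fps (\<lambda>j. (if j = 0 then 1 else 2) * ip H fh ((M ^^ j) fh) / of_real (weight K j))"
  define u where "u = inverse L"
  have P0: "fps_nth (P n) i = 0" if "i \<ge> n" for n i using that by (simp add: P_def c_trunc)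
  have tP: "fps_tends P F"
    unfolding fps_tends_def
  proof
    fix i
    have "\<forall>\<^sub>F n in sequentially. fps_nth F i = fps_nth (P n) i"
      using eventually_gt_at_top[of i] by eventually_elim (simp add: P_def c_trunc flip: fh(2))
    then show "(\<lambda>n. fps_nth (P n) i) \<longlonglongrightarrow> fps_nth F i" by (rule tendsto_eventually[OF eventually_mono]) simp
  qed
  have "fps_tends (\<lambda>n. sarason K n (P n))
      (Abs_fps (\<lambda>j. (if j = 0 then 1 else 2) * ip H fh ((M ^^ j) fh) / of_real (weight K j)))"
    unfolding fps_tends_def
  proof
    fix j
    have "sarason_coeff K n (P n) j = (\<Sum>a<n. complex_of_real (weight K a) * c fh a * cnj (c ((M ^^ j) fh) a))" for n
      unfolding sarason_coeff_def P_def
      by (intro sum.cong refl) (auto simp: c_trunc c_M_pow fh(1))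
    moreover have "(\<lambda>n. \<Sum>a<n. complex_of_real (weight K a) * c fh a * cnj (c ((M ^^ j) fh) a))
        \<longlonglongrightarrow> ip H fh ((M ^^ j) fh)"
      using has_sum_imp_sums[OF ip_has_sum[OF fh(1) M_pow_vecs[OF fh(1)]]] by (simp add: sums_def)
    ultimately have lim: "(\<lambda>n. sarason_coeff K n (P n) j) \<longlonglongrightarrow> ip H fh ((M ^^ j) fh)" by simp
    have "complex_of_real (weight K j) \<noteq> 0" using weight_pos[of K j] by (simp del: weight_pos)
    then show "(\<lambda>n. fps_nth (sarason K n (P n)) j) \<longlonglongrightarrow> fps_nth
        (Abs_fps (\<lambda>j. (if j = 0 then 1 else 2) * ip H fh ((M ^^ j) fh) / of_real (weight K j))) j"
      unfolding sarason_def fps_nth_Abs_fps by (intro tendsto_divide tendsto_mult tendsto_const lim)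
  qed
  then have tV: "fps_tends V L" unfolding V_def L_def by (intro fps_tends_add fps_tends_const)
  have V0: "1 \<le> cmod (fps_nth (V n) 0)" for n unfolding V_def by (rule one_plus_sarason_nth_0)
  then have V0': "fps_nth (V n) 0 \<noteq> 0" for n by (metis norm_zero not_one_le_zero)
  have "Re (fps_nth L 0) \<ge> 1" using ip_nonneg[OF fh(1)] w_nonneg[of 0] by (simp add: L_def)
  then have L0: "fps_nth L 0 \<noteq> 0" by auto
  have tU: "fps_tends U u" unfolding U_def u_def by (rule fps_tends_inverse[OF tV V0' L0])
  have res: "\<exists>y k. y \<in> T \<and> E y = U n * E h \<and> hnorm H y \<le> hnorm H h
      \<and> k \<in> T \<and> E k = P n * U n * E h \<and> hnorm H k \<le> hnorm H h"
    if T: "invariant T" and h: "h \<in> T" for T h n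
  proof -
    obtain y k where "y \<in> T" "E y = inverse (1 + sarason K n (P n)) * E h" "hnorm H y \<le> hnorm H h"
      "k \<in> T" "E k = P n * inverse (1 + sarason K n (P n)) * E h" "hnorm H k \<le> hnorm H h"
      by (rule sarason_resolvent[OF T P0 h])
    then show ?thesis unfolding U_def V_def by blast
  qed

  have "\<forall>n. \<exists>y. y \<in> S \<and> E y = U n * E f \<and> hnorm H y \<le> hnorm H f" using res[OF S f(1)] by meson
  then obtain Y where Y: "\<And>n. Y n \<in> S" "\<And>n. E (Y n) = U n * E f" "\<And>n. hnorm H (Y n) \<le> hnorm H f"
    using choice[of "\<lambda>n y. y \<in> S \<and> E y = U n * E f \<and> hnorm H y \<le> hnorm H f"] by auto
  have "fps_tends (\<lambda>n. E (Y n)) (u * E f)" unfolding Y(2) by (intro fps_tends_mult tU fps_tends_const)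
  then obtain uf where uf: "uf \<in> S" "E uf = u * E f" by (rule fps_limit[OF S Y(1,3)])

  \<comment> \<open>Stated on all of \<open>vecs H\<close>, because it is applied below to shifted
    truncations of \<open>gh\<close>, which need not lie in \<open>S\<close>.\<close>
  have contr: "\<exists>k. k \<in> vecs H \<and> E k = F * u * E h \<and> hnorm H k \<le> hnorm H h" if h: "h \<in> vecs H" for h
  proof -
    have "\<forall>n. \<exists>k. k \<in> vecs H \<and> E k = P n * U n * E h \<and> hnorm H k \<le> hnorm H h"
      using res[OF invariant_vecs h] by meson
    then obtain Z where Z: "\<And>n. Z n \<in> vecs H" "\<And>n. E (Z n) = P n * U n * E h" "\<And>n. hnorm H (Z n) \<le> hnorm H h"
      using choice[of "\<lambda>n k. k \<in> vecs H \<and> E k = P n * U n * E h \<and> hnorm H k \<le> hnorm H h"] by auto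
    have "fps_tends (\<lambda>n. E (Z n)) (F * u * E h)"
      unfolding Z(2) by (intro fps_tends_mult tP tU fps_tends_const)
    then obtain k where "k \<in> vecs H" "E k = F * u * E h" "hnorm H k \<le> hnorm H h"
      by (rule fps_limit[OF invariant_vecs Z(1,3)])
    then show ?thesis by blast
  qed

  \<comment> \<open>A truncation of \<open>G\<close> is a polynomial, so its product with
    \<open>u f\<close> lies in \<open>S\<close>. The same vector is \<open>F u\<close> times a
    shifted truncation, and contractivity bounds it independently of \<open>n\<close>.\<close>
  have "\<exists>y. y \<in> S \<and> E y = E (trunc n gh) * (u * E f) \<and> hnorm H y \<le> 2 ^ m * hnorm H gh" for n
  proof -
    have tr: "fps_nth (E (trunc n gh)) i = 0" if "i \<ge> n" for i using that by (simp add: c_trunc)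
    obtain y where y: "y \<in> S" "E y = E (trunc n gh) * E uf" by (rule poly_mult[OF S tr uf(1)])
    obtain k where k: "k \<in> vecs H" "E k = F * u * E ((M ^^ m) (trunc n gh))"
      "hnorm H k \<le> hnorm H ((M ^^ m) (trunc n gh))"
      using contr[OF M_pow_vecs[OF trunc_vecs]] by blast
    have "E k = E y" by (simp add: k(2) y(2) uf(2) f(2) E_M_pow algebra_simps)
    then have "k = y" using k(1) Sv[OF y(1)] by (rule E_inject[rotated 2])
    then have "hnorm H y \<le> 2 ^ m * hnorm H (trunc n gh)"
      using k(3) hnorm_M_pow_le[OF trunc_vecs[of n gh], of m] by simp
    also have "\<dots> \<le> 2 ^ m * hnorm H gh" by (intro mult_left_mono hnorm_trunc_le gh) simp
    finally show ?thesis using y uf(2) by auto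
  qed
  then have "\<forall>n. \<exists>y. y \<in> S \<and> E y = E (trunc n gh) * (u * E f) \<and> hnorm H y \<le> 2 ^ m * hnorm H gh" ..
  then obtain Y1 where Y1: "\<And>n. Y1 n \<in> S" "\<And>n. E (Y1 n) = E (trunc n gh) * (u * E f)"
    "\<And>n. hnorm H (Y1 n) \<le> 2 ^ m * hnorm H gh"
    using choice[of "\<lambda>n y. y \<in> S \<and> E y = E (trunc n gh) * (u * E f) \<and> hnorm H y \<le> 2 ^ m * hnorm H gh"] by auto
  have "fps_tends (\<lambda>n. E (trunc n gh)) G"
    unfolding fps_tends_def
  proof
    fix i
    have "\<forall>\<^sub>F n in sequentially. fps_nth (E (trunc n gh)) i = fps_nth G i"
      using eventually_gt_at_top[of i] by eventually_elim (simp add: c_trunc flip: gh(2))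
    then show "(\<lambda>n. fps_nth (E (trunc n gh)) i) \<longlonglongrightarrow> fps_nth G i" by (rule tendsto_eventually)
  qed
  then have "fps_tends (\<lambda>n. E (Y1 n)) (G * (u * E f))"
    unfolding Y1(2) by (intro fps_tends_mult fps_tends_const)
  then obtain y1 where y1: "y1 \<in> S" "E y1 = G * (u * E f)" by (rule fps_limit[OF S Y1(1,3)])

  have "\<exists>z. z \<in> S \<and> E z = fps_shift 1 (P n * U n) * E g
      \<and> hnorm H z \<le> (1 + cmod (fps_nth F 0)) * hnorm H g" for n
  proof -
    \<comment> \<open>\<open>q\<close> cancels the constant term of \<open>P n - q V n\<close>, so
      \<open>D\<close> is a polynomial; since \<open>U n\<close> inverts \<open>V n\<close>, the
      product \<open>U n * D\<close> is the difference quotient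
      \<open>(P n * U n - q) / X\<close>.\<close>
    define q where "q = fps_nth (P n * U n) 0"
    define D where "D = fps_shift 1 (P n - fps_const q * V n)"
    have VU: "V n * U n = 1" unfolding U_def by (rule inverse_mult_eq_1'[OF V0'])
    have "fps_nth (V n) 0 * fps_nth (U n) 0 = 1" using arg_cong[OF VU, of "\<lambda>P. fps_nth P 0"] by simp
    then have "fps_nth (P n - fps_const q * V n) 0 = 0" by (simp add: q_def mult.assoc mult.commute)
    then have XD: "fps_X * D = P n - fps_const q * V n"
      by (auto simp: fps_eq_iff D_def)
    have XS: "fps_X * fps_shift 1 (P n * U n) = P n * U n - fps_const q"
      by (auto simp: fps_eq_iff q_def)
    have "fps_X * (U n * D) = U n * (P n - fps_const q * V n)"
      unfolding XD[symmetric] by (simp add: algebra_simps)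
    also have "\<dots> = P n * U n - fps_const q * (V n * U n)" by (simp add: algebra_simps)
    also have "\<dots> = fps_X * fps_shift 1 (P n * U n)" unfolding XS VU by simp
    finally have UD: "U n * D = fps_shift 1 (P n * U n)" by simp
    have D0: "fps_nth D i = 0" if "i \<ge> n" for i
      using that P0[of n "Suc i"] sarason_nth_large[of n "Suc i" "P n"] by (simp add: D_def V_def)
    obtain d where d: "d \<in> S" "E d = D * E g" by (rule poly_mult[OF S D0 g(1)])
    obtain z where z: "z \<in> S" "E z = U n * E d" using res[OF S d(1)] by meson
    have Ez: "E z = fps_shift 1 (P n * U n) * E g" unfolding z(2) d(2) UD[symmetric] by (rule mult.assoc[symmetric])
    obtain k where k: "k \<in> S" "E k = P n * U n * E g" "hnorm H k \<le> hnorm H g"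
      using res[OF S g(1)] by meson
    have qg: "cscale q g \<in> S" using invariantD(7)[OF S g(1)] .
    have "E (M z) = (fps_X * fps_shift 1 (P n * U n)) * E g" using z(1) Sv by (simp add: E_M Ez mult.assoc)
    also have "\<dots> = E (k - cscale q g)"
      unfolding XS using k(1) qg g(1) Sv by (simp add: E_diff E_scale k(2) algebra_simps)
    finally have "M z = k - cscale q g"
      using z(1) k(1) qg Sv by (intro E_inject) auto
    \<comment> \<open>\<open>M\<close> does not decrease norms, so the bound for
      \<open>k - cscale q g\<close> passes to its quotient \<open>z\<close>.\<close>
    then have "hnorm H z \<le> hnorm H (k - cscale q g)" using hnorm_M(1)[OF Sv[OF z(1)]] by simp
    also have "\<dots> \<le> hnorm H k + hnorm H (cscale q g)"
      using hnorm_triangle_diff[OF Sv[OF k(1)] vecs_closed(1) Sv[OF qg]]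
        hnorm_minus_commute[OF vecs_closed(1) Sv[OF qg]] by simp
    also have "\<dots> \<le> hnorm H g + cmod q * hnorm H g" using k(3) hnorm_scale[OF Sv[OF g(1)]] by simp
    also have "\<dots> \<le> hnorm H g + cmod (fps_nth F 0) * hnorm H g"
    proof -
      have "cmod (fps_nth (U n) 0) \<le> 1"
        using V0[of n] by (simp add: U_def norm_inverse inverse_le_1_iff)
      moreover have "cmod (fps_nth (P n) 0) \<le> cmod (fps_nth F 0)"
        by (simp add: P_def c_trunc flip: fh(2))
      ultimately have "cmod q \<le> cmod (fps_nth F 0) * 1"
        unfolding q_def fps_mult_nth_0 norm_mult by (intro mult_mono) auto
      then show ?thesis using Sv[OF g(1)] by (simp add: mult_right_mono)
    qed
    finally show ?thesis using z(1) Ez by (auto simp: algebra_simps)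
  qed
  then have "\<forall>n. \<exists>z. z \<in> S \<and> E z = fps_shift 1 (P n * U n) * E g
      \<and> hnorm H z \<le> (1 + cmod (fps_nth F 0)) * hnorm H g" ..
  then obtain Z where Z: "\<And>n. Z n \<in> S" "\<And>n. E (Z n) = fps_shift 1 (P n * U n) * E g"
    "\<And>n. hnorm H (Z n) \<le> (1 + cmod (fps_nth F 0)) * hnorm H g"
    using choice[of "\<lambda>n z. z \<in> S \<and> E z = fps_shift 1 (P n * U n) * E g
      \<and> hnorm H z \<le> (1 + cmod (fps_nth F 0)) * hnorm H g"] by auto
  have "fps_tends (\<lambda>n. E (Z n)) (fps_shift 1 (F * u) * E g)"
    unfolding Z(2) by (intro fps_tends_mult fps_tends_shift tP tU fps_tends_const)
  then obtain z where z: "z \<in> S" "E z = fps_shift 1 (F * u) * E g" by (rule fps_limit[OF S Z(1,3)])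

  define q where "q = fps_nth (F * u) 0"
  have q: "q \<noteq> 0" using F0 L0 by (simp add: q_def u_def)
  have XS: "fps_X * fps_shift 1 (F * u) = F * u - fps_const q"
    by (auto simp: fps_eq_iff q_def)
  have yz: "y1 - z \<in> S" using invariantD(6)[OF S y1(1) z(1)] .
  have "E (y1 - z) = G * (u * (fps_X ^ m * F)) - (fps_X * fps_shift 1 (F * u)) * (fps_X ^ m * G)"
    using y1 z Sv by (simp add: E_diff f(2) g(2) algebra_simps)
  also have "\<dots> = fps_const q * (fps_X ^ m * G)" unfolding XS by (simp add: algebra_simps)
  finally have e: "E (y1 - z) = fps_const q * (fps_X ^ m * G)" .
  have "E (cscale (1 / q) (y1 - z)) = fps_const (1 / q) * (fps_const q * (fps_X ^ m * G))"
    unfolding E_scale[OF Sv[OF yz]] e ..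
  also have "\<dots> = fps_X ^ m * G" using q by (simp flip: mult.assoc add: fps_const_mult)
  finally show thesis using that invariantD(7)[OF S yz] by blast
qed

text \<open>
  Richter's argument: writing \<open>x = \<alpha>\<^sub>0 \<phi> + M x\<^sub>1\<close>, \<open>x\<^sub>1 = \<alpha>\<^sub>1 \<phi> + M x\<^sub>2\<close> and so on, the remainders
  \<open>M^n x\<^sub>n\<close> are bounded along a subsequence and have a zero of order \<open>n\<close>, so they tend weakly to \<open>0\<close>.
\<close>

theorem cyclic_vector:
  assumes S: "invariant S"
  obtains \<phi> where "\<phi> \<in> S" "\<And>x. x \<in> S \<Longrightarrow> (\<And>p. ip H x ((M ^^ p) \<phi>) = 0) \<Longrightarrow> x = 0"
proof (cases "S = {0}")
  case True
  then show thesis by (intro that[of 0]) auto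
next
  case False
  note Sv = invariantD(2)[OF S]
  obtain f where f: "f \<in> S" "f \<noteq> 0" using False invariantD(4)[OF S] by blast
  then have "\<exists>i. c f i \<noteq> 0" using c_inj[OF Sv] by blast
  then have ex: "\<exists>i. \<exists>f\<in>S. c f i \<noteq> 0" using f by blast
  define m where "m = (LEAST i. \<exists>f\<in>S. c f i \<noteq> 0)"
  obtain f0 where f0: "f0 \<in> S" "c f0 m \<noteq> 0" using LeastI_ex[OF ex] unfolding m_def by blast
  have low: "c f i = 0" if "f \<in> S" "i < m" for f i
    using not_less_Least[of i "\<lambda>i. \<exists>f\<in>S. c f i \<noteq> 0"] that unfolding m_def by blast
  have factor: "E f = fps_X ^ m * fps_shift m (E f)" if "f \<in> S" for f
    using low[OF that] by (auto simp: fps_eq_iff fps_X_power_mult_nth)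
  have quotient: "\<exists>y\<in>S. x = M y" if x: "x \<in> S" "c x m = 0" for x
  proof -
    have "E x = fps_X ^ Suc m * fps_shift (Suc m) (E x)"
      using low[OF x(1)] x(2) by (auto simp: fps_eq_iff fps_X_power_mult_nth less_Suc_eq simp del: power_Suc)
    then obtain y where y: "y \<in> S" "E y = fps_X ^ m * fps_shift (Suc m) (E x)"
      using division[OF S f0(1) factor[OF f0(1)] _ x(1)] f0(2) by (auto simp del: power_Suc)
    have "E x = E (M y)"
      using \<open>E x = fps_X ^ Suc m * fps_shift (Suc m) (E x)\<close> y Sv by (simp add: E_M mult.assoc)
    then show ?thesis using E_inject[OF Sv[OF x(1)] M_vecs[OF Sv[OF y(1)]]] y(1) by blast
  qed
  \<comment> \<open>By \<open>quotient\<close> and the minimality of \<open>m\<close>,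
    \<open>S0\<close> is \<open>M\<close> applied to \<open>S\<close>. It is closed because the
    coefficient functional is bounded, and \<open>\<phi>\<close> is the component of
    \<open>f0\<close> orthogonal to it.\<close>
  define S0 where "S0 = {x \<in> S. c x m = 0}"
  have S0v: "S0 \<subseteq> vecs H" using Sv by (auto simp: S0_def)
  have S0sub: "cfun.subspace S0"
    unfolding cfun.subspace_def S0_def
    using invariantD(4,5,7)[OF S] Sv by (auto simp: c_add c_scale)
  have S0: "closed_subspace H S0"
  proof -
    have "f \<in> S0" if fc: "f \<in> hclosure H S0" for f
    proof -
      have "f \<in> hclosure H S" using fc by (auto simp: hclosure_def S0_def)
      then have fS: "f \<in> S" using invariantD(1)[OF S] by (simp add: closed_subspace_def)
      have "cmod (c f m) \<le> e" if e: "e > 0" for e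
      proof -
        obtain g where g: "g \<in> S0" "hnorm H (f - g) < e" by (rule hclosureE[OF fc e])
        then have "cmod (c (f - g) m) \<le> hnorm H (f - g)"
          using norm_coeff_le_hnorm[of "f - g" m] Sv[OF fS] S0v by blast
        then show ?thesis using g Sv[OF fS] S0v by (auto simp: c_diff S0_def)
      qed
      then have "cmod (c f m) \<le> 0" by (rule field_le_epsilon[where y = 0, simplified])
      then show ?thesis using fS by (simp add: S0_def)
    qed
    then show ?thesis using S0v S0sub hclosure_superset[OF S0v] by (auto simp: closed_subspace_def)
  qed
  obtain s where s: "s \<in> S0" "f0 - s \<in> orth_compl H S0" by (rule projection[OF S0 Sv[OF f0(1)]])
  define \<phi> where "\<phi> = f0 - s"
  have \<phi>S: "\<phi> \<in> S" using f0(1) s(1) invariantD(6)[OF S] by (auto simp: \<phi>_def S0_def)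
  have \<phi>m: "c \<phi> m \<noteq> 0" using f0 s(1) Sv by (auto simp: \<phi>_def S0_def c_diff)
  have \<phi>perp: "ip H \<phi> g = 0" if "g \<in> S0" for g using s(2) that by (simp add: orth_compl_def \<phi>_def)
  have split: "\<exists>y a. y \<in> S \<and> x = cscale a \<phi> + M y \<and> hnorm H (M y) \<le> hnorm H x" if x: "x \<in> S" for x
  proof -
    define a where "a = c x m / c \<phi> m"
    have a\<phi>: "cscale a \<phi> \<in> S" using invariantD(7)[OF S \<phi>S] .
    have r: "x - cscale a \<phi> \<in> S" using invariantD(6)[OF S x a\<phi>] .
    have r0: "c (x - cscale a \<phi>) m = 0"
      unfolding c_diff[OF Sv[OF x] Sv[OF a\<phi>]] c_scale[OF Sv[OF \<phi>S]] using \<phi>m by (simp add: a_def)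
    obtain y where y: "y \<in> S" "x - cscale a \<phi> = M y" using quotient[OF r r0] by blast
    have xe: "x = cscale a \<phi> + M y" unfolding y(2)[symmetric] by auto
    have "M y \<in> S0" using r r0 y(2) by (simp add: S0_def)
    then have "ip H (cscale a \<phi>) (M y) = 0"
      using ip_scale[OF Sv[OF \<phi>S], of "M y" a] \<phi>perp y(1) Sv by simp
    then have "(hnorm H x)\<^sup>2 = (hnorm H (cscale a \<phi>))\<^sup>2 + (hnorm H (M y))\<^sup>2"
      unfolding xe using hnorm_sq_add[OF Sv[OF a\<phi>] M_vecs[OF Sv[OF y(1)]]] by blast
    then have "(hnorm H (M y))\<^sup>2 \<le> (hnorm H x)\<^sup>2" using zero_le_power2[of "hnorm H (cscale a \<phi>)"] by linarith
    then have "hnorm H (M y) \<le> hnorm H x" by (rule power2_le_imp_le) (use Sv[OF x] in simp)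
    then show ?thesis using y(1) xe by blast
  qed
  show thesis
  proof (rule that[OF \<phi>S])
    fix x assume x: "x \<in> S" and perp: "\<And>p. ip H x ((M ^^ p) \<phi>) = 0"
    note xv = Sv[OF x]
    have "\<exists>X. X 0 = x \<and> (\<forall>n. X n \<in> S \<and> (\<exists>a. X n = cscale a \<phi> + M (X (Suc n))
        \<and> hnorm H (M (X (Suc n))) \<le> hnorm H (X n)))"
    proof -
      have "\<exists>L. \<forall>x. x \<in> S \<longrightarrow> L x \<in> S \<and> (\<exists>a. x = cscale a \<phi> + M (L x) \<and> hnorm H (M (L x)) \<le> hnorm H x)"
        by (rule choice) (use split in blast)
      then obtain L where L: "\<And>x. x \<in> S \<Longrightarrow> L x \<in> S"
        "\<And>x. x \<in> S \<Longrightarrow> \<exists>a. x = cscale a \<phi> + M (L x) \<and> hnorm H (M (L x)) \<le> hnorm H x" by auto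
      have "(L ^^ n) x \<in> S" for n by (induction n) (auto simp: x L(1))
      then show ?thesis using L(2) by (intro exI[of _ "\<lambda>n. (L ^^ n) x"]) auto
    qed
    then obtain X where X0: "X 0 = x" and XS: "\<And>n. X n \<in> S"
      and Xs: "\<And>n. \<exists>a. X n = cscale a \<phi> + M (X (Suc n)) \<and> hnorm H (M (X (Suc n))) \<le> hnorm H (X n)"
      by auto
    note Xv = Sv[OF XS]
    have pow_add: "(M ^^ n) (f + g) = (M ^^ n) f + (M ^^ n) g" if "f \<in> vecs H" "g \<in> vecs H" for f g n
    proof (induction n)
      case (Suc n)
      show ?case unfolding funpow.simps o_apply Suc M_add[OF M_pow_vecs[OF that(1)] M_pow_vecs[OF that(2)]] ..
    qed simp
    have pow_scale: "(M ^^ n) (cscale k f) = cscale k ((M ^^ n) f)" if "f \<in> vecs H" for f n k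
    proof (induction n)
      case (Suc n)
      show ?case unfolding funpow.simps o_apply Suc M_scale[OF M_pow_vecs[OF that]] ..
    qed simp
    \<comment> \<open>Unrolling the splitting \<open>n\<close> times writes \<open>x\<close> as a
      combination of the \<open>(M ^^ p) \<phi>\<close> with \<open>p < n\<close> plus
      \<open>(M ^^ n) (X n)\<close>, and \<open>x\<close> is orthogonal to the combination.\<close>
    have rem: "ip H x x = ip H x ((M ^^ n) (X n))" for n
    proof (induction n)
      case 0
      then show ?case by (simp add: X0)
    next
      case (Suc n)
      obtain a where a: "X n = cscale a \<phi> + M (X (Suc n))" using Xs by blast
      have a\<phi>: "cscale a \<phi> \<in> vecs H" using Sv[OF \<phi>S] by (rule vecs_closed(4))
      have "(M ^^ n) (X n) = cscale a ((M ^^ n) \<phi>) + (M ^^ n) (M (X (Suc n)))"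
        unfolding a pow_add[OF a\<phi> M_vecs[OF Xv]] pow_scale[OF Sv[OF \<phi>S]] ..
      moreover have "(M ^^ n) (M (X (Suc n))) = (M ^^ Suc n) (X (Suc n))"
        by (simp add: funpow_swap1)
      ultimately have e: "(M ^^ n) (X n) = cscale a ((M ^^ n) \<phi>) + (M ^^ Suc n) (X (Suc n))" by simp
      have "ip H x ((M ^^ n) (X n)) = cnj a * ip H x ((M ^^ n) \<phi>) + ip H x ((M ^^ Suc n) (X (Suc n)))"
        unfolding e ip_add_right[OF vecs_closed(4)[OF M_pow_vecs[OF Sv[OF \<phi>S]]] M_pow_vecs[OF Xv] xv]
          ip_scale_right[OF M_pow_vecs[OF Sv[OF \<phi>S]] xv] ..
      then show ?case using Suc.IH perp by simp
    qed
    define b where "b n = (hnorm H (X n))\<^sup>2" for n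
    have dec: "(hnorm H (M (X (Suc n))))\<^sup>2 \<le> b n" for n
      unfolding b_def using Xs[of n] M_vecs[OF Xv[of "Suc n"]] by (intro power_mono hnorm_nonneg) auto
    have mono: "b n \<le> (hnorm H (M (X n)))\<^sup>2" for n
      unfolding b_def using hnorm_M(1)[OF Xv] Xv by (intro power_mono) auto
    have bdec: "b (Suc n) \<le> b n" for n using dec[of n] mono[of "Suc n"] by linarith
    have b0: "b n \<le> b 0" for n by (induction n) (use bdec order_trans in auto)
    \<comment> \<open>Since \<open>b (Suc n) \<le> \<parallel>M (X (Suc n))\<parallel>\<^sup>2 \<le>
      b n\<close>, the slope in \<open>M_pow_norm\<close> is at most the decrement of
      \<open>b\<close>, which infinitely often is at most \<open>1 / (n + 1)\<close>.\<close>
    have bound: "(hnorm H ((M ^^ Suc n) (X (Suc n))))\<^sup>2 \<le> b 0 + 1"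
      if "real (Suc n) * (b n - b (Suc n)) \<le> 1" for n
    proof -
      have "(hnorm H ((M ^^ Suc n) (X (Suc n))))\<^sup>2
          = b (Suc n) + real (Suc n) * ((hnorm H (M (X (Suc n))))\<^sup>2 - b (Suc n))"
        unfolding b_def by (rule M_pow_norm[OF Xv])
      also have "\<dots> \<le> b (Suc n) + real (Suc n) * (b n - b (Suc n))"
        by (intro add_left_mono mult_left_mono diff_right_mono dec) simp
      also have "\<dots> \<le> b 0 + 1" using b0[of "Suc n"] that by linarith
      finally show ?thesis .
    qed
    define C where "C = sqrt (b 0 + 1)"
    \<comment> \<open>The truncation of \<open>x\<close> is orthogonal to a vector with a zero of
      order \<open>n\<close>, so only the tail of \<open>x\<close> meets the remainder.\<close>
    have est: "cmod (ip H x x) \<le> hnorm H (trunc n x - x) * hnorm H ((M ^^ n) (X n))" for n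
    proof -
      have "ip H ((M ^^ n) (X n)) (trunc n x) = (\<Sum>i<n. complex_of_real (weight K i)
          * c ((M ^^ n) (X n)) i * cnj (c (trunc n x) i))"
        by (rule ip_finite[OF M_pow_vecs[OF Xv] trunc_vecs finite_lessThan]) (simp add: c_trunc)
      then have "ip H ((M ^^ n) (X n)) (trunc n x) = 0" by (simp add: c_M_pow[OF Xv])
      then have "ip H (trunc n x) ((M ^^ n) (X n)) = 0"
        using ip_eq_0_sym M_pow_vecs[OF Xv] trunc_vecs by blast
      then have "ip H (trunc n x - x) ((M ^^ n) (X n)) = - ip H x x"
        using ip_diff[OF trunc_vecs xv M_pow_vecs[OF Xv]] rem[of n] by simp
      then show ?thesis
        using Cauchy_Schwarz[OF vecs_closed(3)[OF trunc_vecs xv] M_pow_vecs[OF Xv], of n]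
        by (metis norm_minus_cancel)
    qed
    have "cmod (ip H x x) \<le> e" if e: "e > 0" for e
    proof -
      have C: "C > 0" using b_def[of 0] by (simp add: C_def add_nonneg_pos)
      have "\<forall>\<^sub>F n in sequentially. hnorm H (trunc n x - x) < e / C"
        using order_tendstoD(2)[OF trunc_tendsto[OF xv]] e C by simp
      then obtain N where N: "\<And>n. n \<ge> N \<Longrightarrow> hnorm H (trunc n x - x) < e / C"
        by (auto simp: eventually_sequentially)
      obtain n where n: "n \<ge> N" "real (Suc n) * (b n - b (Suc n)) \<le> 1"
        using frequently_slow_decrease[of b N] bdec by (auto simp: b_def)
      have "hnorm H ((M ^^ Suc n) (X (Suc n))) \<le> C"
        unfolding C_def by (rule real_le_rsqrt[OF bound[OF n(2)]])
      then have "hnorm H (trunc (Suc n) x - x) * hnorm H ((M ^^ Suc n) (X (Suc n))) \<le> e / C * C"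
        using N[of "Suc n"] n(1) C M_pow_vecs[OF Xv] e
        by (intro mult_mono hnorm_nonneg) auto
      then show ?thesis using est[of "Suc n"] C by simp
    qed
    then have "cmod (ip H x x) \<le> 0" by (rule field_le_epsilon[where y = 0, simplified])
    then show "x = 0" using ip_definite[OF xv] by simp
  qed
qed

end

section \<open>The Hardy and the Dirichlet space\<close>

lemma vecs_disc_iff:
  "f \<in> vecs (disc_hilbert K) \<longleftrightarrow> f holomorphic_on ball 0 1 \<and> (\<forall>z. z \<notin> ball 0 1 \<longrightarrow> f z = 0) \<and>
     (\<lambda>m. weight K m * (cmod (fps_nth (fps_expansion f 0) m))\<^sup>2) summable_on UNIV"
  by (subst summable_on_UNIV_nonneg_real_iff) (simp_all add: disc_hilbert_def less_imp_le[OF weight_pos])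

lemma disc_has_fps_expansion:
  "f holomorphic_on ball 0 1 \<Longrightarrow> f has_fps_expansion fps_expansion f 0"
  by (rule has_fps_expansion_fps_expansion[of "ball 0 1"]) auto

lemma disc_sums:
  assumes "f holomorphic_on ball 0 1" "z \<in> ball 0 1"
  shows "(\<lambda>n. fps_nth (fps_expansion f 0) n * z ^ n) sums f z"
  using has_fps_expansion_imp_sums_complex[OF disc_has_fps_expansion[OF assms(1)], of "ereal 1" z] assms
  by (simp add: eball_def ball_def)

lemma bounded_coeff_conv_radius:
  assumes "\<And>n. cmod (a n) \<le> B"
  shows "fps_conv_radius (Abs_fps a) \<ge> 1"
  unfolding fps_conv_radius_def
proof (rule conv_radius_geI_ex')
  fix r :: real assume r: "0 < r" "ereal r < 1"
  have "summable (\<lambda>n. B * r ^ n)" using r by (intro summable_mult summable_geometric) (simp add: one_ereal_def)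
  then show "summable (\<lambda>n. fps_nth (Abs_fps a) n * of_real r ^ n)"
    by (rule summable_comparison_test') (use assms r in \<open>auto simp: norm_mult norm_power intro!: mult_right_mono\<close>)
qed

lemma disc_space_surj:
  assumes "(\<lambda>m. weight K m * (cmod (a m))\<^sup>2) summable_on UNIV"
  obtains f where "f \<in> vecs (disc_hilbert K)" "fps_nth (fps_expansion f 0) = a"
proof -
  define f where "f z = (if z \<in> ball 0 1 then eval_fps (Abs_fps a) z else 0)" for z :: complex
  have "cmod (a m) \<le> sqrt (\<Sum>\<^sub>\<infinity>m. weight K m * (cmod (a m))\<^sup>2)" for m
  proof (rule real_le_rsqrt)
    have "(cmod (a m))\<^sup>2 \<le> weight K m * (cmod (a m))\<^sup>2"
      using mult_right_mono[OF weight_ge1[of K m], of "(cmod (a m))\<^sup>2"] by simp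
    also have "\<dots> = sum (\<lambda>m. weight K m * (cmod (a m))\<^sup>2) {m}" by simp
    also have "\<dots> \<le> (\<Sum>\<^sub>\<infinity>m. weight K m * (cmod (a m))\<^sup>2)"
      by (rule finite_sum_le_infsum[OF assms]) (auto simp: less_imp_le[OF weight_pos])
    finally show "(cmod (a m))\<^sup>2 \<le> (\<Sum>\<^sub>\<infinity>m. weight K m * (cmod (a m))\<^sup>2)" .
  qed
  then have rad: "fps_conv_radius (Abs_fps a) \<ge> 1" by (rule bounded_coeff_conv_radius)
  have "ball 0 1 \<subseteq> eball (0::complex) (fps_conv_radius (Abs_fps a))"
  proof
    fix z :: complex assume "z \<in> ball 0 1"
    then have "ereal (norm z) < 1" by (simp add: one_ereal_def)
    also note rad
    finally show "z \<in> eball (0::complex) (fps_conv_radius (Abs_fps a))" by (simp add: in_eball_iff)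
  qed
  then have "eval_fps (Abs_fps a) holomorphic_on ball 0 1" by (rule holomorphic_on_eval_fps)
  then have hol: "f holomorphic_on ball 0 1" by (rule holomorphic_transform) (simp add: f_def)
  have "eval_fps (Abs_fps a) has_fps_expansion Abs_fps a"
    by (rule eval_fps_has_fps_expansion) (use rad in \<open>auto intro: less_le_trans[of 0 1]\<close>)
  moreover have "\<forall>\<^sub>F z in nhds 0. f z = eval_fps (Abs_fps a) z"
    using eventually_nhds_in_open[of "ball 0 1" "0::complex"] by (auto elim!: eventually_mono simp: f_def)
  ultimately have "f has_fps_expansion Abs_fps a" using has_fps_expansion_cong by blast
  then have "fps_expansion f 0 = Abs_fps a" by (rule fps_expansion_eqI)
  then show thesis using hol assms by (intro that[of f]) (auto simp: vecs_disc_iff f_def)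
qed

lemma mult_z_expansion:
  assumes "f holomorphic_on ball 0 1"
  shows "fps_expansion (mult_z f) 0 = fps_X * fps_expansion f 0"
  unfolding mult_z_def
  by (intro fps_expansion_eqI has_fps_expansion_mult has_fps_expansion_fps_X disc_has_fps_expansion assms)

abbreviation disc_coeff :: "(complex \<Rightarrow> complex) \<Rightarrow> nat \<Rightarrow> complex" where
  "disc_coeff f \<equiv> fps_nth (fps_expansion f 0)"

lemma shift_space_disc: "shift_space (disc_hilbert K) disc_coeff K mult_z"
proof
  let ?H = "disc_hilbert K"
  show "1 \<le> weight K i" for i by (rule weight_ge1)
  have add: "fps_expansion (f + g) 0 = fps_expansion f 0 + fps_expansion g 0"
    if "f holomorphic_on ball 0 1" "g holomorphic_on ball 0 1" for f g
    unfolding plus_fun_def by (intro fps_expansion_eqI has_fps_expansion_add disc_has_fps_expansion that)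
  have scale: "fps_expansion (cscale k f) 0 = fps_const k * fps_expansion f 0"
    if "f holomorphic_on ball 0 1" for f k
    by (intro fps_expansion_eqI has_fps_expansion_cmult_left disc_has_fps_expansion that)
  show "cfun.subspace (vecs ?H)"
    unfolding cfun.subspace_def
  proof (intro conjI ballI allI)
    have "fps_expansion (0 :: complex \<Rightarrow> complex) 0 = 0"
      unfolding zero_fun_def by (intro fps_expansion_eqI has_fps_expansion_0)
    then show "0 \<in> vecs ?H" by (simp add: vecs_disc_iff zero_fun_def)
  next
    fix f g assume fg: "f \<in> vecs ?H" "g \<in> vecs ?H"
    have "(\<lambda>m. weight K m * (cmod (disc_coeff f m + disc_coeff g m))\<^sup>2) summable_on UNIV"
      using fg by (intro weighted_summable_add) (auto simp: vecs_disc_iff less_imp_le[OF weight_pos])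
    then show "f + g \<in> vecs ?H"
      using fg add[of f g] by (auto simp: vecs_disc_iff plus_fun_def intro: holomorphic_on_add)
  next
    fix k f assume f: "f \<in> vecs ?H"
    have "(\<lambda>m. (cmod k)\<^sup>2 * (weight K m * (cmod (disc_coeff f m))\<^sup>2)) summable_on UNIV"
      using f by (intro summable_on_cmult_right) (auto simp: vecs_disc_iff)
    then show "cscale k f \<in> vecs ?H"
      using f scale[of f k]
      by (auto simp: vecs_disc_iff norm_mult power_mult_distrib ac_simps intro!: holomorphic_intros)
  qed
  show "disc_coeff (f + g) i = disc_coeff f i + disc_coeff g i"
    if "f \<in> vecs ?H" "g \<in> vecs ?H" for f g i
    using that add by (simp add: vecs_disc_iff)
  show "disc_coeff (cscale k f) i = k * disc_coeff f i" if "f \<in> vecs ?H" for f k i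
    using that scale by (simp add: vecs_disc_iff)
  show "f = 0" if f: "f \<in> vecs ?H" and z: "\<And>i. disc_coeff f i = 0" for f
  proof
    fix z
    show "f z = 0 z"
    proof (cases "z \<in> ball 0 1")
      case True
      then have "(\<lambda>n. disc_coeff f n * z ^ n) sums f z" using f by (intro disc_sums) (auto simp: vecs_disc_iff)
      then show ?thesis using z by (simp add: sums_iff)
    next
      case False
      then show ?thesis using f by (simp add: vecs_disc_iff)
    qed
  qed
  show "(\<lambda>i. weight K i * (cmod (disc_coeff f i))\<^sup>2) summable_on UNIV" if "f \<in> vecs ?H" for f
    using that by (simp add: vecs_disc_iff)
  show "\<exists>f\<in>vecs ?H. disc_coeff f = a" if "(\<lambda>i. weight K i * (cmod (a i))\<^sup>2) summable_on UNIV" for a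
    using disc_space_surj[OF that] by blast
  show "ip ?H f g = (\<Sum>\<^sub>\<infinity>i. complex_of_real (weight K i) * disc_coeff f i * cnj (disc_coeff g i))"
    if "f \<in> vecs ?H" "g \<in> vecs ?H" for f g
  proof -
    have "(\<lambda>i. complex_of_real (weight K i) * disc_coeff f i * cnj (disc_coeff g i)) summable_on UNIV"
      using that by (intro weighted_product_summable) (auto simp: vecs_disc_iff less_imp_le[OF weight_pos])
    from sums_unique[OF has_sum_imp_sums[OF has_sum_infsum[OF this]]]
    show ?thesis by (simp add: disc_hilbert_def)
  qed
  fix f assume f: "f \<in> vecs ?H"
  have e: "fps_expansion (mult_z f) 0 = fps_X * fps_expansion f 0"
    using f by (intro mult_z_expansion) (simp add: vecs_disc_iff)
  show "disc_coeff (mult_z f) n = (if n = 0 then 0 else disc_coeff f (n - 1))" for n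
    by (simp add: e)
  have "summable (\<lambda>m. weight K m * (cmod (disc_coeff f m))\<^sup>2)"
    using f by (simp add: disc_hilbert_def)
  then have "summable (\<lambda>m. 2 * (weight K m * (cmod (disc_coeff f m))\<^sup>2))" by (rule summable_mult)
  then have "summable (\<lambda>m. weight K (Suc m) * (cmod (disc_coeff f m))\<^sup>2)"
  proof (rule summable_comparison_test')
    fix m
    have "weight K (Suc m) * (cmod (disc_coeff f m))\<^sup>2 \<le> 2 * weight K m * (cmod (disc_coeff f m))\<^sup>2"
      by (intro mult_right_mono weight_Suc) simp
    then show "norm (weight K (Suc m) * (cmod (disc_coeff f m))\<^sup>2) \<le> 2 * (weight K m * (cmod (disc_coeff f m))\<^sup>2)"
      using weight_pos[of K "Suc m"] by (simp add: less_imp_le[OF weight_pos])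
  qed
  then have "summable (\<lambda>m. weight K m * (cmod (disc_coeff (mult_z f) m))\<^sup>2)"
    by (subst summable_Suc_iff[symmetric]) (simp add: e)
  then show "mult_z f \<in> vecs ?H"
    using f by (auto simp: disc_hilbert_def mult_z_def intro!: holomorphic_intros)
qed

section \<open>The adjoint of the shift and reproducing kernels\<close>

context shift_space
begin

text \<open>The adjoint is a weighted backward shift whose ratios are at most 2. The explicit
  coefficients are what \<open>ip_mult_coord_elementary_tensor\<close> compares.\<close>

lemma adjoint_exists:
  assumes h: "h \<in> vecs H"
  obtains h' where "h' \<in> vecs H" "\<And>m. c h' m = of_real (weight K (Suc m) / weight K m) * c h (Suc m)"
    "\<And>f. f \<in> vecs H \<Longrightarrow> ip H (M f) h = ip H f h'"
proof -
  define a where "a m = complex_of_real (weight K (Suc m) / weight K m) * c h (Suc m)" for m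
  have "summable (\<lambda>m. 2 * (weight K (Suc m) * (cmod (c h (Suc m)))\<^sup>2))"
    using sums_summable[OF norm_sums[OF h]] by (intro summable_mult) (subst summable_Suc_iff)
  then have "summable (\<lambda>m. weight K m * (cmod (a m))\<^sup>2)"
  proof (rule summable_comparison_test')
    fix m
    have "weight K (Suc m) / weight K m \<le> 2"
      using weight_Suc(2)[of K m] weight_pos[of K m] by (simp add: pos_divide_le_eq)
    then have "(weight K (Suc m) / weight K m) * (weight K (Suc m) * (cmod (c h (Suc m)))\<^sup>2)
        \<le> 2 * (weight K (Suc m) * (cmod (c h (Suc m)))\<^sup>2)"
      by (intro mult_right_mono mult_nonneg_nonneg) (auto simp: w_nonneg)
    moreover have "weight K m * (cmod (a m))\<^sup>2
        = (weight K (Suc m) / weight K m) * (weight K (Suc m) * (cmod (c h (Suc m)))\<^sup>2)"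
      unfolding a_def norm_mult power_mult_distrib norm_of_real power2_abs
      using weight_pos[of K m] by (simp add: power2_eq_square less_imp_neq[symmetric])
    ultimately show "norm (weight K m * (cmod (a m))\<^sup>2) \<le> 2 * (weight K (Suc m) * (cmod (c h (Suc m)))\<^sup>2)"
      by (simp add: w_nonneg)
  qed
  then have "(\<lambda>m. weight K m * (cmod (a m))\<^sup>2) summable_on UNIV"
    by (subst summable_on_UNIV_nonneg_real_iff) (simp_all add: w_nonneg)
  from c_surj[OF this] obtain h' where h': "h' \<in> vecs H" "c h' = a" by auto
  have "ip H (M f) h = ip H f h'" if f: "f \<in> vecs H" for f
  proof -
    let ?s = "\<lambda>m. complex_of_real (weight K m) * c (M f) m * cnj (c h m)"
    have "?s sums ip H (M f) h" by (rule has_sum_imp_sums[OF ip_has_sum[OF M_vecs[OF f] h]])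
    moreover have "?s 0 = 0" by (simp add: c_M[OF f])
    ultimately have "?s sums (ip H (M f) h + ?s 0)" by (simp only: add_0_right)
    then have "(\<lambda>m. ?s (Suc m)) sums ip H (M f) h" by (rule sums_Suc_iff[of ?s, THEN iffD2])
    moreover have "?s (Suc m) = complex_of_real (weight K m) * c f m * cnj (c h' m)" for m
      using weight_pos[of K m] by (simp add: c_M[OF f] h'(2) a_def less_imp_neq[symmetric])
    ultimately show ?thesis
      using sums_unique2 has_sum_imp_sums[OF ip_has_sum[OF f h'(1)]] by simp
  qed
  then show thesis using that h' by (simp add: a_def)
qed

text \<open>\<open>k\<close> is the reproducing kernel at \<open>l\<close>, an eigenvector of the
  adjoint of \<open>M\<close>. Its norm is dominated by a geometric series, hence uniformly on
  compact subsets of the disc, as Cauchy's estimate requires.\<close>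

lemma eval_kernel:
  assumes l: "cmod l < 1"
  obtains k where "k \<in> vecs H" "\<And>m. c k m = cnj l ^ m / of_real (weight K m)"
    "\<And>f. f \<in> vecs H \<Longrightarrow> (\<lambda>m. c f m * l ^ m) sums ip H f k"
    "(hnorm H k)\<^sup>2 \<le> 1 / (1 - (cmod l)\<^sup>2)" "\<And>f. f \<in> vecs H \<Longrightarrow> ip H (M f) k = l * ip H f k"
proof -
  define a where "a m = cnj l ^ m / complex_of_real (weight K m)" for m
  have geom: "(\<lambda>m. ((cmod l)\<^sup>2) ^ m) sums (1 / (1 - (cmod l)\<^sup>2))"
    using l by (intro geometric_sums) (simp add: power_less_one_iff abs_square_less_1)
  have le: "weight K m * (cmod (a m))\<^sup>2 \<le> ((cmod l)\<^sup>2) ^ m" for m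
  proof -
    have "weight K m * (cmod (a m))\<^sup>2 = ((cmod l)\<^sup>2) ^ m / weight K m"
      using weight_pos[of K m]
      by (simp add: a_def norm_divide norm_power power_divide power2_eq_square power_mult_distrib w_nonneg less_imp_neq[symmetric])
    also have "\<dots> \<le> ((cmod l)\<^sup>2) ^ m / 1" by (intro divide_left_mono weight_ge1) auto
    finally show ?thesis by simp
  qed
  have "summable (\<lambda>m. weight K m * (cmod (a m))\<^sup>2)"
    by (rule summable_comparison_test'[OF sums_summable[OF geom]]) (use le in \<open>simp add: w_nonneg\<close>)
  then have "(\<lambda>m. weight K m * (cmod (a m))\<^sup>2) summable_on UNIV"
    by (subst summable_on_UNIV_nonneg_real_iff) (simp_all add: w_nonneg)
  from c_surj[OF this] obtain k where k: "k \<in> vecs H" "c k = a" by auto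
  have s: "(\<lambda>m. c f m * l ^ m) sums ip H f k" if f: "f \<in> vecs H" for f
  proof -
    have "complex_of_real (weight K m) * c f m * cnj (c k m) = c f m * l ^ m" for m
      using weight_pos[of K m] by (simp add: k(2) a_def less_imp_neq[symmetric])
    then show ?thesis using has_sum_imp_sums[OF ip_has_sum[OF f k(1)]] by (simp only:)
  qed
  have "ip H (M f) k = l * ip H f k" if f: "f \<in> vecs H" for f
  proof -
    have "(\<lambda>m. c (M f) (Suc m) * l ^ Suc m) sums (l * ip H f k)"
      using sums_mult[OF s[OF f], of l] by (simp add: c_M[OF f] ac_simps)
    then have "(\<lambda>m. c (M f) m * l ^ m) sums (l * ip H f k)"
      by (subst (asm) sums_Suc_iff) (simp add: c_M[OF f])
    then show ?thesis using s[OF M_vecs[OF f]] sums_unique2 by blast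
  qed
  moreover have "(hnorm H k)\<^sup>2 \<le> 1 / (1 - (cmod l)\<^sup>2)"
    using sums_le[OF _ norm_sums[OF k(1)] geom] le by (simp add: hnorm_sq k)
  ultimately show thesis using that[of k] k s by (simp add: a_def)
qed

end

lemma disc_eval_kernel:
  assumes l: "l \<in> ball 0 1"
  obtains k where "k \<in> vecs (disc_hilbert K)" "\<And>f. f \<in> vecs (disc_hilbert K) \<Longrightarrow> ip (disc_hilbert K) f k = f l"
    "(hnorm (disc_hilbert K) k)\<^sup>2 \<le> 1 / (1 - (cmod l)\<^sup>2)"
    "\<And>f. f \<in> vecs (disc_hilbert K) \<Longrightarrow> ip (disc_hilbert K) (mult_z f) k = l * ip (disc_hilbert K) f k"
proof -
  interpret shift_space "disc_hilbert K" disc_coeff K mult_z by (rule shift_space_disc)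
  have l1: "cmod l < 1" using l by simp
  obtain k where k: "k \<in> vecs (disc_hilbert K)" "\<And>m. disc_coeff k m = cnj l ^ m / of_real (weight K m)"
    "\<And>f. f \<in> vecs (disc_hilbert K) \<Longrightarrow> (\<lambda>m. disc_coeff f m * l ^ m) sums ip (disc_hilbert K) f k"
    "(hnorm (disc_hilbert K) k)\<^sup>2 \<le> 1 / (1 - (cmod l)\<^sup>2)"
    "\<And>f. f \<in> vecs (disc_hilbert K) \<Longrightarrow> ip (disc_hilbert K) (mult_z f) k = l * ip (disc_hilbert K) f k"
    by (rule eval_kernel[OF l1]) (rule that; blast)
  have "ip (disc_hilbert K) f k = f l" if f: "f \<in> vecs (disc_hilbert K)" for f
    using k(3)[OF f] disc_sums[of f l] f l sums_unique2 by (auto simp: vecs_disc_iff)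
  then show thesis using that k by blast
qed

text \<open>Point evaluations are bounded uniformly on a small circle around \<open>l\<close>, by
  the norms of the kernels; Cauchy's inequality transfers this to derivatives.\<close>

lemma higher_deriv_bounded:
  assumes l: "l \<in> ball 0 1"
  obtains C where "\<And>f. f \<in> vecs (disc_hilbert K) \<Longrightarrow> cmod ((deriv ^^ n) f l) \<le> C * hnorm (disc_hilbert K) f"
proof -
  interpret shift_space "disc_hilbert K" disc_coeff K mult_z by (rule shift_space_disc)
  \<comment> \<open>Half the distance from \<open>l\<close> to the unit circle; \<open>s\<close>
    then bounds the modulus on \<open>cball l r\<close> and is below 1.\<close>
  define r where "r = (1 - cmod l) / 2"
  define s where "s = cmod l + r"
  have r: "r > 0" and s: "0 \<le> s" "s < 1" using l by (auto simp: r_def s_def field_simps)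
  have inball: "cball l r \<subseteq> ball 0 1"
  proof
    fix z assume "z \<in> cball l r"
    then have "cmod z \<le> s" using norm_triangle_ineq2[of z l] by (simp add: s_def dist_norm norm_minus_commute)
    then show "z \<in> ball 0 1" using s by simp
  qed
  define D where "D = sqrt (1 / (1 - s\<^sup>2))"
  have "cmod ((deriv ^^ n) f l) \<le> (fact n * D / r ^ n) * hnorm (disc_hilbert K) f"
    if f: "f \<in> vecs (disc_hilbert K)" for f
  proof -
    have hol: "f holomorphic_on ball 0 1" using f by (simp add: vecs_disc_iff)
    have "cmod (f z) \<le> D * hnorm (disc_hilbert K) f" if z: "cmod (l - z) = r" for z
    proof -
      have zb: "z \<in> ball 0 1" using inball z by (auto simp: dist_norm)
      have zs: "cmod z \<le> s" using z norm_triangle_ineq2[of z l] by (simp add: s_def norm_minus_commute)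
      obtain k where k: "k \<in> vecs (disc_hilbert K)"
        "\<And>f. f \<in> vecs (disc_hilbert K) \<Longrightarrow> ip (disc_hilbert K) f k = f z"
        "(hnorm (disc_hilbert K) k)\<^sup>2 \<le> 1 / (1 - (cmod z)\<^sup>2)"
        by (rule disc_eval_kernel[OF zb]) (rule that; blast)
      have "(cmod z)\<^sup>2 \<le> s\<^sup>2" "s\<^sup>2 < 1" using zs s by (auto intro: power_mono simp: abs_square_less_1)
      then have "1 / (1 - (cmod z)\<^sup>2) \<le> 1 / (1 - s\<^sup>2)" by (intro divide_left_mono) auto
      then have "hnorm (disc_hilbert K) k \<le> D" unfolding D_def using k(3) by (intro real_le_rsqrt) linarith
      moreover have "cmod (f z) \<le> hnorm (disc_hilbert K) f * hnorm (disc_hilbert K) k"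
        using Cauchy_Schwarz[OF f k(1)] k(2)[OF f] by simp
      ultimately show ?thesis
        using mult_left_mono[of _ D "hnorm (disc_hilbert K) f"] hnorm_nonneg[OF f] by (force simp: mult.commute)
    qed
    note bd = this
    have h1: "f holomorphic_on ball l r"
      using hol by (rule holomorphic_on_subset) (use inball ball_subset_cball in blast)
    have h2: "continuous_on (cball l r) f"
      by (rule holomorphic_on_imp_continuous_on[OF holomorphic_on_subset[OF hol inball]])
    have "cmod ((deriv ^^ n) f l) \<le> fact n * (D * hnorm (disc_hilbert K) f) / r ^ n"
      by (rule Cauchy_inequality[OF h1 h2 r bd])
    then show ?thesis by (simp add: field_simps)
  qed
  then show thesis by (rule that)
qed

text \<open>
  If \<open>(z - l) S\<close> were dense in \<open>S\<close>, all derivatives at \<open>l\<close> would vanish on \<open>S\<close>, one order after the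
  other.
\<close>

lemma codimension_at_point:
  assumes S: "closed_subspace (disc_hilbert K) S" "mult_z ` S \<subseteq> S" and ne: "f \<in> S" "f \<noteq> 0" and l: "l \<in> ball 0 1"
  obtains e where "e \<in> S" "e \<noteq> 0" "\<And>s. s \<in> S \<Longrightarrow> ip (disc_hilbert K) (mult_z s - cscale l s) e = 0"
proof -
  interpret shift_space "disc_hilbert K" disc_coeff K mult_z by (rule shift_space_disc)
  let ?H = "disc_hilbert K"
  have inv: "invariant S" using S by (auto simp: invariant_def)
  note Sv = invariantD(2)[OF inv]
  define T where "T = (\<lambda>s. mult_z s - cscale l s) ` S"
  have TS: "T \<subseteq> S" unfolding T_def
    using invariantD(3)[OF inv] invariantD(7)[OF inv] invariantD(6)[OF inv] by auto
  have Tv: "T \<subseteq> vecs ?H" using TS Sv by blast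
  have "cfun.subspace T"
    unfolding cfun.subspace_def
  proof (intro conjI ballI allI)
    show "0 \<in> T" unfolding T_def
      by (rule image_eqI[of _ _ 0]) (auto simp: mult_z_def fun_eq_iff invariantD(4)[OF inv])
  next
    fix x y assume "x \<in> T" "y \<in> T"
    then obtain s t where st: "s \<in> S" "t \<in> S" and xy: "x = mult_z s - cscale l s" "y = mult_z t - cscale l t"
      by (auto simp: T_def)
    have e: "x + y = mult_z (s + t) - cscale l (s + t)"
      by (rule ext) (simp add: xy mult_z_def algebra_simps)
    have "s + t \<in> S" by (rule invariantD(5)[OF inv st])
    then show "x + y \<in> T" unfolding T_def e by (rule imageI)
  next
    fix k x assume "x \<in> T"
    then obtain s where s: "s \<in> S" and x: "x = mult_z s - cscale l s" by (auto simp: T_def)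
    have e: "cscale k x = mult_z (cscale k s) - cscale l (cscale k s)"
      unfolding x mult_z_def fun_diff_def by (rule ext) (simp only: right_diff_distrib mult.left_commute)
    have "cscale k s \<in> S" by (rule invariantD(7)[OF inv s])
    then show "cscale k x \<in> T" unfolding T_def e by (rule imageI)
  qed
  note clT = closed_subspace_hclosure[OF this Tv]
  have sub: "hclosure ?H T \<subseteq> S"
  proof -
    have "hclosure ?H T \<subseteq> hclosure ?H S" using TS unfolding hclosure_def by blast
    then show ?thesis using S(1) by (simp add: closed_subspace_def)
  qed
  have "\<exists>s\<in>S. s \<notin> hclosure ?H T"
  proof (rule ccontr)
    assume "\<not> ?thesis"
    then have dense: "\<And>s. s \<in> S \<Longrightarrow> s \<in> hclosure ?H T" by blast
    have hol: "s holomorphic_on ball 0 1" if "s \<in> vecs ?H" for s using that by (simp add: vecs_disc_iff)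
    have "\<forall>s\<in>S. (deriv ^^ n) s l = 0" for n
    proof (induction n rule: less_induct)
      case (less n)
      \<comment> \<open>Leibniz' rule for \<open>(z - l) u\<close>: the term with the
        undifferentiated factor vanishes at \<open>l\<close>, the others contain derivatives of
        \<open>u\<close> of order below \<open>n\<close>.\<close>
      have T0: "(deriv ^^ n) t l = 0" if t: "t \<in> T" for t
      proof -
        obtain u where u: "u \<in> S" "t = mult_z u - cscale l u" using t by (auto simp: T_def)
        have "t = (\<lambda>z. (z - l) * u z)" by (auto simp: u(2) mult_z_def algebra_simps)
        then have "(deriv ^^ n) t l
            = (\<Sum>i = 0..n. of_nat (n choose i) * (deriv ^^ i) (\<lambda>z. z - l) l * (deriv ^^ (n - i)) u l)"
          using higher_deriv_mult[OF holomorphic_on_diff[OF holomorphic_on_ident holomorphic_on_const]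
              hol[OF Sv[OF u(1)]] open_ball l, of n l] by simp
        also have "\<dots> = 0"
        proof (rule sum.neutral, rule ballI)
          fix i assume i: "i \<in> {0..n}"
          show "of_nat (n choose i) * (deriv ^^ i) (\<lambda>z. z - l) l * (deriv ^^ (n - i)) u l = 0"
          proof (cases i)
            case (Suc j)
            then have "n - i < n" using i by auto
            then show ?thesis using less.IH u(1) by simp
          qed simp
        qed
        finally show ?thesis .
      qed
      obtain C where C: "\<And>f. f \<in> vecs ?H \<Longrightarrow> cmod ((deriv ^^ n) f l) \<le> C * hnorm ?H f"
        by (rule higher_deriv_bounded[OF l]) (rule that; blast)
      show ?case
      proof
        fix s assume s: "s \<in> S"
        \<comment> \<open>The derivative at \<open>l\<close> is a bounded functional that vanishes
          on the dense set \<open>T\<close>.\<close>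
        have "cmod ((deriv ^^ n) s l) \<le> e" if e: "e > 0" for e
        proof -
          have "e / (\<bar>C\<bar> + 1) > 0" using e by (simp add: add_nonneg_pos)
          then obtain t where t: "t \<in> T" "hnorm ?H (s - t) < e / (\<bar>C\<bar> + 1)"
            by (rule hclosureE[OF dense[OF s]])
          have tv: "t \<in> vecs ?H" and st: "s - t \<in> vecs ?H" using t(1) Tv Sv[OF s] by auto
          have "(deriv ^^ n) (s - t) l = (deriv ^^ n) s l - (deriv ^^ n) t l"
            unfolding fun_diff_def
            by (rule higher_deriv_diff[OF hol[OF Sv[OF s]] hol[OF tv] open_ball l])
          then have "cmod ((deriv ^^ n) s l) \<le> C * hnorm ?H (s - t)"
            using C[OF st] T0[OF t(1)] by simp
          also have "\<dots> \<le> (\<bar>C\<bar> + 1) * hnorm ?H (s - t)"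
            by (intro mult_right_mono hnorm_nonneg st) simp
          also have "\<dots> \<le> (\<bar>C\<bar> + 1) * (e / (\<bar>C\<bar> + 1))"
            using t(2) by (intro mult_left_mono) auto
          also have "\<dots> = e" by (simp add: add_nonneg_pos)
          finally show ?thesis .
        qed
        then have "cmod ((deriv ^^ n) s l) \<le> 0" by (rule field_le_epsilon[where y = 0, simplified])
        then show "(deriv ^^ n) s l = 0" by simp
      qed
    qed
    then have d: "(deriv ^^ n) f l = 0" for n using ne(1) by blast
    have "f z = 0" for z
    proof (cases "z \<in> ball 0 1")
      case True
      show ?thesis
        by (rule holomorphic_fun_eq_0_on_connected[OF hol[OF Sv[OF ne(1)]] open_ball _ d l True]) simp
    next
      case False
      then show ?thesis using Sv[OF ne(1)] by (simp add: vecs_disc_iff)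
    qed
    then show False using ne(2) by (auto simp: fun_eq_iff)
  qed
  then obtain s where s: "s \<in> S" "s \<notin> hclosure ?H T" by blast
  obtain p where p: "p \<in> hclosure ?H T" "s - p \<in> orth_compl ?H (hclosure ?H T)"
    by (rule projection[OF clT Sv[OF s(1)]])
  define e where "e = s - p"
  have eS: "e \<in> S" using s(1) p(1) sub invariantD(6)[OF inv] by (auto simp: e_def)
  have "e \<noteq> 0" using s(2) p(1) by (auto simp: e_def)
  moreover have "ip ?H (mult_z x - cscale l x) e = 0" if x: "x \<in> S" for x
  proof -
    have "mult_z x - cscale l x \<in> T" using x by (simp add: T_def)
    then have xT: "mult_z x - cscale l x \<in> hclosure ?H T" using hclosure_superset[OF Tv] by blast
    then have "ip ?H e (mult_z x - cscale l x) = 0" using p(2) by (simp add: orth_compl_def e_def)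
    then show ?thesis using ip_eq_0_sym[of e "mult_z x - cscale l x"] Sv[OF eS] xT sub Sv by blast
  qed
  ultimately show thesis using that eS by blast
qed

section \<open>Power series on the polydisc and elementary tensors\<close>

text \<open>A finite set of multi-indices lies in the box of its projections, over which the sum of
  products factorizes.\<close>

lemma prod_summable_nonneg:
  fixes f :: "'n::finite \<Rightarrow> 'b \<Rightarrow> real"
  assumes nn: "\<And>i x. 0 \<le> f i x" and s: "\<And>i. f i summable_on UNIV"
  shows "(\<lambda>\<alpha>. \<Prod>i\<in>UNIV. f i (\<alpha> i)) summable_on UNIV"
proof (rule nonneg_bounded_partial_sums_imp_summable_on[where C = "\<Prod>i\<in>UNIV. infsum (f i) UNIV"])
  show "0 \<le> (\<Prod>i\<in>UNIV. f i (\<alpha> i))" for \<alpha> by (intro prod_nonneg) (simp add: nn)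
  have "(\<Sum>\<alpha>\<in>P. \<Prod>i\<in>UNIV. f i (\<alpha> i)) \<le> (\<Prod>i\<in>UNIV. infsum (f i) UNIV)" if P: "finite P" for P
  proof -
    define B where "B i = (\<lambda>\<alpha>. \<alpha> i) ` P" for i
    have B: "finite (B i)" for i using P by (simp add: B_def)
    have "(\<Sum>\<alpha>\<in>P. \<Prod>i\<in>UNIV. f i (\<alpha> i)) \<le> (\<Sum>\<alpha>\<in>Pi\<^sub>E UNIV B. \<Prod>i\<in>UNIV. f i (\<alpha> i))"
    proof (rule sum_mono2)
      show "finite (Pi\<^sub>E UNIV B)" by (intro finite_PiE) (auto simp: B)
      show "P \<subseteq> Pi\<^sub>E UNIV B" by (auto simp: B_def)
    qed (intro prod_nonneg, simp add: nn)
    also have "\<dots> = (\<Prod>i\<in>UNIV. \<Sum>x\<in>B i. f i x)"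
      by (rule prod_sum_PiE[symmetric]) (auto simp: B)
    also have "\<dots> \<le> (\<Prod>i\<in>UNIV. infsum (f i) UNIV)"
      by (intro prod_mono conjI sum_nonneg finite_sum_le_infsum s B) (auto simp: nn)
    finally show ?thesis .
  qed
  then show "\<forall>\<^sub>F P in finite_subsets_at_top UNIV. (\<Sum>\<alpha>\<in>P. \<Prod>i\<in>UNIV. f i (\<alpha> i)) \<le> (\<Prod>i\<in>UNIV. infsum (f i) UNIV)"
    by (auto simp: eventually_finite_subsets_at_top intro!: exI[of _ "{}"])
qed

lemma has_sum_prod:
  fixes f :: "'n::finite \<Rightarrow> 'b \<Rightarrow> complex"
  assumes s: "\<And>i. f i summable_on UNIV"
  shows "((\<lambda>\<alpha>. \<Prod>i\<in>UNIV. f i (\<alpha> i)) has_sum (\<Prod>i\<in>UNIV. infsum (f i) UNIV)) UNIV"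
proof -
  have a: "(\<lambda>x. norm (f i x)) summable_on UNIV" for i
    using s[of i] summable_on_iff_abs_summable_on_complex by blast
  have "(\<lambda>\<alpha>. norm (\<Prod>i\<in>UNIV. f i (\<alpha> i))) summable_on UNIV"
    using prod_summable_nonneg[of "\<lambda>i x. norm (f i x)", OF norm_ge_zero a] by (simp add: prod_norm)
  then have S: "(\<lambda>\<alpha>. \<Prod>i\<in>UNIV. f i (\<alpha> i)) summable_on UNIV" by (rule abs_summable_summable)
  have "infsum (\<lambda>\<alpha>. \<Prod>i\<in>UNIV. f i (\<alpha> i)) (Pi\<^sub>E UNIV (\<lambda>_. UNIV)) = (\<Prod>i\<in>UNIV. infsum (f i) UNIV)"
    by (rule infsum_prod_PiE_abs) (use a in auto)
  then have I: "(\<Sum>\<^sub>\<infinity>\<alpha>. \<Prod>i\<in>UNIV. f i (\<alpha> i)) = (\<Prod>i\<in>UNIV. infsum (f i) UNIV)" by simp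
  show ?thesis using has_sum_infsum[OF S] unfolding I .
qed

lemma power_sums_0_imp_coeff_0:
  fixes a :: "nat \<Rightarrow> complex"
  assumes "\<And>z. cmod z < 1 \<Longrightarrow> (\<lambda>n. a n * z ^ n) sums 0"
  shows "a n = 0"
proof -
  have "conv_radius a \<ge> 1"
  proof (rule conv_radius_geI_ex')
    fix r :: real assume "0 < r" "ereal r < 1"
    then show "summable (\<lambda>n. a n * of_real r ^ n)"
      using sums_summable[OF assms[of "of_real r"]] by (simp add: one_ereal_def)
  qed
  then have "fps_conv_radius (Abs_fps a) > 0"
    by (auto simp: fps_conv_radius_def intro: less_le_trans[of 0 1])
  then have "eval_fps (Abs_fps a) has_fps_expansion Abs_fps a" by (rule eval_fps_has_fps_expansion)
  moreover have ev: "\<forall>\<^sub>F z in nhds 0. eval_fps (Abs_fps a) z = 0"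
    using eventually_nhds_in_open[of "ball 0 1" "0::complex"]
    by (auto elim!: eventually_mono simp: eval_fps_def sums_unique[OF assms, symmetric])
  ultimately have "(\<lambda>_. 0) has_fps_expansion Abs_fps a" using has_fps_expansion_cong[OF ev refl] by blast
  then have "Abs_fps a = 0"
    using fps_expansion_eqI has_fps_expansion_0 by metis
  then show ?thesis by (simp add: fps_eq_iff)
qed

text \<open>Variables are separated one at a time: once those in \<open>A\<close> are done, the sum
  over all indices that agree with \<open>\<beta>\<close> on \<open>A\<close> vanishes identically
  in the remaining variables. This uniqueness is what makes \<open>power_series_coeff\<close> well
  defined.\<close>

lemma has_sum_power_series_0:
  fixes d :: "('n::finite \<Rightarrow> nat) \<Rightarrow> complex"
  assumes "\<And>z. z \<in> polydisc \<Longrightarrow> ((\<lambda>\<alpha>. d \<alpha> * monomial \<alpha> z) has_sum 0) UNIV"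
  shows "d \<beta> = 0"
proof -
  have "\<forall>\<beta>. \<forall>z\<in>polydisc. ((\<lambda>\<alpha>. d \<alpha> * (\<Prod>j\<in>-A. (z $ j) ^ \<alpha> j)) has_sum 0) {\<alpha>. \<forall>j\<in>A. \<alpha> j = \<beta> j}" for A
  proof (induction A rule: infinite_finite_induct)
    case (infinite A)
    then show ?case by simp
  next
    case empty
    show ?case using assms by (simp add: monomial_def)
  next
    case (insert i A)
    show ?case
    proof (intro allI ballI)
      fix \<beta> :: "'n \<Rightarrow> nat" and z :: "complex ^ 'n" assume z: "z \<in> polydisc"
      define S where "S = {\<alpha>. \<forall>j\<in>A. \<alpha> j = \<beta> j}"
      define T where "T k = {\<alpha> \<in> S. \<alpha> i = k}" for k
      define g where "g \<alpha> = d \<alpha> * (\<Prod>j\<in>-insert i A. (z $ j) ^ \<alpha> j)" for \<alpha>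
      have line: "((\<lambda>\<alpha>. g \<alpha> * x ^ \<alpha> i) has_sum 0) S" if x: "cmod x < 1" for x
      proof -
        define y where "y = (\<chi> j. if j = i then x else z $ j)"
        have "y \<in> polydisc" using z x by (auto simp: polydisc_def y_def)
        moreover have "d \<alpha> * (\<Prod>j\<in>-A. (y $ j) ^ \<alpha> j) = g \<alpha> * x ^ \<alpha> i" for \<alpha>
        proof -
          have "-A = insert i (-insert i A)" using insert.hyps by auto
          then have "(\<Prod>j\<in>-A. (y $ j) ^ \<alpha> j) = x ^ \<alpha> i * (\<Prod>j\<in>-insert i A. (y $ j) ^ \<alpha> j)"
            by (simp add: y_def)
          moreover have "(\<Prod>j\<in>-insert i A. (y $ j) ^ \<alpha> j) = (\<Prod>j\<in>-insert i A. (z $ j) ^ \<alpha> j)"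
            by (rule prod.cong) (auto simp: y_def)
          ultimately show ?thesis by (simp add: g_def)
        qed
        moreover have "((\<lambda>\<alpha>. d \<alpha> * (\<Prod>j\<in>-A. (y $ j) ^ \<alpha> j)) has_sum 0) S"
          using insert.IH \<open>y \<in> polydisc\<close> unfolding S_def by blast
        ultimately show ?thesis by simp
      qed
      \<comment> \<open>At \<open>x = 1/2\<close> the factor \<open>x ^ \<alpha> i\<close> is a
        nonzero constant on the slice \<open>T k\<close>, so it can be divided out.\<close>
      have gs: "g summable_on T k" for k
      proof -
        have "(\<lambda>\<alpha>. g \<alpha> * (1/2) ^ \<alpha> i) summable_on S"
          using line[of "1/2"] by (auto simp: summable_on_def)
        then have "(\<lambda>\<alpha>. g \<alpha> * (1/2) ^ \<alpha> i) summable_on T k"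
          by (rule summable_on_subset_banach) (auto simp: T_def)
        moreover have "(\<lambda>\<alpha>. g \<alpha> * (1/2) ^ \<alpha> i) summable_on T k \<longleftrightarrow> (\<lambda>\<alpha>. g \<alpha> * (1/2) ^ k) summable_on T k"
          by (rule summable_on_cong) (simp add: T_def)
        ultimately have h: "(\<lambda>\<alpha>. g \<alpha> * (1/2) ^ k) summable_on T k" by simp
        have s: "(\<lambda>\<alpha>. g \<alpha> * (1/2) ^ k * 2 ^ k) summable_on T k"
          by (rule summable_on_cmult_left[OF h])
        have one: "(1/2) ^ k * 2 ^ k = (1 :: complex)" by (simp flip: power_mult_distrib)
        show ?thesis using s by (simp only: mult.assoc one mult_1_right)
      qed
      \<comment> \<open>Grouping by the exponent of the \<open>i\<close>-th variable leaves a power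
        series in \<open>x\<close> alone that vanishes on the disc.\<close>
      have "(\<lambda>k. infsum g (T k) * x ^ k) sums 0" if x: "cmod x < 1" for x
      proof -
        have sum1: "((\<lambda>(k, \<alpha>). g \<alpha> * x ^ \<alpha> i) has_sum 0) (SIGMA k:UNIV. T k)"
        proof (rule has_sum_reindex_bij_witness[where i = "\<lambda>\<alpha>. (\<alpha> i, \<alpha>)" and j = snd, THEN iffD2, OF _ _ _ _ _ _ line[OF x]])
        qed (auto simp: T_def)
        have sum2: "((\<lambda>\<alpha>. g \<alpha> * x ^ \<alpha> i) has_sum (infsum g (T k) * x ^ k)) (T k)" for k
        proof -
          have "((\<lambda>\<alpha>. g \<alpha> * x ^ k) has_sum (infsum g (T k) * x ^ k)) (T k)"
            by (intro has_sum_cmult_left has_sum_infsum gs)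
          then show ?thesis by (rule has_sum_cong[THEN iffD1, rotated]) (simp add: T_def)
        qed
        have "((\<lambda>k. infsum g (T k) * x ^ k) has_sum 0) UNIV"
          by (rule has_sum_SigmaD[OF sum1]) (simp add: sum2)
        then show ?thesis by (rule has_sum_imp_sums)
      qed
      then have "infsum g (T (\<beta> i)) = 0" by (rule power_sums_0_imp_coeff_0)
      then have "(g has_sum 0) (T (\<beta> i))" using has_sum_infsum[OF gs, of "\<beta> i"] by simp
      moreover have "T (\<beta> i) = {\<alpha>. \<forall>j\<in>insert i A. \<alpha> j = \<beta> j}" by (auto simp: T_def S_def)
      ultimately show "((\<lambda>\<alpha>. d \<alpha> * (\<Prod>j\<in>-insert i A. (z $ j) ^ \<alpha> j)) has_sum 0) {\<alpha>. \<forall>j\<in>insert i A. \<alpha> j = \<beta> j}"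
        by (simp add: g_def[abs_def])
    qed
  qed
  from this[of UNIV, THEN spec[of _ \<beta>]] have "\<forall>z\<in>(polydisc :: (complex ^ 'n) set). (d has_sum 0) {\<beta>}"
    by (simp add: fun_eq_iff[symmetric])
  moreover have "(0 :: complex ^ 'n) \<in> polydisc" by (simp add: polydisc_def)
  ultimately have "(d has_sum 0) {\<beta>}" by blast
  moreover have "(d has_sum d \<beta>) {\<beta>}" using has_sum_finite[of "{\<beta>}" d] by simp
  ultimately show ?thesis using has_sum_unique by blast
qed

lemma power_series_coeff_eqI:
  assumes a: "has_power_series f a"
  shows "power_series_coeff f = a"
  unfolding power_series_coeff_def
proof (rule the_equality)
  show "has_power_series f a" by (rule a)
  fix b assume b: "has_power_series f b"
  have "b \<alpha> - a \<alpha> = 0" for \<alpha>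
  proof (rule has_sum_power_series_0)
    fix z :: "complex ^ 'a" assume z: "z \<in> polydisc"
    have "((\<lambda>\<alpha>. b \<alpha> * monomial \<alpha> z + (-1) * (a \<alpha> * monomial \<alpha> z)) has_sum (f z + (-1) * f z)) UNIV"
      using a b z by (intro has_sum_add has_sum_cmult_right) (auto simp: has_power_series_def)
    then show "((\<lambda>\<alpha>. (b \<alpha> - a \<alpha>) * monomial \<alpha> z) has_sum 0) UNIV" by (simp add: algebra_simps)
  qed
  then show "b = a" by (simp add: fun_eq_iff)
qed

lemma tensor_weight_ge1: "1 \<le> tensor_weight K \<alpha>"
  unfolding tensor_weight_def by (intro prod_ge_1 weight_ge1)

lemma tensor_weight_nonneg: "0 \<le> tensor_weight K \<alpha>"
  using tensor_weight_ge1[of K \<alpha>] by linarith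

lemma vecs_tensorD:
  assumes "f \<in> vecs (tensor_hilbert K)"
  shows "has_power_series f (power_series_coeff f)" "z \<notin> polydisc \<Longrightarrow> f z = 0"
    "(\<lambda>\<alpha>. tensor_weight K \<alpha> * (cmod (power_series_coeff f \<alpha>))\<^sup>2) summable_on UNIV"
  using assms power_series_coeff_eqI[of f] by (auto simp: tensor_hilbert_def)

lemma vecs_tensorI:
  assumes "has_power_series f a" "\<And>z. z \<notin> polydisc \<Longrightarrow> f z = 0"
    "(\<lambda>\<alpha>. tensor_weight K \<alpha> * (cmod (a \<alpha>))\<^sup>2) summable_on UNIV"
  shows "f \<in> vecs (tensor_hilbert K)" "power_series_coeff f = a"
  using assms power_series_coeff_eqI[of f a] by (auto simp: tensor_hilbert_def)

text \<open>The monomials at a point of the polydisc are square summable, as a product of geometric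
  series, and the weights are at least 1; hence every square summable coefficient family defines a
  function.\<close>

lemma weighted_summable_imp_power_series:
  assumes a: "(\<lambda>\<alpha>. tensor_weight K \<alpha> * (cmod (a \<alpha>))\<^sup>2) summable_on UNIV" and z: "z \<in> polydisc"
  shows "(\<lambda>\<alpha>. a \<alpha> * monomial \<alpha> z) summable_on UNIV"
proof -
  have m: "(\<lambda>\<alpha>. (cmod (monomial \<alpha> z))\<^sup>2) summable_on UNIV"
  proof -
    have "(\<lambda>n. ((cmod (z $ i))\<^sup>2) ^ n) summable_on UNIV" for i
    proof -
      have "(cmod (z $ i))\<^sup>2 < 1" using z by (simp add: polydisc_def abs_square_less_1)
      then have "summable (\<lambda>n. ((cmod (z $ i))\<^sup>2) ^ n)" by (intro summable_geometric) simp
      then show ?thesis by (subst summable_on_UNIV_nonneg_real_iff) auto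
    qed
    then have "(\<lambda>\<alpha>. \<Prod>i\<in>UNIV. ((cmod (z $ i))\<^sup>2) ^ \<alpha> i) summable_on UNIV"
      by (intro prod_summable_nonneg) auto
    moreover have "(\<Prod>i\<in>UNIV. ((cmod (z $ i))\<^sup>2) ^ \<alpha> i) = (cmod (monomial \<alpha> z))\<^sup>2" for \<alpha>
      by (simp add: monomial_def norm_power prod_norm[symmetric] prod_power_distrib power_mult[symmetric] mult.commute)
    ultimately show ?thesis by simp
  qed
  have "(\<lambda>\<alpha>. norm (a \<alpha> * monomial \<alpha> z)) summable_on UNIV"
  proof (rule Infinite_Sum.abs_summable_on_comparison_test')
    show "(\<lambda>\<alpha>. tensor_weight K \<alpha> * (cmod (a \<alpha>))\<^sup>2 + (cmod (monomial \<alpha> z))\<^sup>2) summable_on UNIV"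
      by (intro summable_on_add a m)
    fix \<alpha>
    have "cmod (a \<alpha>) * cmod (monomial \<alpha> z) \<le> (cmod (a \<alpha>))\<^sup>2 + (cmod (monomial \<alpha> z))\<^sup>2"
      using sum_squares_bound[of "cmod (a \<alpha>)" "cmod (monomial \<alpha> z)"]
        mult_nonneg_nonneg[OF norm_ge_zero[of "a \<alpha>"] norm_ge_zero[of "monomial \<alpha> z"]] by linarith
    moreover have "(cmod (a \<alpha>))\<^sup>2 \<le> tensor_weight K \<alpha> * (cmod (a \<alpha>))\<^sup>2"
      using mult_right_mono[OF tensor_weight_ge1[of K \<alpha>], of "(cmod (a \<alpha>))\<^sup>2"] by simp
    ultimately show "norm (a \<alpha> * monomial \<alpha> z) \<le> tensor_weight K \<alpha> * (cmod (a \<alpha>))\<^sup>2 + (cmod (monomial \<alpha> z))\<^sup>2"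
      by (simp add: norm_mult)
  qed
  then show ?thesis by (rule abs_summable_summable)
qed

lemma weighted_space_tensor:
  fixes K :: "'n::finite \<Rightarrow> disc_space"
  shows "weighted_space (tensor_hilbert K) power_series_coeff (tensor_weight K)"
proof
  let ?H = "tensor_hilbert K"
  show "1 \<le> tensor_weight K i" for i by (rule tensor_weight_ge1)
  have add: "f + g \<in> vecs ?H \<and> power_series_coeff (f + g) = (\<lambda>\<alpha>. power_series_coeff f \<alpha> + power_series_coeff g \<alpha>)"
    if "f \<in> vecs ?H" "g \<in> vecs ?H" for f g
  proof -
    note f = vecs_tensorD[OF that(1)] and g = vecs_tensorD[OF that(2)]
    have "has_power_series (f + g) (\<lambda>\<alpha>. power_series_coeff f \<alpha> + power_series_coeff g \<alpha>)"
      using f(1) g(1) by (auto simp: has_power_series_def distrib_right intro!: has_sum_add)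
    moreover have "(f + g) z = 0" if "z \<notin> polydisc" for z using f(2)[OF that] g(2)[OF that] by simp
    moreover have "(\<lambda>\<alpha>. tensor_weight K \<alpha> * (cmod (power_series_coeff f \<alpha> + power_series_coeff g \<alpha>))\<^sup>2) summable_on UNIV"
      by (rule weighted_summable_add[OF tensor_weight_nonneg f(3) g(3)])
    ultimately show ?thesis using vecs_tensorI by blast
  qed
  have scale: "cscale k f \<in> vecs ?H \<and> power_series_coeff (cscale k f) = (\<lambda>\<alpha>. k * power_series_coeff f \<alpha>)"
    if "f \<in> vecs ?H" for f k
  proof -
    note f = vecs_tensorD[OF that]
    have "has_power_series (cscale k f) (\<lambda>\<alpha>. k * power_series_coeff f \<alpha>)"
      using f(1) by (auto simp: has_power_series_def mult.assoc intro!: has_sum_cmult_right)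
    moreover have "k * f z = 0" if "z \<notin> polydisc" for z using f(2)[OF that] by simp
    moreover have "(\<lambda>\<alpha>. (cmod k)\<^sup>2 * (tensor_weight K \<alpha> * (cmod (power_series_coeff f \<alpha>))\<^sup>2)) summable_on UNIV"
      by (intro summable_on_cmult_right f(3))
    then have "(\<lambda>\<alpha>. tensor_weight K \<alpha> * (cmod (k * power_series_coeff f \<alpha>))\<^sup>2) summable_on UNIV"
      by (simp add: norm_mult power_mult_distrib mult.left_commute)
    ultimately show ?thesis using vecs_tensorI[of "cscale k f"] by blast
  qed
  have "has_power_series (0 :: complex ^ 'n \<Rightarrow> complex) (\<lambda>_. 0)"
    by (simp add: has_power_series_def)
  then have zero: "0 \<in> vecs ?H" by (rule vecs_tensorI(1)) auto
  show "cfun.subspace (vecs ?H)"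
    unfolding cfun.subspace_def using zero add scale by blast
  show "power_series_coeff (f + g) i = power_series_coeff f i + power_series_coeff g i"
    if "f \<in> vecs ?H" "g \<in> vecs ?H" for f g i
    using add[OF that] by simp
  show "power_series_coeff (cscale k f) i = k * power_series_coeff f i" if "f \<in> vecs ?H" for f k i
    using scale[OF that, of k] by simp
  show "f = 0" if f: "f \<in> vecs ?H" and c: "\<And>i. power_series_coeff f i = 0" for f
  proof
    fix z
    show "f z = 0 z"
    proof (cases "z \<in> polydisc")
      case True
      then have "((\<lambda>\<alpha> :: 'n \<Rightarrow> nat. 0 :: complex) has_sum f z) UNIV"
        using vecs_tensorD(1)[OF f, unfolded has_power_series_def, rule_format, OF True] by (simp add: c)
      moreover have "((\<lambda>\<alpha> :: 'n \<Rightarrow> nat. 0 :: complex) has_sum 0) UNIV" by (rule has_sum_0) simp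
      ultimately have "f z = 0" by (rule has_sum_unique)
      then show ?thesis by simp
    next
      case False
      then show ?thesis using vecs_tensorD(2)[OF f] by simp
    qed
  qed
  show "(\<lambda>i. tensor_weight K i * (cmod (power_series_coeff f i))\<^sup>2) summable_on UNIV" if "f \<in> vecs ?H" for f
    by (rule vecs_tensorD(3)[OF that])
  show "\<exists>f\<in>vecs ?H. power_series_coeff f = a"
    if a: "(\<lambda>i. tensor_weight K i * (cmod (a i))\<^sup>2) summable_on UNIV" for a
  proof -
    define f where "f z = (if z \<in> polydisc then \<Sum>\<^sub>\<infinity>\<alpha>. a \<alpha> * monomial \<alpha> z else 0)" for z
    have "has_power_series f a"
      unfolding has_power_series_def f_def
      using weighted_summable_imp_power_series[OF a] by (auto intro: has_sum_infsum)
    then show ?thesis using vecs_tensorI[OF _ _ a, of f] by (auto simp: f_def)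
  qed
  show "ip ?H f g = (\<Sum>\<^sub>\<infinity>i. complex_of_real (tensor_weight K i) * power_series_coeff f i * cnj (power_series_coeff g i))"
    if "f \<in> vecs ?H" "g \<in> vecs ?H" for f g
    by (simp add: tensor_hilbert_def)
qed

section \<open>Elementary tensors\<close>

lemma disc_abs_summable:
  assumes f: "f \<in> vecs (disc_hilbert K)" and z: "z \<in> ball 0 1"
  shows "((\<lambda>m. disc_coeff f m * z ^ m) has_sum f z) UNIV"
proof -
  have hol: "f holomorphic_on ball 0 1" using f by (simp add: vecs_disc_iff)
  have "fps_conv_radius (fps_expansion f 0) \<ge> ereal 1"
    by (rule conv_radius_fps_expansion) (use hol in simp)
  then have s: "summable (\<lambda>m. norm (disc_coeff f m * z ^ m))"
    using z by (intro norm_summable_fps) (auto intro: less_le_trans[of _ "ereal 1"])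
  have "((\<lambda>m. disc_coeff f m * z ^ m) has_sum (\<Sum>m. disc_coeff f m * z ^ m)) UNIV"
    by (rule norm_summable_imp_has_sum[OF s summable_sums[OF summable_norm_cancel[OF s]]])
  then show ?thesis using sums_unique[OF disc_sums[OF hol z]] by simp
qed

lemma elementary_tensor_vecs:
  fixes K :: "'n::finite \<Rightarrow> disc_space"
  assumes f: "\<And>i. f i \<in> vecs (disc_hilbert (K i))"
  shows "elementary_tensor f \<in> vecs (tensor_hilbert K)"
    and "power_series_coeff (elementary_tensor f) = (\<lambda>\<alpha>. \<Prod>i\<in>UNIV. disc_coeff (f i) (\<alpha> i))"
proof -
  have 1: "has_power_series (elementary_tensor f) (\<lambda>\<alpha>. \<Prod>i\<in>UNIV. disc_coeff (f i) (\<alpha> i))"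
    unfolding has_power_series_def
  proof
    fix z :: "complex ^ 'n" assume "z \<in> polydisc"
    then have h: "((\<lambda>m. disc_coeff (f i) m * (z $ i) ^ m) has_sum f i (z $ i)) UNIV" for i
      by (intro disc_abs_summable[OF f]) (simp add: polydisc_def)
    have "((\<lambda>\<alpha>. \<Prod>i\<in>UNIV. disc_coeff (f i) (\<alpha> i) * (z $ i) ^ \<alpha> i)
        has_sum (\<Prod>i\<in>UNIV. infsum (\<lambda>m. disc_coeff (f i) m * (z $ i) ^ m) UNIV)) UNIV"
      using h by (intro has_sum_prod) (auto simp: summable_on_def)
    then show "((\<lambda>\<alpha>. (\<Prod>i\<in>UNIV. disc_coeff (f i) (\<alpha> i)) * monomial \<alpha> z) has_sum elementary_tensor f z) UNIV"
      by (simp add: infsumI[OF h] prod.distrib monomial_def elementary_tensor_def)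
  qed
  have 2: "elementary_tensor f z = 0" if z: "z \<notin> polydisc" for z
  proof -
    obtain i where "z $ i \<notin> ball 0 1" using z unfolding polydisc_def by blast
    then have "f i (z $ i) = 0" using f[of i] by (simp add: vecs_disc_iff)
    then show ?thesis by (auto simp: elementary_tensor_def prod_zero_iff)
  qed
  have "(\<lambda>\<alpha>. \<Prod>i\<in>UNIV. weight (K i) (\<alpha> i) * (cmod (disc_coeff (f i) (\<alpha> i)))\<^sup>2) summable_on UNIV"
    using f by (intro prod_summable_nonneg) (auto simp: vecs_disc_iff less_imp_le[OF weight_pos])
  then have 3: "(\<lambda>\<alpha>. tensor_weight K \<alpha> * (cmod (\<Prod>i\<in>UNIV. disc_coeff (f i) (\<alpha> i)))\<^sup>2) summable_on UNIV"
    by (simp add: tensor_weight_def prod.distrib prod_norm[symmetric] prod_power_distrib)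
  show "elementary_tensor f \<in> vecs (tensor_hilbert K)"
    and "power_series_coeff (elementary_tensor f) = (\<lambda>\<alpha>. \<Prod>i\<in>UNIV. disc_coeff (f i) (\<alpha> i))"
    using vecs_tensorI[OF 1 2 3] by auto
qed

lemma ip_elementary_tensor:
  fixes K :: "'n::finite \<Rightarrow> disc_space"
  assumes f: "\<And>i. f i \<in> vecs (disc_hilbert (K i))" and g: "\<And>i. g i \<in> vecs (disc_hilbert (K i))"
  shows "ip (tensor_hilbert K) (elementary_tensor f) (elementary_tensor g) = (\<Prod>i\<in>UNIV. ip (disc_hilbert (K i)) (f i) (g i))"
proof -
  interpret T: weighted_space "tensor_hilbert K" power_series_coeff "tensor_weight K"
    by (rule weighted_space_tensor)
  let ?s = "\<lambda>i m. complex_of_real (weight (K i) m) * disc_coeff (f i) m * cnj (disc_coeff (g i) m)"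
  have h: "(?s i has_sum ip (disc_hilbert (K i)) (f i) (g i)) UNIV" for i
  proof -
    interpret D: shift_space "disc_hilbert (K i)" disc_coeff "K i" mult_z by (rule shift_space_disc)
    show ?thesis by (rule D.ip_has_sum[OF f g])
  qed
  have "((\<lambda>\<alpha>. \<Prod>i\<in>UNIV. ?s i (\<alpha> i)) has_sum (\<Prod>i\<in>UNIV. infsum (?s i) UNIV)) UNIV"
    using h by (intro has_sum_prod) (auto simp: summable_on_def)
  then have "((\<lambda>\<alpha>. complex_of_real (tensor_weight K \<alpha>) * power_series_coeff (elementary_tensor f) \<alpha>
      * cnj (power_series_coeff (elementary_tensor g) \<alpha>)) has_sum (\<Prod>i\<in>UNIV. ip (disc_hilbert (K i)) (f i) (g i))) UNIV"
    by (simp add: infsumI[OF h] elementary_tensor_vecs(2)[OF f] elementary_tensor_vecs(2)[OF g]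
        tensor_weight_def prod.distrib)
  then show ?thesis
    using T.ip_has_sum[OF elementary_tensor_vecs(1)[OF f] elementary_tensor_vecs(1)[OF g]] has_sum_unique by blast
qed

lemma elementary_tensor_update:
  "elementary_tensor (h(i := x)) z = x (z $ i) * (\<Prod>j\<in>UNIV - {i}. h j (z $ j))"
proof -
  have "(\<Prod>j\<in>UNIV - {i}. (h(i := x)) j (z $ j)) = (\<Prod>j\<in>UNIV - {i}. h j (z $ j))"
    by (rule prod.cong) auto
  then show ?thesis
    unfolding elementary_tensor_def by (subst prod.remove[of _ i]) auto
qed

lemma elementary_tensor_add:
  "elementary_tensor (h(i := x + y)) = elementary_tensor (h(i := x)) + elementary_tensor (h(i := y))"
  by (rule ext) (simp add: elementary_tensor_update distrib_right)

lemma elementary_tensor_diff: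
  "elementary_tensor (h(i := x - y)) = elementary_tensor (h(i := x)) - elementary_tensor (h(i := y))"
  by (rule ext) (simp add: elementary_tensor_update left_diff_distrib)

lemma elementary_tensor_scale:
  "elementary_tensor (h(i := cscale k x)) = cscale k (elementary_tensor (h(i := x)))"
  by (rule ext) (simp add: elementary_tensor_update mult.assoc)

section \<open>Coordinate multiplications\<close>

text \<open>Raising the \<open>i\<close>-th index is injective and misses exactly the indices with
  \<open>i\<close>-th entry 0, where \<open>G\<close> vanishes.\<close>

lemma has_sum_shift_index:
  fixes F G :: "('n \<Rightarrow> nat) \<Rightarrow> 'b::{comm_monoid_add, topological_space}"
  assumes "\<And>\<beta>. G (\<beta>(i := Suc (\<beta> i))) = F \<beta>" "\<And>\<alpha>. \<alpha> i = 0 \<Longrightarrow> G \<alpha> = 0"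
  shows "(F has_sum s) UNIV \<longleftrightarrow> (G has_sum s) UNIV"
proof -
  let ?r = "\<lambda>\<beta>::'n \<Rightarrow> nat. \<beta>(i := Suc (\<beta> i))"
  have inj: "inj ?r"
  proof (rule injI)
    fix \<beta> \<gamma> :: "'n \<Rightarrow> nat" assume e: "?r \<beta> = ?r \<gamma>"
    show "\<beta> = \<gamma>"
    proof
      fix j show "\<beta> j = \<gamma> j" using fun_cong[OF e, of j] by (cases "j = i") auto
    qed
  qed
  have r: "\<alpha> \<in> range ?r" if "\<alpha> i \<noteq> 0" for \<alpha>
    using that by (intro image_eqI[of _ _ "\<alpha>(i := \<alpha> i - 1)"]) auto
  have "(F has_sum s) UNIV \<longleftrightarrow> ((G \<circ> ?r) has_sum s) UNIV" using assms(1) by (simp add: comp_def)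
  also have "\<dots> \<longleftrightarrow> (G has_sum s) (range ?r)" using has_sum_reindex[OF inj, of G s] by simp
  also have "\<dots> \<longleftrightarrow> (G has_sum s) UNIV"
    by (rule has_sum_cong_neutral) (use r assms(2) in auto)
  finally show ?thesis .
qed

lemma tensor_weight_Suc:
  "tensor_weight K (\<beta>(i := Suc (\<beta> i))) = weight (K i) (Suc (\<beta> i)) * (\<Prod>j\<in>UNIV - {i}. weight (K j) (\<beta> j))"
  "tensor_weight K \<beta> = weight (K i) (\<beta> i) * (\<Prod>j\<in>UNIV - {i}. weight (K j) (\<beta> j))"
proof -
  have "(\<Prod>j\<in>UNIV - {i}. weight (K j) ((\<beta>(i := Suc (\<beta> i))) j)) = (\<Prod>j\<in>UNIV - {i}. weight (K j) (\<beta> j))"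
    by (rule prod.cong) auto
  then show "tensor_weight K (\<beta>(i := Suc (\<beta> i))) = weight (K i) (Suc (\<beta> i)) * (\<Prod>j\<in>UNIV - {i}. weight (K j) (\<beta> j))"
    unfolding tensor_weight_def by (subst prod.remove[of _ i]) auto
  show "tensor_weight K \<beta> = weight (K i) (\<beta> i) * (\<Prod>j\<in>UNIV - {i}. weight (K j) (\<beta> j))"
    unfolding tensor_weight_def by (subst prod.remove[of _ i]) auto
qed

lemma monomial_Suc:
  fixes z :: "complex ^ 'n::finite"
  shows "monomial (\<beta>(i := Suc (\<beta> i))) z = z $ i * monomial \<beta> z"
proof -
  have "(\<Prod>j\<in>UNIV - {i}. (z $ j) ^ (\<beta>(i := Suc (\<beta> i))) j) = (\<Prod>j\<in>UNIV - {i}. (z $ j) ^ \<beta> j)"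
    by (rule prod.cong) auto
  then show ?thesis
    unfolding monomial_def by (subst (1 2) prod.remove[of _ i]) (auto simp: mult.assoc)
qed

lemma mult_coord_vecs:
  fixes K :: "'n::finite \<Rightarrow> disc_space"
  assumes F: "F \<in> vecs (tensor_hilbert K)"
  shows "mult_coord i F \<in> vecs (tensor_hilbert K)"
    and "power_series_coeff (mult_coord i F)
      = (\<lambda>\<alpha>. if \<alpha> i = 0 then 0 else power_series_coeff F (\<alpha>(i := \<alpha> i - 1)))"
proof -
  let ?a = "\<lambda>\<alpha>. if \<alpha> i = 0 then 0 else power_series_coeff F (\<alpha>(i := \<alpha> i - 1))"
  note F' = vecs_tensorD[OF F]
  have 1: "has_power_series (mult_coord i F) ?a"
    unfolding has_power_series_def
  proof
    fix z :: "complex ^ 'n" assume "z \<in> polydisc"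
    then have "((\<lambda>\<beta>. z $ i * (power_series_coeff F \<beta> * monomial \<beta> z)) has_sum (z $ i * F z)) UNIV"
      using F'(1) by (intro has_sum_cmult_right) (simp add: has_power_series_def)
    then show "((\<lambda>\<alpha>. ?a \<alpha> * monomial \<alpha> z) has_sum mult_coord i F z) UNIV"
      unfolding mult_coord_def
      by (rule has_sum_shift_index[THEN iffD1, rotated 2]) (auto simp: monomial_Suc)
  qed
  have 2: "mult_coord i F z = 0" if "z \<notin> polydisc" for z
    using F'(2)[OF that] by (simp add: mult_coord_def)
  have "(\<lambda>\<beta>. tensor_weight K (\<beta>(i := Suc (\<beta> i))) * (cmod (power_series_coeff F \<beta>))\<^sup>2) summable_on UNIV"
  proof (rule summable_on_comparison_test)
    show "(\<lambda>\<beta>. 2 * (tensor_weight K \<beta> * (cmod (power_series_coeff F \<beta>))\<^sup>2)) summable_on UNIV"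
      by (intro summable_on_cmult_right F'(3))
    fix \<beta>
    have "weight (K i) (Suc (\<beta> i)) * (\<Prod>j\<in>UNIV - {i}. weight (K j) (\<beta> j))
        \<le> (2 * weight (K i) (\<beta> i)) * (\<Prod>j\<in>UNIV - {i}. weight (K j) (\<beta> j))"
      by (intro mult_right_mono weight_Suc prod_nonneg) (simp add: less_imp_le[OF weight_pos])
    then have "tensor_weight K (\<beta>(i := Suc (\<beta> i))) \<le> 2 * tensor_weight K \<beta>"
      unfolding tensor_weight_Suc(1) tensor_weight_Suc(2)[of K \<beta> i] by (simp only: mult.assoc)
    then show "tensor_weight K (\<beta>(i := Suc (\<beta> i))) * (cmod (power_series_coeff F \<beta>))\<^sup>2
        \<le> 2 * (tensor_weight K \<beta> * (cmod (power_series_coeff F \<beta>))\<^sup>2)"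
      unfolding mult.assoc[symmetric] by (intro mult_right_mono) auto
  qed (simp add: tensor_weight_nonneg)
  then obtain s where "((\<lambda>\<beta>. tensor_weight K (\<beta>(i := Suc (\<beta> i))) * (cmod (power_series_coeff F \<beta>))\<^sup>2) has_sum s) UNIV"
    by (auto simp: summable_on_def)
  then have "((\<lambda>\<alpha>. tensor_weight K \<alpha> * (cmod (?a \<alpha>))\<^sup>2) has_sum s) UNIV"
    by (rule has_sum_shift_index[THEN iffD1, rotated 2]) auto
  then have 3: "(\<lambda>\<alpha>. tensor_weight K \<alpha> * (cmod (?a \<alpha>))\<^sup>2) summable_on UNIV" by (auto simp: summable_on_def)
  show "mult_coord i F \<in> vecs (tensor_hilbert K)" "power_series_coeff (mult_coord i F) = ?a"
    using vecs_tensorI[OF 1 2 3] by auto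
qed

text \<open>The adjoint of a coordinate multiplication acts on one factor. \<open>F\<close> need not
  be a tensor, so coefficients are compared, for which \<open>h'\<close> is first identified with
  the explicit vector of \<open>adjoint_exists\<close>.\<close>

lemma ip_mult_coord_elementary_tensor:
  fixes K :: "'n::finite \<Rightarrow> disc_space"
  assumes F: "F \<in> vecs (tensor_hilbert K)" and h: "\<And>j. h j \<in> vecs (disc_hilbert (K j))"
    and h': "h' \<in> vecs (disc_hilbert (K i))"
      "\<And>f. f \<in> vecs (disc_hilbert (K i)) \<Longrightarrow> ip (disc_hilbert (K i)) (mult_z f) (h i) = ip (disc_hilbert (K i)) f h'"
  shows "ip (tensor_hilbert K) (mult_coord i F) (elementary_tensor h)
    = ip (tensor_hilbert K) F (elementary_tensor (h(i := h')))"
proof -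
  interpret T: weighted_space "tensor_hilbert K" power_series_coeff "tensor_weight K"
    by (rule weighted_space_tensor)
  interpret D: shift_space "disc_hilbert (K i)" disc_coeff "K i" mult_z by (rule shift_space_disc)
  obtain h'' where h'': "h'' \<in> vecs (disc_hilbert (K i))"
    "\<And>m. disc_coeff h'' m = of_real (weight (K i) (Suc m) / weight (K i) m) * disc_coeff (h i) (Suc m)"
    "\<And>f. f \<in> vecs (disc_hilbert (K i)) \<Longrightarrow> ip (disc_hilbert (K i)) (mult_z f) (h i) = ip (disc_hilbert (K i)) f h''"
    by (rule D.adjoint_exists[OF h[of i]]) (rule that; blast)
  have d: "h' - h'' \<in> vecs (disc_hilbert (K i))" using h'(1) h''(1) by (rule D.vecs_closed(3))
  have "ip (disc_hilbert (K i)) (h' - h'') (h' - h'') = 0"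
    using h'(2)[OF d] h''(3)[OF d] D.ip_diff_right[OF h'(1) h''(1) d] by simp
  then have "h' - h'' = 0" using D.ip_definite[OF d] by simp
  then have eq: "h' = h''" using eq_iff_diff_eq_0[of h' h''] by blast
  have h1: "(h(i := h')) j \<in> vecs (disc_hilbert (K j))" for j using h h'(1) by simp
  have c: "power_series_coeff (elementary_tensor h) \<alpha>
      = disc_coeff (h i) (\<alpha> i) * (\<Prod>j\<in>UNIV - {i}. disc_coeff (h j) (\<alpha> j))" for \<alpha>
    unfolding elementary_tensor_vecs(2)[OF h] by (subst prod.remove[of _ i]) auto
  have c': "power_series_coeff (elementary_tensor (h(i := h'))) \<alpha>
      = disc_coeff h' (\<alpha> i) * (\<Prod>j\<in>UNIV - {i}. disc_coeff (h j) (\<alpha> j))" for \<alpha>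
  proof -
    have "(\<Prod>j\<in>UNIV - {i}. disc_coeff ((h(i := h')) j) (\<alpha> j)) = (\<Prod>j\<in>UNIV - {i}. disc_coeff (h j) (\<alpha> j))"
      by (rule prod.cong) auto
    then show ?thesis unfolding elementary_tensor_vecs(2)[OF h1] by (subst prod.remove[of _ i]) auto
  qed
  let ?F = "\<lambda>\<beta>. complex_of_real (tensor_weight K \<beta>) * power_series_coeff F \<beta>
      * cnj (power_series_coeff (elementary_tensor (h(i := h'))) \<beta>)"
  let ?G = "\<lambda>\<alpha>. complex_of_real (tensor_weight K \<alpha>) * power_series_coeff (mult_coord i F) \<alpha>
      * cnj (power_series_coeff (elementary_tensor h) \<alpha>)"
  have "?G (\<beta>(i := Suc (\<beta> i))) = ?F \<beta>" for \<beta>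
  proof -
    have p: "(\<Prod>j\<in>UNIV - {i}. disc_coeff (h j) ((\<beta>(i := Suc (\<beta> i))) j)) = (\<Prod>j\<in>UNIV - {i}. disc_coeff (h j) (\<beta> j))"
      by (rule prod.cong) auto
    have "weight (K i) (\<beta> i) \<noteq> 0" using weight_pos[of "K i" "\<beta> i"] by linarith
    then show ?thesis
      unfolding c c' p mult_coord_vecs(2)[OF F] tensor_weight_Suc(1) tensor_weight_Suc(2)[of K \<beta> i]
      unfolding eq h''(2) by simp
  qed
  then have "(?F has_sum s) UNIV \<longleftrightarrow> (?G has_sum s) UNIV" for s
    by (rule has_sum_shift_index) (simp add: mult_coord_vecs(2)[OF F])
  then show ?thesis
    using T.ip_has_sum[OF F elementary_tensor_vecs(1)[OF h1]]
      T.ip_has_sum[OF mult_coord_vecs(1)[OF F] elementary_tensor_vecs(1)[OF h]] has_sum_unique by blast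
qed

lemma mult_coord_power: "(mult_coord i ^^ m) g = (\<lambda>z. (z $ i) ^ m * g z)"
  by (induction m) (auto simp: mult_coord_def mult.assoc)

lemma tuple_power_mult_coord: "tuple_power mult_coord k g = (\<lambda>z. monomial k z * g z)"
proof -
  interpret comp_fun_commute "\<lambda>i. mult_coord i ^^ k i"
    by unfold_locales (auto simp: mult_coord_power fun_eq_iff)
  have "Finite_Set.fold (\<lambda>i. mult_coord i ^^ k i) g A = (\<lambda>z. (\<Prod>i\<in>A. (z $ i) ^ k i) * g z)" if "finite A" for A
    using that
  proof (induction A rule: finite_induct)
    case (insert x A)
    show ?case
      unfolding fold_insert[OF insert.hyps] insert.IH unfolding mult_coord_power using insert.hyps by (simp add: mult.assoc)
  qed simp
  then show ?thesis by (simp add: tuple_power_def monomial_def)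
qed

section \<open>The multiplicity\<close>

lemma disc_cyclic_vector:
  assumes "closed_subspace (disc_hilbert K) S" "mult_z ` S \<subseteq> S"
  obtains \<phi> where "\<phi> \<in> S" "\<And>p. (mult_z ^^ p) \<phi> \<in> S"
    "S \<subseteq> hclosure (disc_hilbert K) (cfun.span (range (\<lambda>p. (mult_z ^^ p) \<phi>)))"
proof -
  interpret shift_space "disc_hilbert K" disc_coeff K mult_z by (rule shift_space_disc)
  have inv: "invariant S" using assms by (auto simp: invariant_def)
  obtain \<phi> where \<phi>: "\<phi> \<in> S"
    "\<And>x. x \<in> S \<Longrightarrow> (\<And>p. ip (disc_hilbert K) x ((mult_z ^^ p) \<phi>) = 0) \<Longrightarrow> x = 0"
    by (rule cyclic_vector[OF inv]) (rule that; blast)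
  have pow: "(mult_z ^^ p) \<phi> \<in> S" for p
    by (induction p) (auto simp: \<phi>(1) intro: invariantD(3)[OF inv])
  have "S \<subseteq> hclosure (disc_hilbert K) (cfun.span (range (\<lambda>p. (mult_z ^^ p) \<phi>)))"
  proof (rule total_in_subspace[OF assms(1)])
    show "range (\<lambda>p. (mult_z ^^ p) \<phi>) \<subseteq> S" using pow by blast
    fix x assume "x \<in> S" "\<And>a. a \<in> range (\<lambda>p. (mult_z ^^ p) \<phi>) \<Longrightarrow> ip (disc_hilbert K) x a = 0"
    then show "x = 0" by (intro \<phi>(2)) auto
  qed
  then show thesis using that \<phi>(1) pow by blast
qed

text \<open>The constant function 1 under extension by zero. It is cyclic for the whole disc space
  and so serves as the factor of a generator in all coordinates but one.\<close>

definition disc_one :: "complex \<Rightarrow> complex" where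
  "disc_one z = (if z \<in> ball 0 1 then 1 else 0)"

lemma mult_z_power: "(mult_z ^^ p) f = (\<lambda>z. z ^ p * f z)"
  by (induction p) (auto simp: mult_z_def mult.assoc)

lemma disc_one:
  shows "disc_one \<in> vecs (disc_hilbert K)"
    and "disc_coeff ((mult_z ^^ p) disc_one) m = (if m = p then 1 else 0)"
    and "vecs (disc_hilbert K) \<subseteq> hclosure (disc_hilbert K) (cfun.span (range (\<lambda>p. (mult_z ^^ p) disc_one)))"
proof -
  interpret shift_space "disc_hilbert K" disc_coeff K mult_z by (rule shift_space_disc)
  have hol: "disc_one holomorphic_on ball 0 1"
    by (rule holomorphic_transform[OF holomorphic_on_const[of 1]]) (simp add: disc_one_def)
  have "(\<lambda>_. 1) has_fps_expansion (1 :: complex fps)" by (rule has_fps_expansion_1)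
  moreover have ev: "\<forall>\<^sub>F z in nhds 0. disc_one z = 1"
    using eventually_nhds_in_open[of "ball 0 1" "0::complex"] by (auto elim!: eventually_mono simp: disc_one_def)
  ultimately have "disc_one has_fps_expansion 1" using has_fps_expansion_cong[OF ev refl] by blast
  then have e: "fps_expansion disc_one 0 = 1" by (rule fps_expansion_eqI)
  have "(\<lambda>m. weight K m * (cmod (disc_coeff disc_one m))\<^sup>2) summable_on UNIV"
    by (rule finite_summable[of "{0}"]) (simp_all add: e)
  then show v: "disc_one \<in> vecs (disc_hilbert K)" using hol by (simp add: vecs_disc_iff disc_one_def)
  show c: "disc_coeff ((mult_z ^^ p) disc_one) m = (if m = p then 1 else 0)" for p m
    by (simp add: c_M_pow[OF v] e)
  show "vecs (disc_hilbert K) \<subseteq> hclosure (disc_hilbert K) (cfun.span (range (\<lambda>p. (mult_z ^^ p) disc_one)))"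
  proof (rule total_in_subspace[OF closed_subspace_vecs])
    show "range (\<lambda>p. (mult_z ^^ p) disc_one) \<subseteq> vecs (disc_hilbert K)" using v by blast
    fix x assume x: "x \<in> vecs (disc_hilbert K)"
      and perp: "\<And>a. a \<in> range (\<lambda>p. (mult_z ^^ p) disc_one) \<Longrightarrow> ip (disc_hilbert K) x a = 0"
    have "disc_coeff x p = 0" for p
    proof -
      have "ip (disc_hilbert K) x ((mult_z ^^ p) disc_one) = of_real (weight K p) * disc_coeff x p"
        using ip_finite[OF x M_pow_vecs[OF v], of "{p}" p] by (simp add: c)
      then show ?thesis using perp[of "(mult_z ^^ p) disc_one"] weight_pos[of K p] by (simp add: less_imp_neq[symmetric])
    qed
    then show "x = 0" by (rule c_inj[OF x])
  qed
qed

lemma hnorm_elementary_tensor_update: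
  fixes K :: "'n::finite \<Rightarrow> disc_space"
  assumes h: "\<And>i. h i \<in> vecs (disc_hilbert (K i))" and x: "x \<in> vecs (disc_hilbert (K j))"
  shows "(hnorm (tensor_hilbert K) (elementary_tensor (h(j := x))))\<^sup>2
    \<le> (hnorm (disc_hilbert (K j)) x)\<^sup>2 * cmod (\<Prod>i\<in>UNIV - {j}. ip (disc_hilbert (K i)) (h i) (h i))"
proof -
  interpret T: weighted_space "tensor_hilbert K" power_series_coeff "tensor_weight K"
    by (rule weighted_space_tensor)
  interpret D: shift_space "disc_hilbert (K j)" disc_coeff "K j" mult_z by (rule shift_space_disc)
  have h': "(h(j := x)) i \<in> vecs (disc_hilbert (K i))" for i using h x by simp
  have "(\<Prod>i\<in>UNIV - {j}. ip (disc_hilbert (K i)) ((h(j := x)) i) ((h(j := x)) i))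
      = (\<Prod>i\<in>UNIV - {j}. ip (disc_hilbert (K i)) (h i) (h i))"
    by (rule prod.cong) auto
  then have "ip (tensor_hilbert K) (elementary_tensor (h(j := x))) (elementary_tensor (h(j := x)))
      = ip (disc_hilbert (K j)) x x * (\<Prod>i\<in>UNIV - {j}. ip (disc_hilbert (K i)) (h i) (h i))"
    unfolding ip_elementary_tensor[OF h' h'] by (subst prod.remove[of _ j]) auto
  then have "(hnorm (tensor_hilbert K) (elementary_tensor (h(j := x))))\<^sup>2
      \<le> cmod (ip (disc_hilbert (K j)) x x * (\<Prod>i\<in>UNIV - {j}. ip (disc_hilbert (K i)) (h i) (h i)))"
    using T.hnorm_sq[OF elementary_tensor_vecs(1)[OF h']] complex_Re_le_cmod by metis
  also have "cmod (ip (disc_hilbert (K j)) x x) = (hnorm (disc_hilbert (K j)) x)\<^sup>2"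
    using D.ip_self[OF x] D.hnorm_sq[OF x] D.ip_nonneg[OF x] by (metis abs_of_nonneg norm_of_real)
  ultimately show ?thesis by (simp add: norm_mult)
qed

text \<open>One factor at a time: with the others fixed, an elementary tensor depends linearly and
  continuously on the \<open>j\<close>-th, so the \<open>x\<close> for which it is orthogonal to
  \<open>g\<close> form a closed subspace containing \<open>A j\<close>.\<close>

lemma elementary_tensor_perp_closure:
  fixes K :: "'n::finite \<Rightarrow> disc_space"
  assumes g: "g \<in> vecs (tensor_hilbert K)" and A: "\<And>i. A i \<subseteq> vecs (disc_hilbert (K i))"
    and perp: "\<And>h. (\<And>i. h i \<in> A i) \<Longrightarrow> ip (tensor_hilbert K) (elementary_tensor h) g = 0"
    and h: "\<And>i. h i \<in> hclosure (disc_hilbert (K i)) (cfun.span (A i))"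
  shows "ip (tensor_hilbert K) (elementary_tensor h) g = 0"
proof -
  interpret T: weighted_space "tensor_hilbert K" power_series_coeff "tensor_weight K"
    by (rule weighted_space_tensor)
  let ?C = "\<lambda>i. hclosure (disc_hilbert (K i)) (cfun.span (A i))"
  have Cv: "?C i \<subseteq> vecs (disc_hilbert (K i))" for i by (auto simp: hclosure_def)
  \<comment> \<open>\<open>B\<close> collects the coordinates whose factor has already been extended
    from \<open>A i\<close> to its closed span.\<close>
  have "\<forall>h. (\<forall>i\<in>B. h i \<in> ?C i) \<longrightarrow> (\<forall>i\<in>-B. h i \<in> A i) \<longrightarrow> ip (tensor_hilbert K) (elementary_tensor h) g = 0" for B
  proof (induction B rule: infinite_finite_induct)
    case (infinite B)
    then show ?case by simp
  next
    case empty
    show ?case using perp by simp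
  next
    case (insert j B)
    show ?case
    proof (intro allI impI)
      fix h assume h1: "\<forall>i\<in>insert j B. h i \<in> ?C i" and h2: "\<forall>i\<in>-insert j B. h i \<in> A i"
      interpret D: shift_space "disc_hilbert (K j)" disc_coeff "K j" mult_z by (rule shift_space_disc)
      have hv: "h i \<in> vecs (disc_hilbert (K i))" for i
        using h1 h2 Cv[of i] A[of i] by (cases "i \<in> insert j B") blast+
      have uv: "elementary_tensor (h(j := x)) \<in> vecs (tensor_hilbert K)" if "x \<in> vecs (disc_hilbert (K j))" for x
        by (rule elementary_tensor_vecs(1)) (use hv that in simp)
      define Z where "Z = {x \<in> vecs (disc_hilbert (K j)). ip (tensor_hilbert K) (elementary_tensor (h(j := x))) g = 0}"
      have Zv: "Z \<subseteq> vecs (disc_hilbert (K j))" by (auto simp: Z_def)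
      have Zsub: "cfun.subspace Z"
        unfolding cfun.subspace_def
      proof (intro conjI ballI allI)
        have "elementary_tensor (h(j := 0)) = 0"
          by (rule ext) (simp add: elementary_tensor_update)
        then show "0 \<in> Z" using g by (simp add: Z_def)
      next
        fix x y assume "x \<in> Z" "y \<in> Z"
        then show "x + y \<in> Z"
          using uv T.ip_add[OF uv uv g] D.vecs_closed(2) by (auto simp: Z_def elementary_tensor_add)
      next
        fix k x assume "x \<in> Z"
        then show "cscale k x \<in> Z"
          using T.ip_scale[OF uv g] D.vecs_closed(4) by (auto simp: Z_def elementary_tensor_scale)
      qed
      have AZ: "A j \<subseteq> Z"
      proof
        fix x assume x: "x \<in> A j"
        have "ip (tensor_hilbert K) (elementary_tensor (h(j := x))) g = 0"
        proof (rule insert.IH[rule_format])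
          fix i assume "i \<in> B"
          then show "(h(j := x)) i \<in> ?C i" using h1 insert.hyps by auto
        next
          fix i assume "i \<in> -B"
          then show "(h(j := x)) i \<in> A i" using h2 x by (cases "i = j") auto
        qed
        then show "x \<in> Z" using x A[of j] by (auto simp: Z_def)
      qed
      have "f \<in> Z" if fc: "f \<in> hclosure (disc_hilbert (K j)) Z" for f
      proof -
        obtain X where X: "\<And>n::nat. X n \<in> Z" and fv: "f \<in> vecs (disc_hilbert (K j))"
          and lim: "(\<lambda>n. hnorm (disc_hilbert (K j)) (X n - f)) \<longlonglongrightarrow> 0"
          using iffD1[OF D.mem_hclosure_iff[OF Zv] fc] by auto
        have Xv: "X n \<in> vecs (disc_hilbert (K j))" for n using X Zv by blast
        let ?P = "cmod (\<Prod>i\<in>UNIV - {j}. ip (disc_hilbert (K i)) (h i) (h i))"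
        have bd: "hnorm (tensor_hilbert K) (elementary_tensor (h(j := X n)) - elementary_tensor (h(j := f)))
            \<le> hnorm (disc_hilbert (K j)) (X n - f) * sqrt ?P" for n
          unfolding elementary_tensor_diff[symmetric]
        proof (rule power2_le_imp_le)
          show "(hnorm (tensor_hilbert K) (elementary_tensor (h(j := X n - f))))\<^sup>2
              \<le> (hnorm (disc_hilbert (K j)) (X n - f) * sqrt ?P)\<^sup>2"
            using hnorm_elementary_tensor_update[where K = K and j = j and h = h, OF hv D.vecs_closed(3)[OF Xv fv], of n] by (simp add: power_mult_distrib)
          show "0 \<le> hnorm (disc_hilbert (K j)) (X n - f) * sqrt ?P"
            by (intro mult_nonneg_nonneg D.hnorm_nonneg D.vecs_closed(3) Xv fv) simp
        qed
        have t: "(\<lambda>n. hnorm (disc_hilbert (K j)) (X n - f) * sqrt ?P) \<longlonglongrightarrow> 0"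
          by (rule tendsto_mult_left_zero[OF lim])
        have "(\<lambda>n. hnorm (tensor_hilbert K) (elementary_tensor (h(j := X n)) - elementary_tensor (h(j := f)))) \<longlonglongrightarrow> 0"
        proof (rule tendsto_sandwich[OF _ _ tendsto_const t])
          show "\<forall>\<^sub>F n in sequentially. 0 \<le> hnorm (tensor_hilbert K) (elementary_tensor (h(j := X n)) - elementary_tensor (h(j := f)))"
            using T.hnorm_nonneg[OF T.vecs_closed(3)[OF uv[OF Xv] uv[OF fv]]] by (intro always_eventually allI)
        qed (intro always_eventually allI bd)
        from T.ip_tendsto_left[OF uv[OF Xv] uv[OF fv] g this]
        have "(\<lambda>n. ip (tensor_hilbert K) (elementary_tensor (h(j := X n))) g) \<longlonglongrightarrow> ip (tensor_hilbert K) (elementary_tensor (h(j := f))) g" .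
        moreover have "(\<lambda>n. ip (tensor_hilbert K) (elementary_tensor (h(j := X n))) g) = (\<lambda>n. 0)"
          using X by (auto simp: Z_def)
        ultimately have "ip (tensor_hilbert K) (elementary_tensor (h(j := f))) g = 0" by (simp add: LIMSEQ_const_iff)
        then show ?thesis using fv by (simp add: Z_def)
      qed
      moreover have "?C j \<subseteq> hclosure (disc_hilbert (K j)) Z"
        using cfun.span_minimal[OF AZ Zsub] unfolding hclosure_def by blast
      ultimately have "h j \<in> Z" using h1 by blast
      then show "ip (tensor_hilbert K) (elementary_tensor h) g = 0" by (simp add: Z_def)
    qed
  qed
  from this[of UNIV] show ?thesis using h by simp
qed

section \<open>The complement N of the tensor product\<close>

locale zero_based_tensor =
  fixes K :: "'n::finite \<Rightarrow> disc_space" and Q :: "'n \<Rightarrow> (complex \<Rightarrow> complex) set"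
  assumes Q_closed: "closed_subspace (disc_hilbert (K i)) (Q i)"
    and Q_proper: "Q i \<noteq> vecs (disc_hilbert (K i))"
    and Q_zero: "zero_based (disc_hilbert (K i)) (orth_compl (disc_hilbert (K i)) (Q i))"
begin

abbreviation D :: "'n \<Rightarrow> complex function_space" where "D i \<equiv> disc_hilbert (K i)"
abbreviation T :: "(complex ^ 'n) function_space" where "T \<equiv> tensor_hilbert K"
abbreviation S :: "'n \<Rightarrow> (complex \<Rightarrow> complex) set" where "S i \<equiv> orth_compl (D i) (Q i)"

definition N :: "(complex ^ 'n \<Rightarrow> complex) set" where
  "N = orth_compl T (tensor_subspace K Q)"

sublocale T: weighted_space "tensor_hilbert K" power_series_coeff "tensor_weight K"
  by (rule weighted_space_tensor)

sublocale D: shift_space "disc_hilbert (K i)" disc_coeff "K i" mult_z for i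
  by (rule shift_space_disc)

lemma Q_vecs: "q \<in> Q i \<Longrightarrow> q \<in> vecs (D i)"
  using D.closed_subspaceD(1)[OF Q_closed] by blast

lemma S_vecs: "s \<in> S i \<Longrightarrow> s \<in> vecs (D i)"
  by (simp add: orth_compl_def)

lemma S_closed: "closed_subspace (D i) (S i)" and S_mult: "mult_z ` S i \<subseteq> S i"
  using Q_zero[of i] by (simp_all add: zero_based_def)

lemma mem_QI:
  assumes "f \<in> vecs (D i)" "\<And>s. s \<in> S i \<Longrightarrow> ip (D i) s f = 0"
  shows "f \<in> Q i"
  by (rule D.mem_closed_subspaceI[OF Q_closed assms(1)])
    (use assms D.ip_eq_0_sym S_vecs in blast)

lemma elementary_Q_vecs: "(\<And>i. q i \<in> Q i) \<Longrightarrow> elementary_tensor q \<in> vecs T"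
  by (rule elementary_tensor_vecs(1)) (rule Q_vecs)

text \<open>Passing to span and closure does not change an orthogonal complement, so elementary
  tensors suffice as tests.\<close>

lemma mem_N_iff:
  "F \<in> N \<longleftrightarrow> F \<in> vecs T \<and> (\<forall>q. (\<forall>i. q i \<in> Q i) \<longrightarrow> ip T F (elementary_tensor q) = 0)"
proof -
  let ?X = "{elementary_tensor f | f. \<forall>i. f i \<in> Q i}"
  have X: "?X \<subseteq> vecs T" using elementary_Q_vecs by blast
  show ?thesis
  proof (intro iffI conjI allI impI)
    assume F: "F \<in> N"
    then show "F \<in> vecs T" by (simp add: N_def orth_compl_def)
    fix q assume "\<forall>i. q i \<in> Q i"
    then have "elementary_tensor q \<in> cfun.span ?X" by (intro cfun.span_base) blast
    then have "elementary_tensor q \<in> tensor_subspace K Q"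
      unfolding tensor_subspace_def using T.hclosure_superset[OF T.span_subset_vecs[OF X]] by blast
    then show "ip T F (elementary_tensor q) = 0" using F by (simp add: N_def orth_compl_def)
  next
    assume F: "F \<in> vecs T \<and> (\<forall>q. (\<forall>i. q i \<in> Q i) \<longrightarrow> ip T F (elementary_tensor q) = 0)"
    have "ip T F g = 0" if g: "g \<in> tensor_subspace K Q" for g
    proof -
      have "ip T g F = 0"
      proof (rule T.ip_span_eq_0[OF X])
        show "F \<in> vecs T" using F by blast
        show "ip T x F = 0" if "x \<in> ?X" for x
          using that F T.ip_eq_0_sym[of F x] X by blast
        show "g \<in> hclosure T (cfun.span ?X)" using g by (simp add: tensor_subspace_def)
      qed
      moreover have "g \<in> vecs T" using g by (simp add: tensor_subspace_def hclosure_def)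
      ultimately show ?thesis using T.ip_eq_0_sym F by blast
    qed
    then show "F \<in> N" using F by (simp add: N_def orth_compl_def)
  qed
qed

lemma N_closed: "closed_subspace T N"
  unfolding N_def by (rule T.closed_subspace_orth_compl) (auto simp: tensor_subspace_def hclosure_def)

text \<open>The adjoint of \<open>mult_z\<close> maps \<open>Q i\<close> into itself, because
  \<open>S i\<close> is invariant; so a test tensor with factors in the \<open>Q j\<close> is turned
  into another one.\<close>

lemma mult_coord_N:
  assumes F: "F \<in> N" shows "mult_coord i F \<in> N"
proof -
  have Fv: "F \<in> vecs T" using F mem_N_iff by blast
  have "ip T (mult_coord i F) (elementary_tensor q) = 0" if q: "\<forall>i. q i \<in> Q i" for q
  proof -
    have qv: "q j \<in> vecs (D j)" for j using q Q_vecs by blast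
    obtain q' where q': "q' \<in> vecs (D i)" "\<And>f. f \<in> vecs (D i) \<Longrightarrow> ip (D i) (mult_z f) (q i) = ip (D i) f q'"
      using D.adjoint_exists[OF qv] by metis
    have "q' \<in> Q i"
    proof (rule mem_QI[OF q'(1)])
      fix s assume s: "s \<in> S i"
      then have "mult_z s \<in> S i" using S_mult by blast
      then show "ip (D i) s q' = 0" using q'(2)[OF S_vecs[OF s]] q by (simp add: orth_compl_def)
    qed
    then have "\<forall>j. (q(i := q')) j \<in> Q j" using q by simp
    then show ?thesis
      using F mem_N_iff ip_mult_coord_elementary_tensor[OF Fv qv q'] by simp
  qed
  then show ?thesis using mult_coord_vecs(1)[OF Fv] mem_N_iff by blast
qed

lemma elementary_tensor_N:
  assumes "\<And>j. h j \<in> vecs (D j)" "h i \<in> S i"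
  shows "elementary_tensor h \<in> N"
proof -
  have "ip T (elementary_tensor h) (elementary_tensor q) = 0" if q: "\<forall>i. q i \<in> Q i" for q
  proof -
    have "ip (D i) (h i) (q i) = 0" using assms(2) q by (simp add: orth_compl_def)
    then show ?thesis
      using ip_elementary_tensor[of h K q] assms(1) Q_vecs q by (auto simp: prod_zero_iff)
  qed
  moreover have "elementary_tensor h \<in> vecs T" by (rule elementary_tensor_vecs(1)[OF assms(1)])
  ultimately show ?thesis by (simp add: mem_N_iff)
qed

text \<open>Expand the monomials along \<open>D i = S i \<oplus> Q i\<close>: every term but the one in all the \<open>Q i\<close> has a factor in some \<open>S i\<close>.\<close>

lemma N_eq_0I:
  assumes g: "g \<in> N"
    and perp: "\<And>i h. (\<And>j. h j \<in> vecs (D j)) \<Longrightarrow> h i \<in> S i \<Longrightarrow> ip T (elementary_tensor h) g = 0"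
  shows "g = 0"
proof -
  have gv: "g \<in> vecs T" using g mem_N_iff by blast
  \<comment> \<open>\<open>B\<close> is the set of coordinates whose factor is unrestricted; for
    empty \<open>B\<close> the tensor is orthogonal to \<open>g\<close> because \<open>g\<close>
    lies in \<open>N\<close>.\<close>
  have "\<forall>h. (\<forall>i\<in>B. h i \<in> vecs (D i)) \<longrightarrow> (\<forall>i\<in>-B. h i \<in> Q i) \<longrightarrow> ip T (elementary_tensor h) g = 0" for B
  proof (induction B rule: infinite_finite_induct)
    case (infinite B)
    then show ?case by simp
  next
    case empty
    show ?case using g mem_N_iff T.ip_eq_0_sym[OF gv elementary_Q_vecs] by simp
  next
    case (insert j B)
    show ?case
    proof (intro allI impI)
      fix h assume h1: "\<forall>i\<in>insert j B. h i \<in> vecs (D i)" and h2: "\<forall>i\<in>-insert j B. h i \<in> Q i"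
      have hv: "h i \<in> vecs (D i)" for i using h1 h2 Q_vecs by (cases "i \<in> insert j B") auto
      obtain q where q: "q \<in> Q j" "h j - q \<in> S j" using D.projection[OF Q_closed hv] .
      have s: "h j - q \<in> vecs (D j)" and qv: "q \<in> vecs (D j)" using q S_vecs Q_vecs by auto
      have e1: "ip T (elementary_tensor (h(j := h j - q))) g = 0"
        by (rule perp[of _ j]) (use hv s q(2) in auto)
      have e2: "ip T (elementary_tensor (h(j := q))) g = 0"
      proof (rule insert.IH[rule_format])
        fix i assume "i \<in> B"
        then show "(h(j := q)) i \<in> vecs (D i)" using h1 insert.hyps by auto
      next
        fix i assume "i \<in> -B"
        then show "(h(j := q)) i \<in> Q i" using h2 q(1) by (cases "i = j") auto
      qed
      have "h = h(j := (h j - q) + q)" by auto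
      then have "elementary_tensor h = elementary_tensor (h(j := h j - q)) + elementary_tensor (h(j := q))"
        using elementary_tensor_add by metis
      moreover have "elementary_tensor (h(j := h j - q)) \<in> vecs T" "elementary_tensor (h(j := q)) \<in> vecs T"
        using hv s qv by (auto intro!: elementary_tensor_vecs(1))
      ultimately show "ip T (elementary_tensor h) g = 0" using T.ip_add[OF _ _ gv] e1 e2 by simp
    qed
  qed
  from this[of UNIV] have all: "ip T (elementary_tensor h) g = 0" if "\<And>i. h i \<in> vecs (D i)" for h
    using that by simp
  have "power_series_coeff g \<alpha> = 0" for \<alpha>
  proof -
    let ?m = "\<lambda>i. (mult_z ^^ \<alpha> i) disc_one"
    have mv: "?m i \<in> vecs (D i)" for i by (intro D.M_pow_vecs disc_one(1))
    have c: "power_series_coeff (elementary_tensor ?m) \<beta> = (if \<beta> = \<alpha> then 1 else 0)" for \<beta>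
      unfolding elementary_tensor_vecs(2)[OF mv] disc_one(2) by (auto simp: fun_eq_iff)
    have "ip T g (elementary_tensor ?m) = of_real (tensor_weight K \<alpha>) * power_series_coeff g \<alpha>"
      using T.ip_finite[OF gv elementary_tensor_vecs(1)[OF mv], of "{\<alpha>}"] by (simp add: c)
    moreover have "ip T g (elementary_tensor ?m) = 0"
      using all[OF mv] T.ip_eq_0_sym[OF gv elementary_tensor_vecs(1)[OF mv]] by blast
    ultimately show ?thesis using T.w_pos[of \<alpha>] by (simp add: less_imp_neq[symmetric])
  qed
  then show ?thesis by (rule T.c_inj[OF gv])
qed

lemma tuple_power_closed:
  assumes "\<And>j F. F \<in> W \<Longrightarrow> mult_coord j F \<in> W" and g: "g \<in> W"
  shows "tuple_power mult_coord (k :: 'n \<Rightarrow> nat) g \<in> W"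
proof -
  interpret comp_fun_commute "\<lambda>i. mult_coord i ^^ k i"
    by unfold_locales (auto simp: mult_coord_power fun_eq_iff)
  have pow: "(mult_coord i ^^ m) F \<in> W" if "F \<in> W" for i m F
    by (induction m) (auto simp: that assms(1))
  have "Finite_Set.fold (\<lambda>i. mult_coord i ^^ k i) g A \<in> W" if "finite A" for A
    using that
  proof (induction A rule: finite_induct)
    case (insert x A)
    show ?case unfolding fold_insert[OF insert.hyps] by (rule pow[OF insert.IH])
  qed (simp add: g)
  then show ?thesis by (simp add: tuple_power_def)
qed

lemmas tuple_power_N = tuple_power_closed[of N, OF mult_coord_N]

text \<open>\<open>N\<close> is closed, so the closure formed in the subspace agrees with the one in
  the full tensor product.\<close>

lemma generated_N: "generated (T\<lparr>vecs := N\<rparr>) mult_coord G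
    = hclosure T (cfun.span {tuple_power mult_coord k g | k g. g \<in> G})" if "G \<subseteq> N"
proof -
  have "{tuple_power mult_coord k g | k g. g \<in> G} \<subseteq> N" using that tuple_power_N by blast
  then have "cfun.span {tuple_power mult_coord k g | k g. g \<in> G} \<subseteq> N"
    by (rule cfun.span_minimal[OF _ T.closed_subspaceD(2)[OF N_closed]])
  then have "hclosure T (cfun.span {tuple_power mult_coord k g | k g. g \<in> G}) \<subseteq> hclosure T N"
    unfolding hclosure_def by blast
  also have "\<dots> = N" using N_closed by (simp add: closed_subspace_def)
  finally have "hclosure T (cfun.span {tuple_power mult_coord k g | k g. g \<in> G}) \<subseteq> N" .
  moreover have "hclosure (T\<lparr>vecs := N\<rparr>) X = hclosure T X \<inter> N" for X
    using T.closed_subspaceD(1)[OF N_closed] by (auto simp: hclosure_def hnorm_def)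
  ultimately show ?thesis by (auto simp: generated_def)
qed

section \<open>Generating N by n elements\<close>

lemma generators_of_complement:
  "\<exists>G. G \<subseteq> N \<and> generated (T\<lparr>vecs := N\<rparr>) mult_coord G = N \<and> finite G \<and> card G \<le> CARD('n)"
proof -
  have "\<exists>\<phi>. \<phi> \<in> S i \<and> (\<forall>p. (mult_z ^^ p) \<phi> \<in> S i)
      \<and> S i \<subseteq> hclosure (D i) (cfun.span (range (\<lambda>p. (mult_z ^^ p) \<phi>)))" for i
    using disc_cyclic_vector[OF S_closed S_mult, of i] by metis
  then obtain \<phi> where \<phi>: "\<And>i. \<phi> i \<in> S i" "\<And>i p. (mult_z ^^ p) (\<phi> i) \<in> S i"
    "\<And>i. S i \<subseteq> hclosure (D i) (cfun.span (range (\<lambda>p. (mult_z ^^ p) (\<phi> i))))"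
    by metis
  \<comment> \<open>On the polydisc, \<open>elementary_tensor (e i)\<close> is the function
    \<open>\<phi> i (z $ i)\<close>.\<close>
  define e where "e i = (\<lambda>_::'n. disc_one)(i := \<phi> i)" for i
  have ev: "e i j \<in> vecs (D j)" for i j using S_vecs[OF \<phi>(1)] disc_one(1) by (simp add: e_def)
  define G where "G = range (\<lambda>i. elementary_tensor (e i))"
  have "e i i \<in> S i" for i using \<phi>(1) by (simp add: e_def)
  then have "elementary_tensor (e i) \<in> N" for i by (rule elementary_tensor_N[OF ev])
  then have GN: "G \<subseteq> N" by (auto simp: G_def)
  let ?Y = "{tuple_power mult_coord k g | k g. g \<in> G}"
  have YN: "?Y \<subseteq> N" using GN tuple_power_N by blast
  have "N \<subseteq> hclosure T (cfun.span ?Y)"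
  proof (rule T.total_in_subspace[OF N_closed YN])
    fix g assume g: "g \<in> N" and perp: "\<And>a. a \<in> ?Y \<Longrightarrow> ip T g a = 0"
    have gv: "g \<in> vecs T" using g mem_N_iff by blast
    show "g = 0"
    proof (rule N_eq_0I[OF g])
      fix i h assume hv: "\<And>j. h j \<in> vecs (D j)" and hi: "h i \<in> S i"
      \<comment> \<open>Tensors with factors in the \<open>A j\<close> are the monomial multiples of
        \<open>elementary_tensor (e i)\<close>, and the closed span of \<open>A j\<close> contains
        \<open>h j\<close>.\<close>
      define A where "A j = range (\<lambda>p. (mult_z ^^ p) (e i j))" for j
      show "ip T (elementary_tensor h) g = 0"
      proof (rule elementary_tensor_perp_closure[OF gv, where A = A])
        show "A j \<subseteq> vecs (D j)" for j unfolding A_def using ev by blast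
        show "h j \<in> hclosure (D j) (cfun.span (A j))" for j
          using \<phi>(3)[of i] hi disc_one(3)[of "K j"] hv[of j] by (cases "j = i") (auto simp: A_def e_def)
        fix a assume "\<And>j. a j \<in> A j"
        then have "\<forall>j. \<exists>p. a j = (mult_z ^^ p) (e i j)" by (auto simp: A_def)
        then obtain k where k: "\<And>j. a j = (mult_z ^^ k j) (e i j)" by metis
        have "elementary_tensor a = tuple_power mult_coord k (elementary_tensor (e i))"
          unfolding tuple_power_mult_coord
          by (rule ext) (simp add: elementary_tensor_def k mult_z_power monomial_def prod.distrib)
        then have "elementary_tensor a \<in> ?Y" by (auto simp: G_def)
        then show "ip T (elementary_tensor a) g = 0"
          using perp T.ip_eq_0_sym[OF gv] YN mem_N_iff by blast
      qed
    qed
  qed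
  moreover have "generated (T\<lparr>vecs := N\<rparr>) mult_coord G \<subseteq> N" by (auto simp: generated_def hclosure_def)
  ultimately have "generated (T\<lparr>vecs := N\<rparr>) mult_coord G = N" using generated_N[OF GN] by blast
  moreover have "finite G" "card G \<le> CARD('n)" by (simp_all add: G_def card_image_le)
  ultimately show ?thesis using GN by blast
qed

section \<open>Joint eigenfunctionals and the lower bound for generators\<close>

lemma card_generators_ge:
  assumes GN: "G \<subseteq> N" and gen: "generated (T\<lparr>vecs := N\<rparr>) mult_coord G = N" and fin: "finite G"
  shows "CARD('n) \<le> card G"
proof -
  have "\<exists>l. l \<in> ball 0 1 \<and> (\<forall>f\<in>S i. f l = 0)" for i
    using Q_zero[of i] unfolding zero_based_def by blast
  then obtain l where l: "\<And>i. l i \<in> ball 0 1" and l0: "\<And>i f. f \<in> S i \<Longrightarrow> f (l i) = 0" by metis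
  have "\<exists>k. k \<in> vecs (D i) \<and> (\<forall>f\<in>vecs (D i). ip (D i) f k = f (l i))
      \<and> (\<forall>f\<in>vecs (D i). ip (D i) (mult_z f) k = l i * ip (D i) f k)" for i
    using disc_eval_kernel[OF l[of i], where K = "K i"] by metis
  then have "\<exists>k. \<forall>i. k i \<in> vecs (D i) \<and> (\<forall>f\<in>vecs (D i). ip (D i) f (k i) = f (l i))
      \<and> (\<forall>f\<in>vecs (D i). ip (D i) (mult_z f) (k i) = l i * ip (D i) f (k i))"
    by (intro choice allI)
  then obtain k where kv: "\<And>i. k i \<in> vecs (D i)" and k: "\<And>i f. f \<in> vecs (D i) \<Longrightarrow> ip (D i) f (k i) = f (l i)"
    and kz: "\<And>i f. f \<in> vecs (D i) \<Longrightarrow> ip (D i) (mult_z f) (k i) = l i * ip (D i) f (k i)"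
    by (rule exE) (rule that; blast)
  \<comment> \<open>The kernel at a common zero of \<open>S i\<close> is orthogonal to
    \<open>S i\<close>.\<close>
  have kQ: "k i \<in> Q i" for i
    by (rule mem_QI[OF kv]) (simp add: k[OF S_vecs] l0)
  have "\<exists>e. e \<in> S i \<and> e \<noteq> 0 \<and> (\<forall>s\<in>S i. ip (D i) (mult_z s - cscale (l i) s) e = 0)" for i
  proof -
    have "\<exists>f\<in>S i. f \<noteq> 0"
    proof (rule ccontr)
      assume "\<not> ?thesis"
      then have "vecs (D i) \<subseteq> Q i" using mem_QI by fastforce
      then show False using Q_proper Q_vecs by blast
    qed
    then obtain f where f: "f \<in> S i" "f \<noteq> 0" by blast
    obtain e where "e \<in> S i" "e \<noteq> 0" "\<And>s. s \<in> S i \<Longrightarrow> ip (D i) (mult_z s - cscale (l i) s) e = 0"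
      by (rule codimension_at_point[OF S_closed S_mult f l[of i]]) (rule that; blast)
    then show ?thesis by blast
  qed
  then have "\<exists>e. \<forall>i. e i \<in> S i \<and> e i \<noteq> 0 \<and> (\<forall>s\<in>S i. ip (D i) (mult_z s - cscale (l i) s) (e i) = 0)"
    by (intro choice allI)
  then obtain e where eS: "\<And>i. e i \<in> S i" and e0: "\<And>i. e i \<noteq> 0"
    and e: "\<And>i s. s \<in> S i \<Longrightarrow> ip (D i) (mult_z s - cscale (l i) s) (e i) = 0"
    by (rule exE) (rule that; blast)
  have ev: "e i \<in> vecs (D i)" for i by (rule S_vecs[OF eS])
  define h where "h i = k(i := e i)" for i
  have hv: "h i j \<in> vecs (D j)" for i j using kv ev by (simp add: h_def)
  define E where "E i = elementary_tensor (h i)" for i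
  have Ev: "E i \<in> vecs T" for i unfolding E_def by (rule elementary_tensor_vecs(1)[OF hv])
  have scaled: "ip T F (elementary_tensor ((h i)(j := cscale (cnj (l j)) (h i j)))) = l j * ip T F (E i)"
    if F: "F \<in> vecs T" for F i j
  proof -
    have "(h i)(j := h i j) = h i" by simp
    then have e: "elementary_tensor ((h i)(j := cscale (cnj (l j)) (h i j))) = cscale (cnj (l j)) (E i)"
      unfolding elementary_tensor_scale by (simp add: E_def)
    show ?thesis unfolding e T.ip_scale_right[OF Ev F] by simp
  qed
  have eig: "ip T (mult_coord j F) (E i) = l j * ip T F (E i)" if F: "F \<in> N" for F i j
  proof (cases "j = i")
    case False
    have Fv: "F \<in> vecs T" using F by (simp add: mem_N_iff)
    \<comment> \<open>The kernel \<open>k j\<close> is an eigenvector of the adjoint of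
      \<open>mult_z\<close> with eigenvalue \<open>cnj (l j)\<close>.\<close>
    have hk: "h i j = k j" using False by (simp add: h_def)
    have sv: "cscale (cnj (l j)) (h i j) \<in> vecs (D j)" using hv by (rule D.vecs_closed(4))
    have "ip (D j) (mult_z f) (h i j) = ip (D j) f (cscale (cnj (l j)) (h i j))" if f: "f \<in> vecs (D j)" for f
      unfolding hk kz[OF f] D.ip_scale_right[OF kv f] by simp
    then have "ip T (mult_coord j F) (E i) = ip T F (elementary_tensor ((h i)(j := cscale (cnj (l j)) (h i j))))"
      unfolding E_def by (rule ip_mult_coord_elementary_tensor[OF Fv hv sv])
    then show ?thesis using scaled[OF Fv] by simp
  next
    case True
    have Fv: "F \<in> vecs T" using F by (simp add: mem_N_iff)
    have hi: "h i i = e i" by (simp add: h_def)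
    obtain e' where e': "e' \<in> vecs (D i)" "\<And>f. f \<in> vecs (D i) \<Longrightarrow> ip (D i) (mult_z f) (h i i) = ip (D i) f e'"
      using D.adjoint_exists[OF hv[of i i]] by metis
    have sv: "cscale (cnj (l i)) (h i i) \<in> vecs (D i)" using hv by (rule D.vecs_closed(4))
    \<comment> \<open>\<open>d\<close> is the defect of \<open>e i\<close> from being an eigenvector
      of the adjoint. As \<open>e i\<close> is orthogonal to \<open>(z - l i) S i\<close>, it lies
      in \<open>Q i\<close>; then its tensor with the kernels has all factors in the
      \<open>Q j\<close> and is orthogonal to \<open>F\<close>.\<close>
    define d where "d = e' - cscale (cnj (l i)) (h i i)"
    have dv: "d \<in> vecs (D i)" unfolding d_def by (rule D.vecs_closed(3)[OF e'(1) sv])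
    have "d \<in> Q i"
    proof (rule mem_QI[OF dv])
      fix s assume s: "s \<in> S i"
      note s' = S_vecs[OF s]
      have "ip (D i) s d = ip (D i) (mult_z s) (e i) - l i * ip (D i) s (e i)"
        unfolding d_def D.ip_diff_right[OF e'(1) sv s'] e'(2)[OF s', symmetric] D.ip_scale_right[OF hv s']
        unfolding hi by simp
      also have "\<dots> = ip (D i) (mult_z s - cscale (l i) s) (e i)"
        unfolding D.ip_diff[OF D.M_vecs[OF s'] D.vecs_closed(4)[OF s'] ev] D.ip_scale[OF s' ev] ..
      finally show "ip (D i) s d = 0" using e[OF s] by simp
    qed
    then have "\<forall>j. ((h i)(i := d)) j \<in> Q j" using kQ by (simp add: h_def)
    then have F0: "ip T F (elementary_tensor ((h i)(i := d))) = 0" using F mem_N_iff by blast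
    have "((h i)(i := d)) j \<in> vecs (D j)" for j using hv dv by simp
    then have v1: "elementary_tensor ((h i)(i := d)) \<in> vecs T" by (rule elementary_tensor_vecs(1))
    have "((h i)(i := cscale (cnj (l i)) (h i i))) j \<in> vecs (D j)" for j using hv sv by simp
    then have v2: "elementary_tensor ((h i)(i := cscale (cnj (l i)) (h i i))) \<in> vecs T" by (rule elementary_tensor_vecs(1))
    have e'd: "e' = d + cscale (cnj (l i)) (h i i)" by (simp add: d_def)
    have "ip T (mult_coord i F) (E i) = ip T F (elementary_tensor ((h i)(i := e')))"
      unfolding E_def by (rule ip_mult_coord_elementary_tensor[where K = K and i = i and h = "h i", OF Fv hv e'])
    also have "\<dots> = l i * ip T F (E i)"
      unfolding e'd elementary_tensor_add T.ip_add_right[OF v1 v2 Fv] F0 scaled[OF Fv] by simp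
    finally show ?thesis using True by simp
  qed

  define L where "L F = (\<chi> i. ip T F (E i))" for F
  have L_add: "L (F + F') = L F + L F'" if "F \<in> vecs T" "F' \<in> vecs T" for F F'
    by (simp add: L_def vec_eq_iff T.ip_add[OF that Ev])
  have L_scale: "L (cscale a F) = a *s L F" if "F \<in> vecs T" for F a
    by (simp add: L_def vec_eq_iff T.ip_scale[OF that Ev])
  have L_mult: "L (mult_coord j F) = l j *s L F" if "F \<in> N" for F j
    by (simp add: L_def vec_eq_iff eig[OF that])
  define V where "V = vec.span (L ` G)"
  have Vadd: "x + y \<in> V" if "x \<in> V" "y \<in> V" for x y using that unfolding V_def by (rule vec.span_add)
  have Vscale: "a *s x \<in> V" if "x \<in> V" for a x using that unfolding V_def by (rule vec.span_scale)
  have V0: "0 \<in> V" unfolding V_def by (rule vec.span_zero)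
  \<comment> \<open>\<open>V\<close> is also a real subspace of a finite-dimensional space.\<close>
  have "closed V"
  proof (rule closed_subspace)
    have "r *\<^sub>R x = complex_of_real r *s x" for r and x :: "complex ^ 'n"
      unfolding vec_eq_iff vector_scaleR_component vector_smult_component
      by (intro allI scaleR_conv_of_real)
    then show "subspace V" using Vadd Vscale V0 by (simp add: subspace_def)
  qed
  \<comment> \<open>Since \<open>L\<close> turns each coordinate multiplication into a scalar,
    \<open>W\<close> is invariant and contains \<open>G\<close>; closedness of \<open>V\<close> and
    continuity of \<open>L\<close> then make it all of \<open>N\<close>.\<close>
  define W where "W = {F \<in> N. L F \<in> V}"
  note Nsub = T.closed_subspaceD(2)[OF N_closed]
  have Nv: "F \<in> vecs T" if "F \<in> N" for F using that by (simp add: mem_N_iff)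
  have Wsub: "cfun.subspace W"
    unfolding cfun.subspace_def
  proof (intro conjI ballI allI)
    have "L 0 = 0" unfolding L_def vec_eq_iff by (simp add: T.ip_zero(1)[OF Ev])
    then show "0 \<in> W" using cfun.subspace_0[OF Nsub] V0 by (simp add: W_def)
  next
    fix x y assume "x \<in> W" "y \<in> W"
    then show "x + y \<in> W" using cfun.subspace_add[OF Nsub] L_add[OF Nv Nv] Vadd by (auto simp: W_def)
  next
    fix a x assume "x \<in> W"
    then show "cscale a x \<in> W" using cfun.subspace_scale[OF Nsub] L_scale[OF Nv] Vscale by (auto simp: W_def)
  qed
  have WM: "mult_coord j F \<in> W" if "F \<in> W" for F j
    using that mult_coord_N L_mult Vscale by (auto simp: W_def)
  have GW: "G \<subseteq> W" using GN vec.span_base[of _ "L ` G"] by (auto simp: W_def V_def)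
  let ?Y = "{tuple_power mult_coord k g | k g. g \<in> G}"
  have "?Y \<subseteq> W" using tuple_power_closed[of W, OF WM] GW by blast
  then have spW: "cfun.span ?Y \<subseteq> W" by (rule cfun.span_minimal[OF _ Wsub])
  have LV: "L F \<in> V" if F: "F \<in> N" for F
  proof -
    have Wv: "W \<subseteq> vecs T" using Nv by (auto simp: W_def)
    have "F \<in> hclosure T (cfun.span ?Y)" using F gen generated_N[OF GN] by simp
    then have "F \<in> hclosure T W" using spW unfolding hclosure_def by blast
    then have "\<exists>X::nat \<Rightarrow> _. range X \<subseteq> W \<and> (\<lambda>n. hnorm T (X n - F)) \<longlonglongrightarrow> 0"
      unfolding T.mem_hclosure_iff[OF Wv] by (rule conjunct2)
    then obtain X :: "nat \<Rightarrow> _" where "range X \<subseteq> W" and lim: "(\<lambda>n. hnorm T (X n - F)) \<longlonglongrightarrow> 0"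
      by (elim exE conjE) (rule that)
    then have X: "X n \<in> W" for n by blast
    have conv: "(\<lambda>n. L (X n)) \<longlonglongrightarrow> L F"
      unfolding L_def using X Wv
      by (intro tendsto_vec_lambda T.ip_tendsto_left[OF _ Nv[OF F] Ev lim]) auto
    have "L (X n) \<in> V" for n using X by (simp add: W_def)
    then show ?thesis by (rule closed_sequentially[OF \<open>closed V\<close> _ conv])
  qed
  \<comment> \<open>Pairing the tensor of \<open>e i\<close> and ones with \<open>E j\<close> for
    \<open>j \<noteq> i\<close> produces the factor \<open>ip (D i) (e i) (k i)\<close>, the value
    of \<open>e i\<close> at its zero \<open>l i\<close>; for \<open>j = i\<close> the remaining
    factors are values of the function 1.\<close>
  have axis: "axis i 1 \<in> V" for i
  proof -
    define f where "f = (\<lambda>_::'n. disc_one)(i := e i)"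
    have fv: "f j \<in> vecs (D j)" for j using ev disc_one(1) by (simp add: f_def)
    have fN: "elementary_tensor f \<in> N" by (rule elementary_tensor_N[OF fv, of i]) (simp add: f_def eS)
    define a where "a = ip (D i) (e i) (e i)"
    have a0: "a \<noteq> 0" using D.ip_definite[OF ev[of i]] e0[of i] by (metis a_def zero_complex.simps(1))
    have "ip T (elementary_tensor f) (E j) = (if j = i then a else 0)" for j
    proof -
      have p: "ip T (elementary_tensor f) (E j) = (\<Prod>m\<in>UNIV. ip (D m) (f m) (h j m))"
        unfolding E_def by (rule ip_elementary_tensor[OF fv hv])
      show ?thesis
      proof (cases "j = i")
        case True
        have "ip (D m) (f m) (h j m) = 1" if "m \<noteq> i" for m
          using that True k[OF disc_one(1), of m] l[of m] by (simp add: f_def h_def disc_one_def)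
        then have "(\<Prod>m\<in>UNIV - {i}. ip (D m) (f m) (h j m)) = 1" by (intro prod.neutral) auto
        then show ?thesis
          unfolding p using True by (subst prod.remove[of _ i]) (auto simp: f_def h_def a_def)
      next
        case False
        have "ip (D i) (f i) (h j i) = 0" using False k[OF ev, of i] l0[OF eS] by (simp add: f_def h_def)
        then show ?thesis unfolding p using False by (auto simp: prod_zero_iff)
      qed
    qed
    then have "L (elementary_tensor f) = a *s axis i 1"
      by (auto simp: L_def vec_eq_iff axis_def)
    then have "axis i 1 = (1 / a) *s L (elementary_tensor f)" using a0 by (simp add: vec_eq_iff)
    then show ?thesis using Vscale[OF LV[OF fN]] by simp
  qed
  have "x \<in> V" for x :: "complex ^ 'n"
  proof -
    have "(\<Sum>i\<in>UNIV. (x $ i) *s axis i 1) \<in> V"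
      unfolding V_def by (intro vec.span_sum vec.span_scale) (use axis V_def in simp)
    then show ?thesis by (simp add: basis_expansion)
  qed
  then have "(UNIV :: (complex ^ 'n) set) \<subseteq> vec.span (L ` G)" by (auto simp: V_def)
  then have "vec.dim (UNIV :: (complex ^ 'n) set) \<le> card (L ` G)"
    using fin by (intro vec.dim_le_card) auto
  also have "\<dots> \<le> card G" by (rule card_image_le[OF fin])
  finally show ?thesis unfolding vec_dim_card .
qed

end

theorem corollary5p3:
  fixes K :: "'n::finite \<Rightarrow> disc_space"
    and Q :: "'n \<Rightarrow> (complex \<Rightarrow> complex) set"
  assumes "CARD('n) \<ge> 2"
    and "\<And>i. closed_subspace (disc_hilbert (K i)) (Q i)"
    and "\<And>i. Q i \<noteq> vecs (disc_hilbert (K i))"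
    and "\<And>i. adjoint_op (disc_hilbert (K i)) mult_z ` Q i \<subseteq> Q i"
    and "\<And>i. zero_based (disc_hilbert (K i)) (orth_compl (disc_hilbert (K i)) (Q i))"
  shows "tuple_multiplicity
           ((tensor_hilbert K)\<lparr>vecs := orth_compl (tensor_hilbert K) (tensor_subspace K Q)\<rparr>)
           mult_coord = enat CARD('n)"
proof -
  interpret zero_based_tensor K Q
    by unfold_locales (fact assms)+
  let ?M = "(tensor_hilbert K)\<lparr>vecs := N\<rparr>"
  let ?f = "\<lambda>G. if finite G then enat (card G) else \<infinity>"
  have "tuple_multiplicity ?M mult_coord = enat CARD('n)"
  proof (rule antisym)
    obtain G where "G \<subseteq> N" "generated ?M mult_coord G = N" "finite G" "card G \<le> CARD('n)"
      using generators_of_complement by blast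
    then show "tuple_multiplicity ?M mult_coord \<le> enat CARD('n)"
      unfolding tuple_multiplicity_def by (intro INF_lower2[of G]) auto
    \<comment> \<open>Infinite generating sets enter the infimum with value infinity, so only finite
      \<open>G\<close> have to be bounded below.\<close>
    show "enat CARD('n) \<le> tuple_multiplicity ?M mult_coord"
      unfolding tuple_multiplicity_def by (rule INF_greatest) (auto intro: card_generators_ge)
  qed
  then show ?thesis by (simp add: N_def)
qed

end
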